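(* Assume $-\frac{\pi}{4}<\theta<\frac{\pi}{4}$, $\alpha>0$ and $\gamma<0$. Let $u_0\in H^1(\mathbb{R}^N)\cap C_0(\mathbb{R}^N)$ and let $u\in C([0,T_{\max}),H^1(\mathbb{R}^N)\cap C_0(\mathbb{R}^N))$ be the corresponding maximal solution of $$u_t=e^{i\theta}\left[\Delta u+|u|^\alpha u\right]+\gamma u,\qquad u(0)=u_0,$$ in $\mathbb{R}^N$. Suppose further that $$(\alpha+2)\cos(2\theta)+2(1-\cos\theta)\ge 2\cos\theta.$$ If $$E(u_0)+\xi\int_{\mathbb{R}^N}|u_0|^2<0,$$ where $$E(w)=\frac12\int_{\mathbb{R}^N}|\nabla w|^2-\frac{1}{\alpha+2}\int_{\mathbb{R}^N}|w|^{\alpha+2}$$ and $$\xi=-\frac{\gamma}{\cos\theta}\max\left\{\frac1\alpha,\ \frac{(\alpha+2)\cos(2\theta)+2(1-\cos\theta)}{2}\right\},$$ then $u$ blows up in finite time, i.e., $T_{\max}<\infty$.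
   Context: $N\ge 1$ is an integer; functions are complex-valued. $C_0(\mathbb{R}^N)$ is the space of continuous functions $\mathbb{R}^N\to\mathbb{C}$ vanishing at infinity, with the sup norm; $H^1(\mathbb{R}^N)\cap C_0(\mathbb{R}^N)$ carries the natural intersection topology. Maximal solution: for $-\frac{\pi}{2}<\theta<\frac{\pi}{2}$, $\alpha>0$, $\gamma\in\mathbb{R}$, the Cauchy problem is locally well-posed in $H^1(\mathbb{R}^N)\cap C_0(\mathbb{R}^N)$. For every $u_0$ in this space there is a unique solution $u$, defined on a maximal interval $[0,T_{\max})$ with $0<T_{\max}\le\infty$, such that $u\in C([0,T_{\max}),C_0(\mathbb{R}^N)\cap H^1(\mathbb{R}^N))\cap C((0,T_{\max}),H^2(\mathbb{R}^N))\cap C^1((0,T_{\max}),L^2(\mathbb{R}^N))$, $u$ satisfies the equation for all $t\in(0,T_{\max})$, and $u(0)=u_0$. If $T_{\max}<\infty$, then $\|u(t)\|_{L^\infty}\to\infty$ as $t\uparrow T_{\max}$. *)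

theory Defs
  imports "HOL-Analysis.Analysis"
begin

subsection \<open>Function spaces\<close>

text \<open>
  Elements of \<open>L\<^sup>2\<close>, \<open>H\<^sup>1\<close> and \<open>H\<^sup>2\<close> are represented by Borel measurable functions and are
  to be read modulo equality almost everywhere; every class of Lebesgue measurable functions
  has a Borel representative.
\<close>

definition L2 :: "('a::euclidean_space \<Rightarrow> complex) set" where
  "L2 = {f \<in> borel_measurable lborel. integrable lborel (\<lambda>x. (cmod (f x))\<^sup>2)}"

definition L2_norm :: "('a::euclidean_space \<Rightarrow> complex) \<Rightarrow> real" where
  "L2_norm f = sqrt (LINT x|lborel. (cmod (f x))\<^sup>2)"

definition C0 :: "('a::euclidean_space \<Rightarrow> complex) set" where
  "C0 = {f. continuous_on UNIV f \<and> (f \<longlongrightarrow> 0) at_infinity}"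

text \<open>The supremum is meaningful for bounded functions only; it is applied to members of \<open>C0\<close>.\<close>

definition sup_norm :: "('a::euclidean_space \<Rightarrow> complex) \<Rightarrow> real" where
  "sup_norm f = (SUP x. cmod (f x))"

primrec Ck :: "nat \<Rightarrow> ('a::euclidean_space \<Rightarrow> 'b::real_normed_vector) \<Rightarrow> bool" where
  "Ck 0 f \<longleftrightarrow> continuous_on UNIV f"
| "Ck (Suc k) f \<longleftrightarrow> (\<forall>x. f differentiable at x) \<and>
     (\<forall>b\<in>Basis. Ck k (\<lambda>x. frechet_derivative f (at x) b))"

definition test_function :: "('a::euclidean_space \<Rightarrow> complex) \<Rightarrow> bool" where
  "test_function \<phi> \<longleftrightarrow> (\<forall>k. Ck k \<phi>) \<and> compact (closure {x. \<phi> x \<noteq> 0})"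

definition locally_integrable :: "('a::euclidean_space \<Rightarrow> complex) \<Rightarrow> bool" where
  "locally_integrable f \<longleftrightarrow>
     f \<in> borel_measurable lborel \<and> (\<forall>K. compact K \<longrightarrow> set_integrable lborel K f)"

definition has_weak_deriv ::
    "'a::euclidean_space \<Rightarrow> ('a \<Rightarrow> complex) \<Rightarrow> ('a \<Rightarrow> complex) \<Rightarrow> bool" where
  "has_weak_deriv b f g \<longleftrightarrow> locally_integrable f \<and> locally_integrable g \<and>
     (\<forall>\<phi>. test_function \<phi> \<longrightarrow>
        (LINT x|lborel. f x * frechet_derivative \<phi> (at x) b) = - (LINT x|lborel. g x * \<phi> x))"

text \<open>The weak derivative in direction \<open>b\<close>; determined almost everywhere if it exists.\<close>

definition weak_deriv ::
    "'a::euclidean_space \<Rightarrow> ('a \<Rightarrow> complex) \<Rightarrow> 'a \<Rightarrow> complex" where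
  "weak_deriv b f = (SOME g. has_weak_deriv b f g)"

definition H1 :: "('a::euclidean_space \<Rightarrow> complex) set" where
  "H1 = {f \<in> L2. \<forall>b\<in>Basis. \<exists>g\<in>L2. has_weak_deriv b f g}"

definition H1_norm :: "('a::euclidean_space \<Rightarrow> complex) \<Rightarrow> real" where
  "H1_norm f = sqrt ((L2_norm f)\<^sup>2 + (\<Sum>b\<in>Basis. (L2_norm (weak_deriv b f))\<^sup>2))"

definition H2 :: "('a::euclidean_space \<Rightarrow> complex) set" where
  "H2 = {f \<in> H1. \<forall>b\<in>Basis. weak_deriv b f \<in> H1}"

definition H2_norm :: "('a::euclidean_space \<Rightarrow> complex) \<Rightarrow> real" where
  "H2_norm f = sqrt ((H1_norm f)\<^sup>2 +
     (\<Sum>b\<in>Basis. \<Sum>c\<in>Basis. (L2_norm (weak_deriv c (weak_deriv b f)))\<^sup>2))"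

definition laplacian :: "('a::euclidean_space \<Rightarrow> complex) \<Rightarrow> 'a \<Rightarrow> complex" where
  "laplacian f x = (\<Sum>b\<in>Basis. weak_deriv b (weak_deriv b f) x)"

subsection \<open>Curves in function spaces\<close>

text \<open>
  \<open>u \<in> C(I, X)\<close>, where the normed space has underlying set \<open>X\<close> and norm \<open>nrm\<close>. Continuity into
  an intersection space with its natural topology is continuity into both spaces.
\<close>

definition continuous_curve ::
    "real set \<Rightarrow> ('a \<Rightarrow> complex) set \<Rightarrow> (('a \<Rightarrow> complex) \<Rightarrow> real) \<Rightarrow>
     (real \<Rightarrow> 'a \<Rightarrow> complex) \<Rightarrow> bool" where
  "continuous_curve I X nrm u \<longleftrightarrow> (\<forall>t\<in>I. u t \<in> X \<and>
     ((\<lambda>s. nrm (\<lambda>x. u s x - u t x)) \<longlongrightarrow> 0) (at t within I))"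

text \<open>\<open>v\<close> is the derivative at time \<open>t\<close> of \<open>u\<close> as a curve in \<open>L\<^sup>2\<close>.\<close>

definition has_L2_time_deriv ::
    "(real \<Rightarrow> 'a::euclidean_space \<Rightarrow> complex) \<Rightarrow> ('a \<Rightarrow> complex) \<Rightarrow> real \<Rightarrow> bool" where
  "has_L2_time_deriv u v t \<longleftrightarrow> v \<in> L2 \<and>
     ((\<lambda>h. L2_norm (\<lambda>x. (u (t + h) x - u t x) / complex_of_real h - v x)) \<longlongrightarrow> 0) (at 0)"

subsection \<open>The Cauchy problem\<close>

text \<open>
  \<open>u\<close> solves \<open>u\<^sub>t = e\<^sup>i\<^sup>\<theta> (\<Delta>u + |u|\<^sup>\<alpha> u) + \<gamma> u\<close>, \<open>u(0) = u0\<close> on \<open>[0, T)\<close>. The values of \<open>u t\<close> for \<open>t\<close>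
  outside of \<open>[0, T)\<close> are irrelevant.
\<close>

definition is_solution ::
    "real \<Rightarrow> real \<Rightarrow> real \<Rightarrow> ('a::euclidean_space \<Rightarrow> complex) \<Rightarrow> ereal \<Rightarrow>
     (real \<Rightarrow> 'a \<Rightarrow> complex) \<Rightarrow> bool" where
  "is_solution \<theta> \<alpha> \<gamma> u0 T u \<longleftrightarrow> 0 < T \<and> u 0 = u0 \<and>
     continuous_curve {t. 0 \<le> t \<and> ereal t < T} C0 sup_norm u \<and>
     continuous_curve {t. 0 \<le> t \<and> ereal t < T} H1 H1_norm u \<and>
     continuous_curve {t. 0 < t \<and> ereal t < T} H2 H2_norm u \<and>
     (\<exists>u\<^sub>t. continuous_curve {t. 0 < t \<and> ereal t < T} L2 L2_norm u\<^sub>t \<and>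
        (\<forall>t. 0 < t \<and> ereal t < T \<longrightarrow>
           has_L2_time_deriv u (u\<^sub>t t) t \<and>
           (AE x in lborel. u\<^sub>t t x =
              cis \<theta> * (laplacian (u t) x + complex_of_real (cmod (u t x) powr \<alpha>) * u t x)
              + complex_of_real \<gamma> * u t x)))"

definition is_maximal_solution ::
    "real \<Rightarrow> real \<Rightarrow> real \<Rightarrow> ('a::euclidean_space \<Rightarrow> complex) \<Rightarrow> ereal \<Rightarrow>
     (real \<Rightarrow> 'a \<Rightarrow> complex) \<Rightarrow> bool" where
  "is_maximal_solution \<theta> \<alpha> \<gamma> u0 T u \<longleftrightarrow> is_solution \<theta> \<alpha> \<gamma> u0 T u \<and>
     (\<forall>T' v. is_solution \<theta> \<alpha> \<gamma> u0 T' v \<and> (\<forall>t. 0 \<le> t \<and> ereal t < T \<longrightarrow> v t = u t) \<longrightarrow> T' \<le> T)"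

definition energy :: "real \<Rightarrow> ('a::euclidean_space \<Rightarrow> complex) \<Rightarrow> real" where
  "energy \<alpha> w =
     1 / 2 * (LINT x|lborel. (\<Sum>b\<in>Basis. (cmod (weak_deriv b w x))\<^sup>2))
     - 1 / (\<alpha> + 2) * (LINT x|lborel. cmod (w x) powr (\<alpha> + 2))"

end

theory Submission imports Defs begin

text \<open>
  The solution is assumed to be global and a contradiction is derived from four functions of time. Put
  \<open>p = \<alpha> + 2\<close>, \<open>F = \<Delta>u + |u|\<^sup>\<alpha> u\<close>, \<open>M = \<parallel>u\<parallel>\<^sup>2\<close>, \<open>K = \<parallel>F\<parallel>\<^sup>2\<close> (norms of \<open>L\<^sup>2\<close>), \<open>E\<close> the energy of \<open>u\<close>, and
  \<open>J = \<langle>F, u\<rangle> = \<integral>|u|\<^sup>p - \<integral>|\<nabla>u|\<^sup>2\<close>, which is real. Pairing the equation with \<open>u\<close> and with \<open>F\<close> gives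
  \<open>M' = 2 (cos \<theta> J + \<gamma> M)\<close> and \<open>E' = - cos \<theta> K - \<gamma> J\<close>. Moreover \<open>J\<^sup>2 \<le> K M\<close> by Cauchy-Schwarz, and
  \<open>J + p E = (\<alpha>/2) \<integral>|\<nabla>u|\<^sup>2 \<ge> 0\<close>.

  Let \<open>\<eta> = - E - \<xi> M\<close>, which is positive at time \<open>0\<close>. Inserting \<open>K \<ge> J\<^sup>2 / M\<close> into \<open>\<eta>'\<close> leaves a quadratic
  in \<open>J\<close> that factors: \<open>M \<eta>' \<ge> (cos \<theta> J + \<gamma> M) (J - 2 \<xi> M)\<close>. As \<open>J \<ge> p (\<eta> + \<xi> M)\<close> and
  \<open>p \<xi> cos \<theta> \<ge> - \<gamma>\<close>, both factors are positive as long as \<open>\<eta>\<close> is, so \<open>\<eta>\<close> increases and stays positive. The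
  first factor is \<open>M' / 2\<close> and the second is at least \<open>p \<eta>\<close>, so that \<open>M \<eta>' \<ge> (p / 2) \<eta> M'\<close>: the quotient of
  \<open>\<eta>\<close> and \<open>M\<^bsup>p/2\<^esup>\<close> is nondecreasing. Hence \<open>M' \<ge> 2 p cos \<theta> \<eta> \<ge> C M\<^bsup>p/2\<^esup>\<close> with \<open>p / 2 > 1\<close>, and such an
  \<open>M\<close> cannot exist for all times (\<open>virial_blowup\<close>).

  It remains to justify the two derivatives at the regularity of the solution. The weak derivative is
  unique almost everywhere (\<open>has_weak_deriv_unique\<close>), so that it may be treated as a linear operator. The
  identity \<open>\<langle>f, \<Delta>h\<rangle> = - \<langle>\<nabla>f, \<nabla>h\<rangle>\<close> rests on integration by parts between two elements of \<open>H\<^sup>1\<close>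
  (\<open>weak_deriv_integration_by_parts\<close>): difference quotients of \<open>f\<close> along a coordinate direction converge
  weakly in \<open>L\<^sup>2\<close> to the weak derivative (\<open>weak_deriv_translation_derivative\<close>), and moving the translation
  to the other factor of the inner product only reverses its sign. Weak convergence is clear against test
  functions; it extends to \<open>L\<^sup>2\<close> because the quotients are bounded and test functions are dense
  (\<open>test_function_dense\<close>).

  The curve is differentiable in \<open>L\<^sup>2\<close> only, hence the energy is differentiated without differentiating
  \<open>\<nabla>u\<close> in time. By Green's identity the increment of the Dirichlet integral is a pairing of
  \<open>u(t + h) - u(t)\<close> with \<open>\<Delta>u(t + h) + \<Delta>u(t)\<close>, and by convexity of \<open>|z|\<^sup>p\<close> the increment of \<open>\<integral>|u|\<^sup>p\<close> lies
  between its two tangents (\<open>energy_increment\<close>). So the increment of \<open>E\<close> lies between two pairings of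
  \<open>u(t + h) - u(t)\<close> with elements of \<open>L\<^sup>2\<close> that both converge to \<open>- F\<close>.
\<close>

section \<open>Smooth functions approximating indicators of boxes\<close>

text \<open>The functions \<open>e\<^bsup>-1/s\<^esup> / s\<^sup>k\<close>, extended by \<open>0\<close> to \<open>s \<le> 0\<close>. All powers \<open>k\<close> are taken together because
  their span is closed under differentiation.\<close>

definition flat :: "nat \<Rightarrow> real \<Rightarrow> real" where
  "flat k s = (if s \<le> 0 then 0 else exp (- 1 / s) / s ^ k)"

lemma flat_tendsto_0: "(flat k \<longlongrightarrow> 0) (at 0)"
proof -
  have "((\<lambda>s. flat k s) \<longlongrightarrow> 0) (at_right 0)"
  proof -
    have "((\<lambda>s::real. (inverse s) ^ k / exp (inverse s)) \<longlongrightarrow> 0) (at_right 0)"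
      by (rule filterlim_compose[OF tendsto_power_div_exp_0 filterlim_inverse_at_top_right])
    moreover have "eventually (\<lambda>s::real. (inverse s) ^ k / exp (inverse s) = flat k s) (at_right 0)"
      unfolding eventually_at_filter
      by (rule always_eventually)
        (auto simp: flat_def field_simps exp_minus)
    ultimately show ?thesis by (rule Lim_transform_eventually)
  qed
  moreover have "((\<lambda>s. flat k s) \<longlongrightarrow> 0) (at_left 0)"
    by (rule tendsto_eventually) (auto simp: flat_def eventually_at_filter)
  ultimately show ?thesis by (simp add: filterlim_at_split)
qed

lemma flat_has_derivative:
  "(flat k has_real_derivative flat (k + 2) s - real k * flat (k + 1) s) (at s)"
proof -
  consider "s < 0" | "s = 0" | "s > 0" by linarith
  then show ?thesis
  proof cases
    case 1
    have "((\<lambda>_. 0::real) has_real_derivative 0) (at s)" by simp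
    then have "(flat k has_real_derivative 0) (at s)"
      by (rule has_field_derivative_transform_within_open[where S = "{..<0}"])
        (use 1 in \<open>auto simp: flat_def\<close>)
    then show ?thesis using 1 by (simp add: flat_def)
  next
    case 2
    have "((\<lambda>h. flat k h / h) \<longlongrightarrow> 0) (at 0)"
      by (rule Lim_transform_eventually[OF flat_tendsto_0[of "Suc k"]])
        (auto simp: flat_def eventually_at_filter)
    then show ?thesis using 2 by (simp add: DERIV_def flat_def)
  next
    case 3
    have "((\<lambda>s. exp (- 1 / s)) has_real_derivative exp (- 1 / s) * (1 / s\<^sup>2)) (at s)"
      using 3 by (auto intro!: derivative_eq_intros simp: power2_eq_square)
    then have "((\<lambda>s. exp (- 1 / s) / s ^ k) has_real_derivative
        (exp (- 1 / s) * (1 / s\<^sup>2) * s ^ k - exp (- 1 / s) * (real k * s ^ (k - 1))) / (s ^ k * s ^ k)) (at s)"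
      using 3 by (intro DERIV_divide) (auto intro!: derivative_eq_intros)
    also have "(exp (- 1 / s) * (1 / s\<^sup>2) * s ^ k - exp (- 1 / s) * (real k * s ^ (k - 1))) / (s ^ k * s ^ k)
        = flat (k + 2) s - real k * flat (k + 1) s"
      using 3 by (cases k) (simp_all add: flat_def diff_divide_distrib power2_eq_square)
    finally have "((\<lambda>s. exp (- 1 / s) / s ^ k) has_real_derivative
        flat (k + 2) s - real k * flat (k + 1) s) (at s)" .
    then show ?thesis
      by (rule has_field_derivative_transform_within_open[where S = "{0<..}"])
        (use 3 in \<open>auto simp: flat_def\<close>)
  qed
qed

lemma flat_0_tendsto_indicator:
  "(\<lambda>n. flat 0 (real n * s)) \<longlonglongrightarrow> (if s > 0 then 1 else 0)"
proof (cases "s > 0")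
  case True
  have "filterlim (\<lambda>n. real n * s) at_infinity sequentially"
    by (intro filterlim_at_top_imp_at_infinity
        filterlim_at_top_mult_tendsto_pos[OF tendsto_const True filterlim_real_sequentially])
  then have "(\<lambda>n. - 1 / (real n * s)) \<longlonglongrightarrow> 0"
    by (rule tendsto_divide_0[OF tendsto_const])
  then have "(\<lambda>n. exp (- 1 / (real n * s))) \<longlonglongrightarrow> exp 0"
    by (rule tendsto_exp)
  moreover have "eventually (\<lambda>n. exp (- 1 / (real n * s)) = flat 0 (real n * s)) sequentially"
    using eventually_gt_at_top[of 0]
    by eventually_elim (use True in \<open>auto simp: flat_def mult_le_0_iff\<close>)
  ultimately show ?thesis using True by (auto intro: Lim_transform_eventually)
next
  case False
  then have "real n * s \<le> 0" for n by (simp add: mult_nonneg_nonpos)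
  then have "flat 0 (real n * s) = 0" for n by (simp add: flat_def)
  with False show ?thesis by simp
qed

lemma flat_0_bounds: "0 \<le> flat 0 s" "flat 0 s \<le> 1"
  by (auto simp: flat_def)

text \<open>A supply of smooth functions on the whole space. The algebra generated by the ridge functions
  \<open>x \<mapsto> flat k (x \<bullet> v - a)\<close> is closed under directional derivatives, hence consists of smooth functions, and
  it contains enough functions of compact support to approximate the indicators of boxes.\<close>

inductive flat_algebra :: "('a::euclidean_space \<Rightarrow> complex) \<Rightarrow> bool" where
  const: "flat_algebra (\<lambda>_. c)"
| flat: "flat_algebra (\<lambda>x. of_real (flat k (x \<bullet> v - a)))"
| add: "flat_algebra f \<Longrightarrow> flat_algebra g \<Longrightarrow> flat_algebra (\<lambda>x. f x + g x)"
| mult: "flat_algebra f \<Longrightarrow> flat_algebra g \<Longrightarrow> flat_algebra (\<lambda>x. f x * g x)"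

lemma flat_algebra_derivative:
  assumes "flat_algebra f"
  shows "\<exists>f'. (\<forall>x. (f has_derivative f' x) (at x)) \<and> (\<forall>b. flat_algebra (\<lambda>x. f' x b))"
  using assms
proof induction
  case (const c)
  show ?case
    by (rule exI[of _ "\<lambda>_ _. 0"]) (auto intro: flat_algebra.const)
next
  case (flat k v a)
  let ?f' = "\<lambda>x w. complex_of_real ((flat (k + 2) (x \<bullet> v - a) - real k * flat (k + 1) (x \<bullet> v - a)) * (w \<bullet> v))"
  have "((\<lambda>x. complex_of_real (flat k (x \<bullet> v - a))) has_derivative ?f' x) (at x)" for x
  proof -
    have "((\<lambda>x. x \<bullet> v - a) has_derivative (\<lambda>w. w \<bullet> v)) (at x)"
      by (auto intro!: derivative_eq_intros)
    from has_derivative_compose[OF this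
        flat_has_derivative[of k "x \<bullet> v - a", unfolded has_field_derivative_def]]
    have "((\<lambda>x. flat k (x \<bullet> v - a)) has_derivative
       (\<lambda>w. (flat (k + 2) (x \<bullet> v - a) - real k * flat (k + 1) (x \<bullet> v - a)) * (w \<bullet> v))) (at x)" .
    then show ?thesis by (rule has_derivative_of_real)
  qed
  moreover have "flat_algebra (\<lambda>x. ?f' x b)" for b
  proof -
    have "flat_algebra (\<lambda>x. (of_real (flat (k + 2) (x \<bullet> v - a)) +
        (- of_nat k) * of_real (flat (k + 1) (x \<bullet> v - a))) * of_real (b \<bullet> v))"
      by (intro flat_algebra.intros)
    then show ?thesis by simp
  qed
  ultimately show ?case by (intro exI[of _ ?f']) blast
next
  case (add f g)
  then obtain f' g' where
    "\<And>x. (f has_derivative f' x) (at x)" "\<And>b. flat_algebra (\<lambda>x. f' x b)"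
    "\<And>x. (g has_derivative g' x) (at x)" "\<And>b. flat_algebra (\<lambda>x. g' x b)" by blast
  then show ?case
    by (intro exI[of _ "\<lambda>x b. f' x b + g' x b"])
      (auto intro!: has_derivative_add flat_algebra.add)
next
  case (mult f g)
  then obtain f' g' where
    "\<And>x. (f has_derivative f' x) (at x)" "\<And>b. flat_algebra (\<lambda>x. f' x b)"
    "\<And>x. (g has_derivative g' x) (at x)" "\<And>b. flat_algebra (\<lambda>x. g' x b)" by blast
  then show ?case using mult.hyps
    by (intro exI[of _ "\<lambda>x b. f x * g' x b + f' x b * g x"])
      (auto intro!: has_derivative_mult flat_algebra.intros)
qed

lemma flat_algebra_Ck: "flat_algebra f \<Longrightarrow> Ck k f"
proof (induction k arbitrary: f)
  case 0
  then obtain f' where "\<And>x. (f has_derivative f' x) (at x)" using flat_algebra_derivative by blast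
  then show ?case
    by (auto intro!: continuous_at_imp_continuous_on has_derivative_continuous)
next
  case (Suc k)
  then obtain f' where f': "\<And>x. (f has_derivative f' x) (at x)" "\<And>b. flat_algebra (\<lambda>x. f' x b)"
    using flat_algebra_derivative by blast
  then have "frechet_derivative f (at x) = f' x" for x
    by (metis frechet_derivative_at)
  with f' Suc.IH show ?case by (auto simp: differentiable_def)
qed

lemma flat_algebra_prod:
  "finite I \<Longrightarrow> (\<And>i. i \<in> I \<Longrightarrow> flat_algebra (f i)) \<Longrightarrow> flat_algebra (\<lambda>x. \<Prod>i\<in>I. f i x)"
  by (induction I rule: finite_induct) (auto intro: flat_algebra.intros)

text \<open>Since \<open>e\<^bsup>-1/(n s)\<^esup>\<close> tends to \<open>1\<close> for every \<open>s > 0\<close>, these functions tend to the indicator of the open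
  box between \<open>a\<close> and \<open>c\<close>, with values in the unit interval and support in the box.\<close>

definition bump :: "'a::euclidean_space \<Rightarrow> 'a \<Rightarrow> nat \<Rightarrow> 'a \<Rightarrow> complex" where
  "bump a c n x = (\<Prod>b\<in>Basis. of_real (flat 0 (real n * (x \<bullet> b - a \<bullet> b))) *
                               of_real (flat 0 (real n * (c \<bullet> b - x \<bullet> b))))"

lemma flat_algebra_bump: "flat_algebra (bump a c n)"
proof -
  have 1: "flat_algebra (\<lambda>x. of_real (flat 0 (real n * (x \<bullet> b - a \<bullet> b))))" for b :: 'a
    using flat_algebra.flat[of 0 "real n *\<^sub>R b" "real n * (a \<bullet> b)"]
    by (simp add: algebra_simps)
  have 2: "flat_algebra (\<lambda>x. of_real (flat 0 (real n * (c \<bullet> b - x \<bullet> b))))" for b :: 'a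
    using flat_algebra.flat[of 0 "- real n *\<^sub>R b" "- real n * (c \<bullet> b)"]
    by (simp add: algebra_simps)
  show ?thesis unfolding bump_def
    by (intro flat_algebra_prod flat_algebra.mult 1 2) auto
qed

lemma bump_tendsto: "(\<lambda>n. bump a c n x) \<longlonglongrightarrow> indicator (box a c) x"
proof -
  have "(\<lambda>n. bump a c n x) \<longlonglongrightarrow>
    (\<Prod>b\<in>Basis. complex_of_real (if x \<bullet> b - a \<bullet> b > 0 then 1 else 0) *
                complex_of_real (if c \<bullet> b - x \<bullet> b > 0 then 1 else 0))"
    unfolding bump_def
    by (intro tendsto_prod tendsto_mult tendsto_of_real flat_0_tendsto_indicator)
  also have "(\<Prod>b\<in>Basis. complex_of_real (if x \<bullet> b - a \<bullet> b > 0 then 1 else 0) *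
                complex_of_real (if c \<bullet> b - x \<bullet> b > 0 then 1 else 0)) = indicator (box a c) x"
    by (auto simp: indicator_def mem_box intro!: prod.neutral)
  finally show ?thesis .
qed

lemma bump_bound: "cmod (bump a c n x) \<le> 1"
  unfolding bump_def prod_norm[symmetric]
  by (rule prod_le_1) (auto simp: norm_mult flat_0_bounds intro!: mult_le_one)

lemma bump_outside: "x \<notin> box a c \<Longrightarrow> bump a c n x = 0"
proof -
  assume "x \<notin> box a c"
  then obtain b where "b \<in> Basis" and "x \<bullet> b - a \<bullet> b \<le> 0 \<or> c \<bullet> b - x \<bullet> b \<le> 0"
    by (force simp: mem_box)
  then have "flat 0 (real n * (x \<bullet> b - a \<bullet> b)) = 0 \<or> flat 0 (real n * (c \<bullet> b - x \<bullet> b)) = 0"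
    by (auto simp: flat_def mult_nonneg_nonpos)
  then show ?thesis unfolding bump_def
    using \<open>b \<in> Basis\<close> by (auto intro: prod_zero)
qed

lemma test_functionI:
  assumes "flat_algebra f" "bounded {x. f x \<noteq> 0}"
  shows "test_function f"
  using assms by (simp add: test_function_def flat_algebra_Ck compact_closure)

section \<open>The inner product of square integrable functions\<close>

lemma L2D: "f \<in> L2 \<Longrightarrow> f \<in> borel_measurable borel"
  "f \<in> L2 \<Longrightarrow> integrable lborel (\<lambda>x. (cmod (f x))\<^sup>2)"
  by (auto simp: L2_def)

lemma L2_bound:
  assumes "f \<in> borel_measurable borel" "integrable lborel w" "AE x in lborel. (cmod (f x))\<^sup>2 \<le> w x"
  shows "f \<in> L2"
  unfolding L2_def
proof safe
  show "f \<in> borel_measurable lborel" using assms by simp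
  show "integrable lborel (\<lambda>x. (cmod (f x))\<^sup>2)"
    by (rule Bochner_Integration.integrable_bound[OF assms(2)])
      (use assms in \<open>auto elim!: eventually_mono\<close>)
qed

lemma L2_cmult: "f \<in> L2 \<Longrightarrow> (\<lambda>x. c * f x) \<in> L2"
  by (auto simp: L2_def norm_mult power_mult_distrib)

lemma borel_measurable_cnj [measurable]:
  "f \<in> borel_measurable M \<Longrightarrow> (\<lambda>x. cnj (f x)) \<in> borel_measurable M"
  by (rule measurable_compose[where g = cnj, OF _ borel_measurable_continuous_onI])
    (auto intro: continuous_intros)

lemma L2_cnj: "f \<in> L2 \<Longrightarrow> (\<lambda>x. cnj (f x)) \<in> L2"
  by (auto simp: L2_def intro: borel_measurable_cnj)

lemma cmod_add_sq_le: "(cmod (a + b))\<^sup>2 \<le> 2 * (cmod a)\<^sup>2 + 2 * (cmod b)\<^sup>2"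
proof -
  have "(cmod (a + b))\<^sup>2 \<le> (cmod a + cmod b)\<^sup>2"
    by (intro power_mono norm_triangle_ineq) auto
  also have "\<dots> \<le> 2 * (cmod a)\<^sup>2 + 2 * (cmod b)\<^sup>2"
    using sum_squares_bound[of "cmod a" "cmod b"] by (simp add: power2_sum)
  finally show ?thesis .
qed

lemma L2_add: "f \<in> L2 \<Longrightarrow> g \<in> L2 \<Longrightarrow> (\<lambda>x. f x + g x) \<in> L2"
  by (rule L2_bound[where w = "\<lambda>x. 2 * (cmod (f x))\<^sup>2 + 2 * (cmod (g x))\<^sup>2"])
    (auto simp: L2_def intro: cmod_add_sq_le)

lemma L2_diff: "f \<in> L2 \<Longrightarrow> g \<in> L2 \<Longrightarrow> (\<lambda>x. f x - g x) \<in> L2"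
  using L2_add[of f "\<lambda>x. (-1) * g x"] L2_cmult[of g "-1"] by simp

lemma L2_zero: "(\<lambda>_. 0) \<in> L2" by (simp add: L2_def)

lemma L2_sum: "finite I \<Longrightarrow> (\<And>i. i \<in> I \<Longrightarrow> f i \<in> L2) \<Longrightarrow> (\<lambda>x. \<Sum>i\<in>I. f i x) \<in> L2"
  by (induction I rule: finite_induct) (auto intro: L2_add L2_zero)

lemma L2_integrable_mult:
  assumes "f \<in> L2" "g \<in> L2"
  shows "integrable lborel (\<lambda>x. f x * g x)"
proof (rule Bochner_Integration.integrable_bound)
  show "integrable lborel (\<lambda>x. (cmod (f x))\<^sup>2 + (cmod (g x))\<^sup>2)"
    using assms by (auto simp: L2_def)
  have "cmod a * cmod b \<le> (cmod a)\<^sup>2 + (cmod b)\<^sup>2" for a b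
  proof -
    have "0 \<le> cmod a * cmod b" by simp
    with sum_squares_bound[of "cmod a" "cmod b"] show ?thesis by linarith
  qed
  then show "AE x in lborel. norm (f x * g x) \<le> norm ((cmod (f x))\<^sup>2 + (cmod (g x))\<^sup>2)"
    by (auto simp: norm_mult)
qed (use assms in \<open>auto simp: L2_def\<close>)

definition l2_inner :: "('a::euclidean_space \<Rightarrow> complex) \<Rightarrow> ('a \<Rightarrow> complex) \<Rightarrow> complex" where
  "l2_inner f g = (LINT x|lborel. f x * cnj (g x))"

lemma l2_inner_integrable: "f \<in> L2 \<Longrightarrow> g \<in> L2 \<Longrightarrow> integrable lborel (\<lambda>x. f x * cnj (g x))"
  by (intro L2_integrable_mult L2_cnj)

lemma l2_inner_add_left:
  "f \<in> L2 \<Longrightarrow> g \<in> L2 \<Longrightarrow> h \<in> L2 \<Longrightarrow> l2_inner (\<lambda>x. f x + g x) h = l2_inner f h + l2_inner g h"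
  by (simp add: l2_inner_def distrib_right l2_inner_integrable)

lemma l2_inner_diff_left:
  "f \<in> L2 \<Longrightarrow> g \<in> L2 \<Longrightarrow> h \<in> L2 \<Longrightarrow> l2_inner (\<lambda>x. f x - g x) h = l2_inner f h - l2_inner g h"
  by (simp add: l2_inner_def left_diff_distrib l2_inner_integrable)

lemma l2_inner_cmult_left: "l2_inner (\<lambda>x. c * f x) h = c * l2_inner f h"
  by (simp add: l2_inner_def mult.assoc)

lemma l2_inner_cnj: "cnj (l2_inner f g) = l2_inner g f"
  by (simp add: l2_inner_def mult.commute flip: Bochner_Integration.integral_cnj)

lemma l2_inner_add_right:
  "f \<in> L2 \<Longrightarrow> g \<in> L2 \<Longrightarrow> h \<in> L2 \<Longrightarrow> l2_inner h (\<lambda>x. f x + g x) = l2_inner h f + l2_inner h g"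
  by (simp add: l2_inner_def distrib_left l2_inner_integrable)

lemma l2_inner_diff_right:
  "f \<in> L2 \<Longrightarrow> g \<in> L2 \<Longrightarrow> h \<in> L2 \<Longrightarrow> l2_inner h (\<lambda>x. f x - g x) = l2_inner h f - l2_inner h g"
  by (simp add: l2_inner_def right_diff_distrib l2_inner_integrable)

lemma l2_inner_sum_left:
  "finite I \<Longrightarrow> (\<And>i. i \<in> I \<Longrightarrow> f i \<in> L2) \<Longrightarrow> g \<in> L2 \<Longrightarrow>
    l2_inner (\<lambda>x. \<Sum>i\<in>I. f i x) g = (\<Sum>i\<in>I. l2_inner (f i) g)"
  by (simp add: l2_inner_def sum_distrib_right l2_inner_integrable)

lemma l2_inner_self: "l2_inner f f = of_real ((L2_norm f)\<^sup>2)"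
proof -
  have "l2_inner f f = (LINT x|lborel. of_real ((cmod (f x))\<^sup>2))"
    unfolding l2_inner_def by (intro Bochner_Integration.integral_cong) (auto simp: complex_norm_square simp del: of_real_power)
  also have "\<dots> = of_real (LINT x|lborel. (cmod (f x))\<^sup>2)"
    by (rule integral_complex_of_real)
  finally show ?thesis by (simp add: L2_norm_def)
qed

lemma L2_norm_nonneg [simp]: "0 \<le> L2_norm f"
  by (simp add: L2_norm_def)

lemma L2_norm_square: "(L2_norm f)\<^sup>2 = (LINT x|lborel. (cmod (f x))\<^sup>2)"
  by (simp add: L2_norm_def)

lemma L2_norm_cmult: "L2_norm (\<lambda>x. c * f x) = cmod c * L2_norm f"
  by (simp add: L2_norm_def norm_mult power_mult_distrib real_sqrt_mult)

lemma L2_norm_minus_commute: "L2_norm (\<lambda>x. f x - g x) = L2_norm (\<lambda>x. g x - f x)"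
  by (simp add: L2_norm_def norm_minus_commute)

lemma L2_norm_cong_AE:
  assumes "AE x in lborel. f x = g x"
    and [measurable]: "f \<in> borel_measurable borel" "g \<in> borel_measurable borel"
  shows "L2_norm f = L2_norm g"
proof -
  have "(LINT x|lborel. (cmod (f x))\<^sup>2) = (LINT x|lborel. (cmod (g x))\<^sup>2)"
    by (rule integral_cong_AE) (use assms(1) in auto)
  then show ?thesis by (simp add: L2_norm_def)
qed

lemma l2_inner_cong_AE:
  assumes "AE x in lborel. f x = g x" "f \<in> L2" "g \<in> L2" "h \<in> L2"
  shows "l2_inner f h = l2_inner g h"
  unfolding l2_inner_def
proof (rule integral_cong_AE)
  show "AE x in lborel. f x * cnj (h x) = g x * cnj (h x)" using assms(1) by auto
qed (use assms(2-4)[THEN L2D(1)] in measurable)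

text \<open>Integrate \<open>2 |f g| \<le> s |f|\<^sup>2 + |g|\<^sup>2 / s\<close> and optimise over \<open>s > 0\<close>.\<close>

lemma L2_Cauchy_Schwarz:
  assumes "f \<in> L2" "g \<in> L2"
  shows "cmod (l2_inner f g) \<le> L2_norm f * L2_norm g"
proof -
  define A B where "A = L2_norm f" and "B = L2_norm g"
  have *: "cmod (l2_inner f g) \<le> (A\<^sup>2 * s + B\<^sup>2 / s) / 2" if "s > 0" for s
  proof -
    have p: "cmod a * cmod b * 2 \<le> (cmod a)\<^sup>2 * s + (cmod b)\<^sup>2 / s" for a b
    proof -
      have "0 \<le> (cmod a * s - cmod b)\<^sup>2" by simp
      then show ?thesis using \<open>s > 0\<close> by (simp add: field_simps power2_eq_square)
    qed
    have "cmod (l2_inner f g) \<le> (LINT x|lborel. cmod (f x * cnj (g x)))"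
      unfolding l2_inner_def by (rule integral_norm_bound)
    also have "\<dots> \<le> (LINT x|lborel. ((cmod (f x))\<^sup>2 * s + (cmod (g x))\<^sup>2 / s) / 2)"
      using assms
      by (intro integral_mono integrable_norm l2_inner_integrable)
        (auto simp: norm_mult L2_def intro: p)
    also have "\<dots> = (A\<^sup>2 * s + B\<^sup>2 / s) / 2"
      using assms by (simp add: A_def B_def L2_norm_square L2_def)
    finally show ?thesis .
  qed
  have "A \<ge> 0" "B \<ge> 0" by (simp_all add: A_def B_def)
  \<comment> \<open>The optimal \<open>s\<close> is \<open>B / A\<close>; enlarging both norms by \<open>e\<close> keeps it meaningful when one of them vanishes.\<close>
  have "cmod (l2_inner f g) \<le> (A + e) * (B + e)" if "e > 0" for e
  proof -
    have "A + e > 0" "B + e > 0" using that \<open>A \<ge> 0\<close> \<open>B \<ge> 0\<close> by auto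
    have "cmod (l2_inner f g) \<le> (A\<^sup>2 * ((B + e) / (A + e)) + B\<^sup>2 / ((B + e) / (A + e))) / 2"
      using *[of "(B + e) / (A + e)"] \<open>A + e > 0\<close> \<open>B + e > 0\<close> by simp
    also have "\<dots> \<le> ((A + e)\<^sup>2 * ((B + e) / (A + e)) + (B + e)\<^sup>2 / ((B + e) / (A + e))) / 2"
      using that \<open>A \<ge> 0\<close> \<open>B \<ge> 0\<close>
      by (intro divide_right_mono add_mono mult_right_mono power_mono) auto
    also have "\<dots> = (A + e) * (B + e)"
    proof -
      have "(X\<^sup>2 * (Y / X) + Y\<^sup>2 / (Y / X)) / 2 = X * Y" if "X > 0" "Y > 0" for X Y :: real
        using that by (simp add: power2_eq_square)
      from this[OF \<open>A + e > 0\<close> \<open>B + e > 0\<close>] show ?thesis .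
    qed
    finally show ?thesis .
  qed
  then have "eventually (\<lambda>e. cmod (l2_inner f g) \<le> (A + e) * (B + e)) (at_right 0)"
    by (auto simp: eventually_at_filter)
  moreover have "((\<lambda>e. (A + e) * (B + e)) \<longlongrightarrow> (A + 0) * (B + 0)) (at_right 0)"
    by (intro tendsto_intros)
  ultimately have "cmod (l2_inner f g) \<le> (A + 0) * (B + 0)"
    by (intro tendsto_lowerbound) auto
  then show ?thesis by (simp add: A_def B_def)
qed

lemma L2_norm_triangle:
  assumes "f \<in> L2" "g \<in> L2"
  shows "L2_norm (\<lambda>x. f x + g x) \<le> L2_norm f + L2_norm g"
proof -
  let ?h = "\<lambda>x. f x + g x"
  have "?h \<in> L2" using assms by (rule L2_add)
  have "complex_of_real ((L2_norm ?h)\<^sup>2) = l2_inner f ?h + l2_inner g ?h"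
    unfolding l2_inner_self[symmetric] using assms \<open>?h \<in> L2\<close> by (simp add: l2_inner_add_left)
  then have "(L2_norm ?h)\<^sup>2 = cmod (l2_inner f ?h + l2_inner g ?h)"
    by (metis norm_of_real abs_of_nonneg zero_le_power2)
  also have "\<dots> \<le> (L2_norm f + L2_norm g) * L2_norm ?h"
    using norm_triangle_ineq[of "l2_inner f ?h" "l2_inner g ?h"]
      L2_Cauchy_Schwarz[OF assms(1) \<open>?h \<in> L2\<close>] L2_Cauchy_Schwarz[OF assms(2) \<open>?h \<in> L2\<close>]
    by (simp add: distrib_right)
  finally show ?thesis
    by (cases "L2_norm ?h = 0") (auto simp: power2_eq_square mult_le_cancel_right order_less_le)
qed

lemma L2_norm_triangle_diff:
  assumes "f \<in> L2" "g \<in> L2" "h \<in> L2"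
  shows "L2_norm (\<lambda>x. f x - h x) \<le> L2_norm (\<lambda>x. f x - g x) + L2_norm (\<lambda>x. g x - h x)"
  using L2_norm_triangle[of "\<lambda>x. f x - g x" "\<lambda>x. g x - h x"] assms by (simp add: L2_diff)

lemma L2_norm_dominated:
  fixes F :: "nat \<Rightarrow> 'a::euclidean_space \<Rightarrow> complex"
  assumes [measurable]: "\<And>n. F n \<in> borel_measurable borel"
    and lim: "\<And>x. (\<lambda>n. F n x) \<longlonglongrightarrow> 0"
    and w: "integrable lborel w" "\<And>n x. (cmod (F n x))\<^sup>2 \<le> w x"
  shows "(\<lambda>n. L2_norm (F n)) \<longlonglongrightarrow> 0"
proof -
  have "(\<lambda>n. LINT x|lborel. (cmod (F n x))\<^sup>2) \<longlonglongrightarrow> (LINT x|(lborel::'a measure). 0)"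
  proof (rule integral_dominated_convergence[OF _ _ w(1)])
    show "AE x in lborel. (\<lambda>n. (cmod (F n x))\<^sup>2) \<longlonglongrightarrow> 0"
      using tendsto_power[OF tendsto_norm[OF lim], of _ 2] by auto
    show "AE x in lborel. norm ((cmod (F n x))\<^sup>2) \<le> w x" for n using w(2) by auto
  qed auto
  from tendsto_real_sqrt[OF this] show ?thesis by (simp add: L2_norm_def)
qed


section \<open>Density of test functions\<close>

lemma continuous_compact_support_bound:
  fixes f :: "'a::euclidean_space \<Rightarrow> complex"
  assumes "continuous_on UNIV f" "bounded {x. f x \<noteq> 0}"
  obtains K a where "0 \<le> K" "\<And>x. cmod (f x) \<le> K * indicator (cbox (-a) a) x"
proof -
  obtain a where a: "{x. f x \<noteq> 0} \<subseteq> cbox (-a) a"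
    using bounded_subset_cbox_symmetric[OF assms(2)] by metis
  have "compact (f ` cbox (-a) a)"
    using assms by (intro compact_continuous_image) (auto intro: continuous_on_subset)
  then obtain K where K: "\<And>x. x \<in> cbox (-a) a \<Longrightarrow> cmod (f x) \<le> K"
    using compact_imp_bounded bounded_iff by (metis imageI)
  have "cmod (f x) \<le> max 0 K * indicator (cbox (-a) a) x" for x
    using a K[of x] by (auto simp: indicator_def)
  then show thesis by (intro that[of "max 0 K" a]) auto
qed

lemma cbox_cover: "\<exists>n. x \<in> cbox (- (real n *\<^sub>R One)) (real n *\<^sub>R One)"
proof -
  obtain n where n: "norm x \<le> real n" using real_arch_simple by blast
  have "\<bar>x \<bullet> i\<bar> \<le> real n" if "i \<in> Basis" for i
    using Basis_le_norm[OF that, of x] n by linarith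
  then have "x \<in> cbox (- (real n *\<^sub>R One)) (real n *\<^sub>R One)"
    by (fastforce simp: mem_box abs_le_iff)
  then show ?thesis ..
qed

lemma cbox_cover_tendsto:
  "(\<lambda>n. indicator (cbox (- (real n *\<^sub>R One)) (real n *\<^sub>R One)) x :: complex) \<longlonglongrightarrow> 1"
proof -
  obtain n where n: "x \<in> cbox (- (real n *\<^sub>R One)) (real n *\<^sub>R One)"
    using cbox_cover by blast
  have "x \<in> cbox (- (real m *\<^sub>R One)) (real m *\<^sub>R One)" if "n \<le> m" for m
  proof -
    have "real n \<le> real m" using that by simp
    with n show ?thesis by (fastforce simp: mem_box)
  qed
  then show ?thesis
    by (intro tendsto_eventually) (auto simp: eventually_sequentially intro!: exI[of _ n])
qed

text \<open>A functional monotone class theorem that starts from smooth functions of compact support. They produce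
  the indicators of open boxes as bounded limits; boxes are closed under intersection and generate the
  Borel sets, so Dynkin's lemma gives the indicators of Borel sets inside a fixed box, and linearity with
  one more limit gives all functions. It serves twice: for the density of test functions, and for the
  fundamental lemma of the calculus of variations.\<close>

lemma test_function_monotone_class:
  fixes V :: "('a::euclidean_space \<Rightarrow> complex) set"
  assumes smooth: "\<And>\<phi>. flat_algebra \<phi> \<Longrightarrow> bounded {x. \<phi> x \<noteq> 0} \<Longrightarrow> \<phi> \<in> V"
    and add: "\<And>f g. f \<in> V \<Longrightarrow> g \<in> V \<Longrightarrow> (\<lambda>x. f x + g x) \<in> V"
    and scale: "\<And>c f. f \<in> V \<Longrightarrow> (\<lambda>x. c * f x) \<in> V"
    and lim: "\<And>F f C a b. (\<And>n. F n \<in> V) \<Longrightarrow>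
        (\<And>n x. cmod (F n x) \<le> C * indicator (cbox a b) x) \<Longrightarrow>
        (\<And>x. (\<lambda>n. F n x) \<longlonglongrightarrow> f x) \<Longrightarrow> f \<in> V"
    and f: "f \<in> borel_measurable borel" "\<And>x. cmod (f x) \<le> C * indicator (cbox a b) x"
  shows "f \<in> V"
proof -
  have zero: "(\<lambda>_. 0) \<in> V" by (rule smooth) (auto intro: flat_algebra.const)
  have box: "indicator (box c d) \<in> V" for c d :: 'a
  proof (rule lim[of "bump c d" 1 c d])
    show "bump c d n \<in> V" for n
    proof (rule smooth[OF flat_algebra_bump])
      show "bounded {x. bump c d n x \<noteq> 0}"
        by (rule bounded_subset[OF bounded_box[of c d]]) (use bump_outside in blast)
    qed
    show "cmod (bump c d n x) \<le> 1 * indicator (cbox c d) x" for n x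
      using bump_bound[of c d n x] bump_outside[of x c d n] box_subset_cbox[of c d]
      by (auto simp: indicator_def)
  qed (rule bump_tendsto)
  have sum: "(\<lambda>x. \<Sum>i\<in>I. F i x) \<in> V" if "finite I" "\<And>i. i \<in> I \<Longrightarrow> F i \<in> V"
    for I :: "'i set" and F
    using that by (induction I rule: finite_induct) (auto intro: zero add)
  obtain e where "cbox a b \<subseteq> box (-e) e"
    using bounded_subset_box_symmetric[OF bounded_cbox] by metis
  define B where "B = box (-e) e"
  have B: "cbox a b \<subseteq> B" by (simp add: B_def) fact
  have ind: "indicator (A \<inter> B) \<in> V" if "A \<in> sets borel" for A
  proof -
    have "A \<in> sigma_sets UNIV (range (\<lambda>(c, d). box c d))"
      using that unfolding borel_eq_box by (subst (asm) sets_measure_of) auto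
    note sig = this
    have "Int_stable (range (\<lambda>(c, d). box c d :: 'a set))"
      by (auto simp: Int_stable_def box_Int_box)
    moreover have "range (\<lambda>(c, d). box c d :: 'a set) \<subseteq> Pow UNIV" by auto
    moreover note sig
    ultimately show ?thesis
    proof (induction rule: sigma_sets_induct_disjoint)
      case (basic A)
      then show ?case by (auto simp: B_def box_Int_box intro: box)
    next
      case empty
      then show ?case using zero by (simp add: indicator_def[abs_def])
    next
      case (compl A)
      have "(\<lambda>x. indicator B x + (-1) * indicator (A \<inter> B) x) \<in> V"
        by (intro add scale compl) (auto simp: B_def box)
      also have "(\<lambda>x. indicator B x + (-1) * indicator (A \<inter> B) x :: complex) = indicator ((UNIV - A) \<inter> B)"
        by (auto simp: fun_eq_iff indicator_def)
      finally show ?case .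
    next
      case (union A)
      let ?F = "\<lambda>n x. \<Sum>i<n. indicator (A i \<inter> B) x :: complex"
      have F: "?F n x = indicator ((\<Union>i<n. A i) \<inter> B) x" for n x
        by (subst indicator_UN_disjoint[symmetric])
          (use union(1) in \<open>auto simp: disjoint_family_on_def Int_UN_distrib2 intro!: arg_cong2[of _ _ _ _ indicator]\<close>)
      show ?case
      proof (rule lim[of ?F 1 "-e" e])
        show "?F n \<in> V" for n by (intro sum union) auto
        show "cmod (?F n x) \<le> 1 * indicator (cbox (-e) e) x" for n x
          unfolding F using box_subset_cbox[of "-e" e] by (auto simp: indicator_def B_def)
        show "(\<lambda>n. ?F n x) \<longlonglongrightarrow> indicator (\<Union> (range A) \<inter> B) x" for x
        proof (cases "x \<in> \<Union> (range A)")
          case True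
          then obtain i where "x \<in> A i" by auto
          then show ?thesis unfolding F
            by (intro tendsto_eventually) (auto simp: eventually_sequentially indicator_def intro!: exI[of _ "Suc i"])
        next
          case False
          then have "?F n x = 0" for n by simp
          then show ?thesis using False by simp
        qed
      qed
    qed
  qed
  obtain s where s: "\<And>i. simple_function borel (s i)"
      "\<And>x. (\<lambda>i. s i x) \<longlonglongrightarrow> f x" "\<And>i x. dist (s i x) 0 \<le> 2 * dist (f x) 0"
    using borel_measurable_implies_sequence_metric[OF f(1), of 0] by auto
  have s_bound: "cmod (s i x) \<le> (2 * C) * indicator (cbox a b) x" for i x
    using s(3)[of i x] f(2)[of x] by simp
  have "s i \<in> V" for i
  proof -
    have out: "s i x = 0" if "x \<notin> B" for x
    proof -
      have "x \<notin> cbox a b" using that B by blast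
      then show ?thesis using s_bound[of i x] by simp
    qed
    have fin: "finite (range (s i))" using simple_functionD(1)[OF s(1)] by simp
    have "(\<lambda>x. \<Sum>y\<in>range (s i). y * indicator (s i -` {y} \<inter> B) x) \<in> V"
      using simple_functionD(2)[OF s(1)] by (intro sum fin scale ind) auto
    also have "(\<lambda>x. \<Sum>y\<in>range (s i). y * indicator (s i -` {y} \<inter> B) x) = s i"
    proof
      fix x
      have "(\<Sum>y\<in>range (s i). y * indicator (s i -` {y} \<inter> B) x) =
            (\<Sum>y\<in>range (s i). if y = s i x then y else 0)"
        using out[of x] by (intro sum.cong) (auto simp: indicator_def)
      also have "\<dots> = s i x" using fin by simp
      finally show "(\<Sum>y\<in>range (s i). y * indicator (s i -` {y} \<inter> B) x) = s i x" .
    qed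
    finally show ?thesis .
  qed
  from this s_bound s(2) show ?thesis by (rule lim)
qed

text \<open>The \<open>L\<^sup>2\<close>-closure of the smooth functions of compact support satisfies the hypotheses of the monotone
  class theorem, so it contains every bounded function of bounded support. Cutting off domain and values
  of an arbitrary element of \<open>L\<^sup>2\<close> gives such functions that converge to it.\<close>

lemma test_function_dense:
  assumes "f \<in> L2" "e > 0"
  shows "\<exists>\<phi>. test_function \<phi> \<and> \<phi> \<in> L2 \<and> L2_norm (\<lambda>x. f x - \<phi> x) < e"
proof -
  define T where "T = {\<phi>::'a \<Rightarrow> complex. flat_algebra \<phi> \<and> bounded {x. \<phi> x \<noteq> 0} \<and> \<phi> \<in> L2}"
  define V where "V = {f \<in> L2. \<forall>e>0. \<exists>\<phi>\<in>T. L2_norm (\<lambda>x. f x - \<phi> x) < e}"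
  have closed: "f \<in> V" if f: "f \<in> L2" and FV: "\<And>n. F n \<in> V" and lim: "(\<lambda>n. L2_norm (\<lambda>x. f x - F n x)) \<longlonglongrightarrow> 0"
    for f F
    unfolding V_def
  proof (safe)
    fix e :: real assume "e > 0"
    then obtain n where n: "L2_norm (\<lambda>x. f x - F n x) < e / 2"
      using order_tendstoD(2)[OF lim, of "e / 2"] by (auto simp: eventually_sequentially)
    have F: "F n \<in> L2" using FV[of n] by (auto simp: V_def)
    obtain \<phi> where \<phi>: "\<phi> \<in> T" "L2_norm (\<lambda>x. F n x - \<phi> x) < e / 2"
      using FV[of n] \<open>e > 0\<close> half_gt_zero[of e] unfolding V_def by blast
    have "L2_norm (\<lambda>x. f x - \<phi> x) \<le> L2_norm (\<lambda>x. f x - F n x) + L2_norm (\<lambda>x. F n x - \<phi> x)"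
      using f F \<phi>(1) by (intro L2_norm_triangle_diff) (auto simp: T_def)
    with n \<phi> show "\<exists>\<phi>\<in>T. L2_norm (\<lambda>x. f x - \<phi> x) < e" by (intro bexI[of _ \<phi>]) auto
  qed fact
  have ind_int: "integrable lborel (\<lambda>x. K * indicator (cbox a b) x)" for K :: real and a b :: 'a
    by (intro integrable_mult_right integrable_real_indicator emeasure_bounded_finite) auto
  have bdd: "f \<in> V" if f_meas: "f \<in> borel_measurable borel" and f_bound: "\<And>x. cmod (f x) \<le> C * indicator (cbox a b) x"
    for f C a b
  proof (rule test_function_monotone_class[where C = C and a = a and b = b])
    show "f \<in> borel_measurable borel" by (rule f_meas)
    show "cmod (f x) \<le> C * indicator (cbox a b) x" for x by (rule f_bound)
  next
    fix \<phi> :: "'a \<Rightarrow> complex" assume \<phi>: "flat_algebra \<phi>" "bounded {x. \<phi> x \<noteq> 0}"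
    have cont: "continuous_on UNIV \<phi>" using flat_algebra_Ck[OF \<phi>(1), of 0] by simp
    obtain K a where K: "\<And>x. cmod (\<phi> x) \<le> K * indicator (cbox (-a) a) x"
      using continuous_compact_support_bound[OF cont \<phi>(2)] by metis
    have "\<phi> \<in> L2"
    proof (rule L2_bound[OF _ ind_int])
      show "\<phi> \<in> borel_measurable borel" using cont by (rule borel_measurable_continuous_onI)
      show "AE x in lborel. (cmod (\<phi> x))\<^sup>2 \<le> K\<^sup>2 * indicator (cbox (-a) a) x"
      proof (rule AE_I2)
        fix x
        have "(cmod (\<phi> x))\<^sup>2 \<le> (K * indicator (cbox (-a) a) x)\<^sup>2" by (intro power_mono K) auto
        then show "(cmod (\<phi> x))\<^sup>2 \<le> K\<^sup>2 * indicator (cbox (-a) a) x" by (auto simp: indicator_def)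
      qed
    qed
    with \<phi> have "\<phi> \<in> T" by (simp add: T_def)
    moreover have "L2_norm (\<lambda>x. \<phi> x - \<phi> x) = 0" by (simp add: L2_norm_def)
    ultimately have "\<exists>\<psi>\<in>T. L2_norm (\<lambda>x. \<phi> x - \<psi> x) < e" if "e > 0" for e
      using that by (intro bexI[of _ \<phi>]) auto
    with \<open>\<phi> \<in> L2\<close> show "\<phi> \<in> V" by (simp add: V_def)
  next
    fix f g assume f: "f \<in> V" and g: "g \<in> V"
    show "(\<lambda>x. f x + g x) \<in> V" unfolding V_def
    proof safe
      show "(\<lambda>x. f x + g x) \<in> L2" using f g by (auto simp: V_def intro: L2_add)
      fix e :: real assume "e > 0"
      then obtain \<phi> \<psi> where \<phi>: "\<phi> \<in> T" "L2_norm (\<lambda>x. f x - \<phi> x) < e / 2"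
        and \<psi>: "\<psi> \<in> T" "L2_norm (\<lambda>x. g x - \<psi> x) < e / 2"
        using f g half_gt_zero[of e] unfolding V_def by blast
      have "L2_norm (\<lambda>x. (f x - \<phi> x) + (g x - \<psi> x)) < e"
        using L2_norm_triangle[of "\<lambda>x. f x - \<phi> x" "\<lambda>x. g x - \<psi> x"] \<phi> \<psi> f g
        by (simp add: T_def V_def L2_diff)
      moreover have "(\<lambda>x. (f x - \<phi> x) + (g x - \<psi> x)) = (\<lambda>x. f x + g x - (\<phi> x + \<psi> x))" by auto
      moreover have "(\<lambda>x. \<phi> x + \<psi> x) \<in> T"
      proof -
        have "bounded {x. \<phi> x + \<psi> x \<noteq> 0}"
          by (rule bounded_subset[of "{x. \<phi> x \<noteq> 0} \<union> {x. \<psi> x \<noteq> 0}"])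
            (use \<phi> \<psi> in \<open>auto simp: T_def\<close>)
        then show ?thesis using \<phi> \<psi> by (auto simp: T_def intro: flat_algebra.add L2_add)
      qed
      ultimately show "\<exists>\<phi>\<in>T. L2_norm (\<lambda>x. f x + g x - \<phi> x) < e" by (intro bexI[of _ "\<lambda>x. \<phi> x + \<psi> x"]) simp_all
    qed
  next
    fix c f assume f: "f \<in> V"
    show "(\<lambda>x. c * f x) \<in> V" unfolding V_def
    proof safe
      show "(\<lambda>x. c * f x) \<in> L2" using f by (auto simp: V_def intro: L2_cmult)
      fix e :: real assume "e > 0"
      then have "e / (cmod c + 1) > 0" by (simp add: add_nonneg_pos)
      then obtain \<phi> where \<phi>: "\<phi> \<in> T" "L2_norm (\<lambda>x. f x - \<phi> x) < e / (cmod c + 1)"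
        using f unfolding V_def by blast
      have "L2_norm (\<lambda>x. c * (f x - \<phi> x)) \<le> (cmod c + 1) * L2_norm (\<lambda>x. f x - \<phi> x)"
        unfolding L2_norm_cmult by (intro mult_right_mono) auto
      also have "\<dots> < e" using \<phi>(2) by (simp add: pos_less_divide_eq add_nonneg_pos mult.commute)
      finally have "L2_norm (\<lambda>x. c * f x - c * \<phi> x) < e" by (simp add: right_diff_distrib)
      moreover have "(\<lambda>x. c * \<phi> x) \<in> T"
      proof -
        have "bounded {x. c * \<phi> x \<noteq> 0}"
          by (rule bounded_subset[of "{x. \<phi> x \<noteq> 0}"]) (use \<phi> in \<open>auto simp: T_def\<close>)
        then show ?thesis using \<phi> by (auto simp: T_def intro: flat_algebra.intros L2_cmult)
      qed
      ultimately show "\<exists>\<phi>\<in>T. L2_norm (\<lambda>x. c * f x - \<phi> x) < e" by (intro bexI[of _ "\<lambda>x. c * \<phi> x"]) simp_all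
    qed
  next
    fix F :: "nat \<Rightarrow> 'a \<Rightarrow> complex" and f C and a b :: 'a
    assume F: "\<And>n. F n \<in> V" and bd: "\<And>n x. cmod (F n x) \<le> C * indicator (cbox a b) x"
      and lim: "\<And>x. (\<lambda>n. F n x) \<longlonglongrightarrow> f x"
    have [measurable]: "F n \<in> borel_measurable borel" for n
      using F[of n] by (auto simp: V_def L2_def)
    have [measurable]: "f \<in> borel_measurable borel"
      by (rule borel_measurable_LIMSEQ_metric[OF _ lim]) measurable
    have f_bd: "cmod (f x) \<le> C * indicator (cbox a b) x" for x
      by (rule LIMSEQ_le_const2[OF tendsto_norm[OF lim]]) (use bd in blast)
    show "f \<in> V"
    proof (rule closed)
      show "f \<in> L2"
      proof (rule L2_bound[OF _ ind_int])
        show "AE x in lborel. (cmod (f x))\<^sup>2 \<le> C\<^sup>2 * indicator (cbox a b) x"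
        proof (rule AE_I2)
          fix x
          have "(cmod (f x))\<^sup>2 \<le> (C * indicator (cbox a b) x)\<^sup>2" by (intro power_mono f_bd) auto
          then show "(cmod (f x))\<^sup>2 \<le> C\<^sup>2 * indicator (cbox a b) x" by (auto simp: indicator_def)
        qed
      qed measurable
      show "(\<lambda>n. L2_norm (\<lambda>x. f x - F n x)) \<longlonglongrightarrow> 0"
      proof (rule L2_norm_dominated[OF _ _ ind_int])
        show "(\<lambda>n. f x - F n x) \<longlonglongrightarrow> 0" for x
          using tendsto_diff[OF tendsto_const lim, of "f x" x] by simp
        show "(cmod (f x - F n x))\<^sup>2 \<le> (2 * C)\<^sup>2 * indicator (cbox a b) x" for n x
        proof -
          have "cmod (f x - F n x) \<le> 2 * C * indicator (cbox a b) x"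
            using norm_triangle_ineq4[of "f x" "F n x"] f_bd[of x] bd[of n x] by simp
          then have "(cmod (f x - F n x))\<^sup>2 \<le> (2 * C * indicator (cbox a b) x)\<^sup>2"
            by (intro power_mono) auto
          then show ?thesis by (auto simp: indicator_def split: if_splits)
        qed
      qed measurable
    qed fact
  qed
  note [measurable] = L2D(1)[OF assms(1)]
  define F where "F n x = f x * indicator (cbox (- (real n *\<^sub>R One)) (real n *\<^sub>R One)) x *
      indicator {y. cmod (f y) \<le> real n} x" for n x
  have "f \<in> V"
  proof (rule closed[OF assms(1)])
    show "F n \<in> V" for n
    proof (rule bdd)
      show "F n \<in> borel_measurable borel" unfolding F_def by measurable
      show "cmod (F n x) \<le> real n * indicator (cbox (- (real n *\<^sub>R One)) (real n *\<^sub>R One)) x" for x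
        by (auto simp: F_def indicator_def)
    qed
    show "(\<lambda>n. L2_norm (\<lambda>x. f x - F n x)) \<longlonglongrightarrow> 0"
    proof (rule L2_norm_dominated[OF _ _ L2D(2)[OF assms(1)]])
      show "(\<lambda>n. f x - F n x) \<longlonglongrightarrow> 0" for x
      proof -
        have "(\<lambda>n. indicator {y. cmod (f y) \<le> real n} x :: complex) \<longlonglongrightarrow> 1"
        proof (rule tendsto_eventually)
          show "\<forall>\<^sub>F n in sequentially. (indicator {y. cmod (f y) \<le> real n} x :: complex) = 1"
            using eventually_ge_at_top[of "nat \<lceil>cmod (f x)\<rceil>"]
            by eventually_elim (simp add: nat_le_iff ceiling_le_iff)
        qed
        then have "(\<lambda>n. F n x) \<longlonglongrightarrow> f x * 1 * 1"
          unfolding F_def by (intro tendsto_intros cbox_cover_tendsto)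
        then show ?thesis using tendsto_diff[OF tendsto_const[of "f x"], of "\<lambda>n. F n x" "f x"] by simp
      qed
      show "(cmod (f x - F n x))\<^sup>2 \<le> (cmod (f x))\<^sup>2" for n x
        by (auto simp: F_def indicator_def)
    qed (auto simp: F_def)
  qed
  then obtain \<phi> where "\<phi> \<in> T" "L2_norm (\<lambda>x. f x - \<phi> x) < e"
    using assms(2) unfolding V_def by blast
  then show ?thesis unfolding T_def using test_functionI by blast
qed

section \<open>Uniqueness and linearity of weak derivatives\<close>

lemma test_function_differentiable:
  assumes "test_function \<phi>"
  shows "(\<phi> has_derivative frechet_derivative \<phi> (at x)) (at x)"
proof -
  have "Ck (Suc 0) \<phi>" using assms by (auto simp: test_function_def)
  then show ?thesis by (simp add: frechet_derivative_works[symmetric])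
qed

lemma test_function_continuous: "test_function \<phi> \<Longrightarrow> continuous_on UNIV \<phi>"
  by (metis Ck.simps(1) test_function_def)

lemma test_function_deriv_continuous:
  assumes "test_function \<phi>" "b \<in> Basis"
  shows "continuous_on UNIV (\<lambda>x. frechet_derivative \<phi> (at x) b)"
proof -
  have "Ck (Suc 0) \<phi>" using assms by (auto simp: test_function_def)
  then show ?thesis using assms(2) by simp
qed

lemma test_function_bounded_support: "test_function \<phi> \<Longrightarrow> bounded {x. \<phi> x \<noteq> 0}"
  unfolding test_function_def by (meson bounded_subset closure_subset compact_imp_bounded)

lemma test_function_deriv_support:
  assumes "test_function \<phi>"
  shows "bounded {x. frechet_derivative \<phi> (at x) b \<noteq> 0}"
proof (rule bounded_subset)
  show "bounded (closure {x. \<phi> x \<noteq> 0})"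
    by (rule bounded_closure[OF test_function_bounded_support[OF assms]])
  show "{x. frechet_derivative \<phi> (at x) b \<noteq> 0} \<subseteq> closure {x. \<phi> x \<noteq> 0}"
  proof
    fix x assume "x \<in> {x. frechet_derivative \<phi> (at x) b \<noteq> 0}"
    then have nz: "frechet_derivative \<phi> (at x) b \<noteq> 0" by simp
    show "x \<in> closure {x. \<phi> x \<noteq> 0}"
    proof (rule ccontr)
      assume x: "x \<notin> closure {x. \<phi> x \<noteq> 0}"
      have "((\<lambda>_. 0) has_derivative (\<lambda>_. 0)) (at x)" by simp
      then have "(\<phi> has_derivative (\<lambda>_. 0)) (at x)"
      proof (rule has_derivative_transform_within_open)
        show "open (- closure {x. \<phi> x \<noteq> 0})" by auto
        show "x \<in> - closure {x. \<phi> x \<noteq> 0}" using x by simp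
        show "0 = \<phi> y" if "y \<in> - closure {x. \<phi> x \<noteq> 0}" for y
          using that closure_subset[of "{x. \<phi> x \<noteq> 0}"] by auto
      qed
      from frechet_derivative_at[OF this] nz show False by metis
    qed
  qed
qed

lemma test_function_translate:
  assumes "test_function \<phi>"
  shows "test_function (\<lambda>x. \<phi> (x - y))"
proof -
  have tr: "((\<lambda>x. f (x - y)) has_derivative f') (at x)" if "(f has_derivative f') (at (x - y))"
    for f :: "'a \<Rightarrow> complex" and f' x
  proof -
    have "((\<lambda>x. x - y) has_derivative (\<lambda>h. h)) (at x)" by (auto intro!: derivative_eq_intros)
    from has_derivative_compose[OF this that] show ?thesis .
  qed
  have "Ck k (\<lambda>x. f (x - y))" if "Ck k f" for k and f :: "'a \<Rightarrow> complex"
    using that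
  proof (induction k arbitrary: f)
    case 0
    then have "continuous_on UNIV f" by simp
    then show ?case
      by (auto intro!: continuous_on_compose2[of UNIV f] continuous_intros)
  next
    case (Suc k)
    have d: "((\<lambda>x. f (x - y)) has_derivative frechet_derivative f (at (x - y))) (at x)" for x
      using Suc.prems by (intro tr) (simp add: frechet_derivative_works[symmetric])
    then have "frechet_derivative (\<lambda>x. f (x - y)) (at x) = frechet_derivative f (at (x - y))" for x
      by (metis frechet_derivative_at)
    then show ?case
      using Suc.IH[of "\<lambda>x. frechet_derivative f (at x) b" for b] Suc.prems d
      by (auto simp: differentiable_def)
  qed
  moreover have "bounded {x. \<phi> (x - y) \<noteq> 0}"
  proof -
    have "{x. \<phi> (x - y) \<noteq> 0} = (+) y ` {x. \<phi> x \<noteq> 0}"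
      by (force simp: image_def intro: exI[of _ "_ - y"])
    then show ?thesis
      using bounded_translation[OF test_function_bounded_support[OF assms]] by simp
  qed
  ultimately show ?thesis using assms by (simp add: test_function_def compact_closure)
qed

lemma locally_integrable_mult_bounded:
  assumes "locally_integrable f" and [measurable]: "g \<in> borel_measurable borel"
    and g: "\<And>x. cmod (g x) \<le> C * indicator (cbox a b) x"
  shows "integrable lborel (\<lambda>x. f x * g x)"
proof (rule Bochner_Integration.integrable_bound)
  have [measurable]: "f \<in> borel_measurable borel"
    using assms(1) by (simp add: locally_integrable_def)
  have "integrable lborel (\<lambda>x. indicator (cbox a b) x *\<^sub>R f x)"
    using assms(1) by (simp add: locally_integrable_def set_integrable_def)
  then show "integrable lborel (\<lambda>x. C * norm (indicator (cbox a b) x *\<^sub>R f x))"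
    by (intro integrable_mult_right integrable_norm)
  show "(\<lambda>x. f x * g x) \<in> borel_measurable lborel" by measurable
  show "AE x in lborel. norm (f x * g x) \<le> norm (C * norm (indicator (cbox a b) x *\<^sub>R f x))"
  proof (rule AE_I2)
    fix x
    have "cmod (f x) * cmod (g x) \<le> cmod (f x) * (C * indicator (cbox a b) x)"
      by (intro mult_left_mono g) auto
    also have "\<dots> = C * norm (indicator (cbox a b) x *\<^sub>R f x)" by simp
    finally show "norm (f x * g x) \<le> norm (C * norm (indicator (cbox a b) x *\<^sub>R f x))"
      by (simp add: norm_mult)
  qed
qed

lemma locally_integrable_mult_test:
  assumes "locally_integrable f" "test_function \<phi>"
  shows "integrable lborel (\<lambda>x. f x * \<phi> x)"
    and "b \<in> Basis \<Longrightarrow> integrable lborel (\<lambda>x. f x * frechet_derivative \<phi> (at x) b)"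
proof -
  have *: "integrable lborel (\<lambda>x. f x * g x)" if "continuous_on UNIV g" "bounded {x. g x \<noteq> 0}" for g
  proof -
    obtain K a where "\<And>x. cmod (g x) \<le> K * indicator (cbox (-a) a) x"
      using continuous_compact_support_bound[OF \<open>continuous_on UNIV g\<close> \<open>bounded _\<close>] by metis
    then show ?thesis
      by (rule locally_integrable_mult_bounded[OF assms(1) borel_measurable_continuous_onI[OF that(1)]])
  qed
  show "integrable lborel (\<lambda>x. f x * \<phi> x)"
    by (intro * test_function_continuous test_function_bounded_support assms)
  show "b \<in> Basis \<Longrightarrow> integrable lborel (\<lambda>x. f x * frechet_derivative \<phi> (at x) b)"
    by (intro * test_function_deriv_continuous test_function_deriv_support assms)
qed

text \<open>The fundamental lemma of the calculus of variations. By the monotone class theorem \<open>h\<close> is orthogonal to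
  all bounded functions of bounded support, in particular to its conjugate sign on a box.\<close>

lemma locally_integrable_eq_zero:
  assumes h: "locally_integrable h"
    and orth: "\<And>\<phi>. test_function \<phi> \<Longrightarrow> (LINT x|lborel. h x * \<phi> x) = 0"
  shows "AE x in lborel. h x = 0"
proof -
  have [measurable]: "h \<in> borel_measurable borel" using h by (simp add: locally_integrable_def)
  define V where "V = {f \<in> borel_measurable borel.
    integrable lborel (\<lambda>x. h x * f x) \<and> (LINT x|lborel. h x * f x) = 0}"
  have V: "f \<in> V" if f_meas: "f \<in> borel_measurable borel"
    and f_bound: "\<And>x. cmod (f x) \<le> C * indicator (cbox a b) x" for f C a b
  proof (rule test_function_monotone_class[where C = C and a = a and b = b])
    show "f \<in> borel_measurable borel" by (rule f_meas)
    show "cmod (f x) \<le> C * indicator (cbox a b) x" for x by (rule f_bound)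
  next
    fix \<phi> :: "'a \<Rightarrow> complex" assume "flat_algebra \<phi>" "bounded {x. \<phi> x \<noteq> 0}"
    then have "test_function \<phi>" by (rule test_functionI)
    then show "\<phi> \<in> V"
      using orth locally_integrable_mult_test(1)[OF h] test_function_continuous
      by (auto simp: V_def intro: borel_measurable_continuous_onI)
  next
    fix f g assume "f \<in> V" "g \<in> V"
    then show "(\<lambda>x. f x + g x) \<in> V" by (auto simp: V_def distrib_left)
  next
    fix c f assume "f \<in> V"
    then show "(\<lambda>x. c * f x) \<in> V" by (auto simp: V_def mult.left_commute[of _ c])
  next
    fix F :: "nat \<Rightarrow> 'a \<Rightarrow> complex" and f C and a b :: 'a
    assume F: "\<And>n. F n \<in> V" and bd: "\<And>n x. cmod (F n x) \<le> C * indicator (cbox a b) x"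
      and lim: "\<And>x. (\<lambda>n. F n x) \<longlonglongrightarrow> f x"
    have [measurable]: "F n \<in> borel_measurable borel" for n using F[of n] by (auto simp: V_def)
    have [measurable]: "f \<in> borel_measurable borel"
      by (rule borel_measurable_LIMSEQ_metric[OF _ lim]) measurable
    have f_bd: "cmod (f x) \<le> C * indicator (cbox a b) x" for x
      by (rule LIMSEQ_le_const2[OF tendsto_norm[OF lim]]) (use bd in blast)
    have "integrable lborel (\<lambda>x. indicator (cbox a b) x *\<^sub>R h x)"
      using h by (simp add: locally_integrable_def set_integrable_def)
    then have w: "integrable lborel (\<lambda>x. C * norm (indicator (cbox a b) x *\<^sub>R h x))"
      by (intro integrable_mult_right integrable_norm)
    have "(\<lambda>n. LINT x|lborel. h x * F n x) \<longlonglongrightarrow> (LINT x|lborel. h x * f x)"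
    proof (rule integral_dominated_convergence[OF _ _ w])
      show "AE x in lborel. (\<lambda>n. h x * F n x) \<longlonglongrightarrow> h x * f x"
        using lim by (auto intro!: tendsto_intros)
      show "AE x in lborel. norm (h x * F n x) \<le> C * norm (indicator (cbox a b) x *\<^sub>R h x)" for n
      proof (rule AE_I2)
        fix x
        have "cmod (h x) * cmod (F n x) \<le> cmod (h x) * (C * indicator (cbox a b) x)"
          by (intro mult_left_mono bd) auto
        then show "norm (h x * F n x) \<le> C * norm (indicator (cbox a b) x *\<^sub>R h x)"
          by (simp add: norm_mult mult_ac)
      qed
    qed measurable
    moreover have "(LINT x|lborel. h x * F n x) = 0" for n using F[of n] by (simp add: V_def)
    ultimately have "(LINT x|lborel. h x * f x) = 0" by (simp add: LIMSEQ_const_iff)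
    then show "f \<in> V"
      using locally_integrable_mult_bounded[OF h _ f_bd] by (auto simp: V_def)
  qed
  define B where "B n = cbox (- (real n *\<^sub>R One)) (real n *\<^sub>R (One::'a))" for n
  have "AE x in lborel. cmod (h x) * indicator (B n) x = 0" for n
  proof -
    let ?f = "\<lambda>x. cnj (sgn (h x)) * indicator (B n) x"
    have "?f \<in> V"
    proof (rule V)
      show "?f \<in> borel_measurable borel" unfolding B_def sgn_div_norm by measurable
      show "cmod (?f x) \<le> 1 * indicator (cbox (- (real n *\<^sub>R One)) (real n *\<^sub>R One)) x" for x
        by (simp add: B_def norm_mult norm_sgn indicator_def)
    qed
    moreover have "h x * ?f x = of_real (cmod (h x) * indicator (B n) x)" for x
    proof -
      have "h x * cnj (sgn (h x)) = of_real (cmod (h x))"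
        using complex_norm_square[of "h x"]
        by (cases "h x = 0") (simp_all add: sgn_eq power2_eq_square field_simps)
      then show ?thesis by (simp add: indicator_def)
    qed
    ultimately have i: "integrable lborel (\<lambda>x. complex_of_real (cmod (h x) * indicator (B n) x))"
      and z: "(LINT x|lborel. complex_of_real (cmod (h x) * indicator (B n) x)) = 0"
      by (auto simp: V_def)
    have "integrable lborel (\<lambda>x. cmod (h x) * indicator (B n) x)"
      using integrable_Re[OF i] by simp
    moreover have "(LINT x|lborel. cmod (h x) * indicator (B n) x) = 0"
      using z unfolding integral_complex_of_real by (simp only: of_real_eq_0_iff)
    ultimately show ?thesis
      by (subst (asm) integral_nonneg_eq_0_iff_AE) auto
  qed
  then have "AE x in lborel. \<forall>n. cmod (h x) * indicator (B n) x = 0" by (subst AE_all_countable) blast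
  then show ?thesis
  proof (rule eventually_mono)
    fix x assume *: "\<forall>n. cmod (h x) * indicator (B n) x = 0"
    obtain n where "x \<in> B n" using cbox_cover[of x] by (auto simp: B_def)
    with *[rule_format, of n] show "h x = 0" by simp
  qed
qed

lemma L2_locally_integrable: "f \<in> L2 \<Longrightarrow> locally_integrable f"
  unfolding locally_integrable_def
proof safe
  assume f: "f \<in> L2"
  show "f \<in> borel_measurable lborel" using L2D(1)[OF f] by simp
  fix K :: "'a set" assume "compact K"
  then have [measurable]: "K \<in> sets borel" and "emeasure lborel K < \<infinity>"
    by (rule borel_compact, rule emeasure_bounded_finite[OF compact_imp_bounded])
  have "(indicator K :: 'a \<Rightarrow> complex) \<in> L2"
  proof (rule L2_bound)
    show "integrable lborel (indicat_real K)"
      using \<open>emeasure lborel K < \<infinity>\<close> by (intro integrable_real_indicator) auto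
  qed (auto simp: indicator_def)
  from L2_integrable_mult[OF this f] show "set_integrable lborel K f"
    unfolding set_integrable_def by (rule Bochner_Integration.integrable_cong[THEN iffD1, rotated 2])
      (auto simp: indicator_def)
qed

lemma locally_integrable_diff:
  assumes "locally_integrable f" "locally_integrable g"
  shows "locally_integrable (\<lambda>x. f x - g x)"
  using assms by (auto simp: locally_integrable_def intro!: set_integral_diff(1))

lemma has_weak_deriv_unique:
  assumes "has_weak_deriv b f g" "has_weak_deriv b f g'"
  shows "AE x in lborel. g x = g' x"
proof -
  have "AE x in lborel. g x - g' x = 0"
  proof (rule locally_integrable_eq_zero)
    show "locally_integrable (\<lambda>x. g x - g' x)"
      using assms by (auto simp: has_weak_deriv_def intro: locally_integrable_diff)
    fix \<phi> :: "'a \<Rightarrow> complex" assume \<phi>: "test_function \<phi>"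
    then have "- (LINT x|lborel. g x * \<phi> x) = - (LINT x|lborel. g' x * \<phi> x)"
      using assms unfolding has_weak_deriv_def by metis
    then show "(LINT x|lborel. (g x - g' x) * \<phi> x) = 0"
      using assms \<phi> by (simp add: left_diff_distrib has_weak_deriv_def locally_integrable_mult_test)
  qed
  then show ?thesis by simp
qed

lemma has_weak_deriv_diff:
  assumes "b \<in> Basis" "has_weak_deriv b f f'" "has_weak_deriv b g g'"
  shows "has_weak_deriv b (\<lambda>x. f x - g x) (\<lambda>x. f' x - g' x)"
  using assms
  by (auto simp: has_weak_deriv_def left_diff_distrib locally_integrable_mult_test intro: locally_integrable_diff)

lemma weak_deriv_works:
  assumes "f \<in> H1" "b \<in> Basis"
  shows "has_weak_deriv b f (weak_deriv b f)"
  unfolding weak_deriv_def using assms by (intro someI_ex[of "has_weak_deriv b f"]) (auto simp: H1_def)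

lemma weak_deriv_in_L2:
  assumes "f \<in> H1" "b \<in> Basis"
  shows "weak_deriv b f \<in> L2"
proof -
  obtain g where g: "g \<in> L2" "has_weak_deriv b f g" using assms by (auto simp: H1_def)
  have "AE x in lborel. weak_deriv b f x = g x"
    by (rule has_weak_deriv_unique[OF weak_deriv_works[OF assms] g(2)])
  moreover have "weak_deriv b f \<in> borel_measurable borel"
    using weak_deriv_works[OF assms] by (simp add: has_weak_deriv_def locally_integrable_def)
  ultimately show ?thesis using L2D(2)[OF g(1)]
    by (intro L2_bound[where w = "\<lambda>x. (cmod (g x))\<^sup>2"]) (auto elim: eventually_mono)
qed

lemma H1_L2: "f \<in> H1 \<Longrightarrow> f \<in> L2" by (simp add: H1_def)

lemma H1_diff:
  assumes "f \<in> H1" "g \<in> H1"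
  shows "(\<lambda>x. f x - g x) \<in> H1"
  unfolding H1_def
proof safe
  show "(\<lambda>x. f x - g x) \<in> L2" using assms by (intro L2_diff H1_L2)
  fix b :: 'a assume b: "b \<in> Basis"
  show "\<exists>h\<in>L2. has_weak_deriv b (\<lambda>x. f x - g x) h"
    using has_weak_deriv_diff[OF b weak_deriv_works[OF assms(1) b] weak_deriv_works[OF assms(2) b]]
      L2_diff[OF weak_deriv_in_L2[OF assms(1) b] weak_deriv_in_L2[OF assms(2) b]] by blast
qed

lemma weak_deriv_diff:
  assumes "f \<in> H1" "g \<in> H1" "b \<in> Basis"
  shows "AE x in lborel. weak_deriv b (\<lambda>x. f x - g x) x = weak_deriv b f x - weak_deriv b g x"
  by (rule has_weak_deriv_unique[OF weak_deriv_works has_weak_deriv_diff])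
    (use assms in \<open>auto intro: H1_diff weak_deriv_works\<close>)

section \<open>Integration by parts\<close>

lemma vector_derivative_bound:
  fixes F :: "real \<Rightarrow> 'b::real_normed_vector"
  assumes "\<And>s. (F has_vector_derivative F' s) (at s)" "\<And>s. norm (F' s) \<le> K"
  shows "norm (F s - F r) \<le> K * \<bar>s - r\<bar>"
proof -
  have "norm (F s - F r) \<le> K * norm (s - r)"
  proof (rule differentiable_bound[of UNIV F "\<lambda>s h. h *\<^sub>R F' s"])
    show "(F has_derivative (\<lambda>h. h *\<^sub>R F' t)) (at t within UNIV)" for t
      using assms(1)[of t] by (simp add: has_vector_derivative_def)
    show "onorm (\<lambda>h. h *\<^sub>R F' t) \<le> K" for t
      using assms(2)[of t] by (intro onorm_le) (simp add: mult.commute[of K] mult_left_mono)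
  qed auto
  then show ?thesis by simp
qed

lemma has_vector_derivative_quotient:
  fixes F :: "real \<Rightarrow> complex"
  shows "(F has_vector_derivative v) (at s) \<longleftrightarrow>
    ((\<lambda>h. (F (s + h) - F s) / complex_of_real h) \<longlongrightarrow> v) (at 0)"
proof -
  have *: "norm (F (s + h) - F s - h *\<^sub>R v) / norm h = norm ((F (s + h) - F s) / complex_of_real h - v)"
    if "h \<noteq> 0" for h
  proof -
    have "(F (s + h) - F s) / complex_of_real h - v = (F (s + h) - F s - h *\<^sub>R v) / complex_of_real h"
      using that by (simp add: field_simps scaleR_conv_of_real)
    then show ?thesis by (simp add: norm_divide)
  qed
  have "(F has_vector_derivative v) (at s) \<longleftrightarrow>
      ((\<lambda>h. norm (F (s + h) - F s - h *\<^sub>R v) / norm h) \<longlongrightarrow> 0) (at 0)"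
    by (simp add: has_vector_derivative_def has_derivative_at bounded_linear_scaleR_left)
  also have "\<dots> \<longleftrightarrow> ((\<lambda>h. norm ((F (s + h) - F s) / complex_of_real h - v)) \<longlongrightarrow> 0) (at 0)"
    by (rule tendsto_cong) (use * in \<open>auto simp: eventually_at_filter\<close>)
  also have "\<dots> \<longleftrightarrow> ((\<lambda>h. (F (s + h) - F s) / complex_of_real h) \<longlongrightarrow> v) (at 0)"
    unfolding tendsto_norm_zero_iff by (rule LIM_zero_iff)
  finally show ?thesis .
qed

lemma integral_translate:
  fixes f :: "'a::euclidean_space \<Rightarrow> 'b::{banach, second_countable_topology}"
  assumes "f \<in> borel_measurable borel"
  shows "(LINT x|lborel. f (x + y)) = (LINT x|lborel. f x)"
    and "integrable lborel (\<lambda>x. f (x + y)) \<longleftrightarrow> integrable lborel f"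
proof -
  have "(LINT x|lborel. f x) = (LINT x|distr lborel borel ((+) y). f x)"
    by (simp add: lborel_distr_plus)
  also have "\<dots> = (LINT x|lborel. f (x + y))"
    using assms by (subst integral_distr) (auto simp: add.commute)
  finally show "(LINT x|lborel. f (x + y)) = (LINT x|lborel. f x)" ..
  have "integrable lborel f \<longleftrightarrow> integrable (distr lborel borel ((+) y)) f"
    by (simp add: lborel_distr_plus)
  also have "\<dots> \<longleftrightarrow> integrable lborel (\<lambda>x. f (x + y))"
    using assms by (subst integrable_distr_eq) (auto simp: add.commute)
  finally show "integrable lborel (\<lambda>x. f (x + y)) \<longleftrightarrow> integrable lborel f" ..
qed

lemma L2_translate:
  fixes f :: "'a::euclidean_space \<Rightarrow> complex"
  assumes "f \<in> L2"
  shows "(\<lambda>x. f (x - y)) \<in> L2" and "L2_norm (\<lambda>x. f (x - y)) = L2_norm f"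
proof -
  have [measurable]: "f \<in> borel_measurable borel" by (rule L2D(1)[OF assms])
  have "(\<lambda>x. f (x - y)) \<in> borel_measurable borel" by measurable
  then show "(\<lambda>x. f (x - y)) \<in> L2"
    using integral_translate(2)[of "\<lambda>x. (cmod (f x))\<^sup>2" "-y"] L2D(2)[OF assms] by (simp add: L2_def)
  show "L2_norm (\<lambda>x. f (x - y)) = L2_norm f"
    using integral_translate(1)[of "\<lambda>x. (cmod (f x))\<^sup>2" "-y"] by (simp add: L2_norm_def)
qed

lemma L2_norm_cnj: "L2_norm (\<lambda>x. cnj (f x)) = L2_norm f"
  by (simp add: L2_norm_def)

lemma L2_bilinear_bound:
  assumes "f \<in> L2" "g \<in> L2"
  shows "cmod (LINT x|lborel. f x * g x) \<le> L2_norm f * L2_norm g"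
  using L2_Cauchy_Schwarz[OF assms(1) L2_cnj[OF assms(2)]] by (simp add: l2_inner_def L2_norm_cnj)

lemma test_function_increment_bound:
  fixes \<phi> :: "'a::euclidean_space \<Rightarrow> complex"
  assumes "test_function \<phi>" "b \<in> Basis" "\<And>x. cmod (frechet_derivative \<phi> (at x) b) \<le> K"
  shows "((\<lambda>s. \<phi> (x - s *\<^sub>R b)) has_vector_derivative - frechet_derivative \<phi> (at (x - s *\<^sub>R b)) b) (at s)"
    and "cmod (\<phi> (x - s *\<^sub>R b) - \<phi> x) \<le> K * \<bar>s\<bar>"
proof -
  show d: "((\<lambda>s. \<phi> (x - s *\<^sub>R b)) has_vector_derivative - frechet_derivative \<phi> (at (x - s *\<^sub>R b)) b) (at s)" for s
  proof -
    have lin: "bounded_linear (frechet_derivative \<phi> (at (x - s *\<^sub>R b)))"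
      using test_function_differentiable[OF assms(1)] by (rule has_derivative_bounded_linear)
    have "((\<lambda>s. x - s *\<^sub>R b) has_derivative (\<lambda>h. - (h *\<^sub>R b))) (at s)"
      by (auto intro!: derivative_eq_intros)
    from has_derivative_compose[OF this test_function_differentiable[OF assms(1)]]
    show ?thesis
      by (simp add: has_vector_derivative_def linear_simps[OF lin])
  qed
  have "norm (\<phi> (x - s *\<^sub>R b) - \<phi> (x - 0 *\<^sub>R b)) \<le> K * \<bar>s - 0\<bar>"
    by (rule vector_derivative_bound[OF d]) (simp add: assms(3))
  then show "cmod (\<phi> (x - s *\<^sub>R b) - \<phi> x) \<le> K * \<bar>s\<bar>" by simp
qed

text \<open>The difference quotients of a test function are bounded and supported in a common box, so dominated
  convergence differentiates under the integral; the definition of the weak derivative then moves the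
  derivative from \<open>\<phi>\<close> to \<open>f\<close>.\<close>

lemma weak_deriv_test_translation_derivative_0:
  fixes f g \<phi> :: "'a::euclidean_space \<Rightarrow> complex"
  assumes fg: "has_weak_deriv b f g" and \<phi>: "test_function \<phi>" and b: "b \<in> Basis"
  shows "((\<lambda>s. LINT x|lborel. f x * \<phi> (x - s *\<^sub>R b)) has_vector_derivative
          (LINT x|lborel. g x * \<phi> x)) (at 0)"
  unfolding has_vector_derivative_quotient tendsto_at_iff_sequentially
proof (intro allI impI)
  fix X :: "nat \<Rightarrow> real" assume X: "\<forall>i. X i \<in> UNIV - {0}" "X \<longlonglongrightarrow> 0"
  have f: "locally_integrable f" using fg by (simp add: has_weak_deriv_def)
  then have [measurable]: "f \<in> borel_measurable borel" by (simp add: locally_integrable_def)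
  have [measurable]: "\<phi> \<in> borel_measurable borel"
    by (intro borel_measurable_continuous_onI test_function_continuous \<phi>)
  obtain K where "0 \<le> K" and K: "\<And>x. cmod (frechet_derivative \<phi> (at x) b) \<le> K"
  proof -
    obtain K a where K: "0 \<le> K" "\<And>x. cmod (frechet_derivative \<phi> (at x) b) \<le> K * indicator (cbox (-a) a) x"
      using continuous_compact_support_bound[OF test_function_deriv_continuous[OF \<phi> b]
          test_function_deriv_support[OF \<phi>]] by metis
    have "cmod (frechet_derivative \<phi> (at x) b) \<le> K" for x
      using K(2)[of x] K(1) by (cases "x \<in> cbox (-a) a") auto
    with K(1) show thesis by (rule that)
  qed
  note incr = test_function_increment_bound[OF \<phi> b K]
  obtain \<rho> where \<rho>: "\<And>x. \<phi> x \<noteq> 0 \<Longrightarrow> norm x \<le> \<rho>"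
    using test_function_bounded_support[OF \<phi>] by (auto simp: bounded_iff)
  obtain R where R: "\<And>i. \<bar>X i\<bar> \<le> R"
    using convergent_imp_bounded[OF X(2)] by (auto simp: bounded_iff)
  obtain e where e: "cball 0 (\<rho> + R) \<subseteq> cbox (-e) (e::'a)"
    using bounded_subset_cbox_symmetric[OF bounded_cball] by metis
  have "0 \<le> R" using R[of 0] by linarith
  let ?Q = "\<lambda>i x. (\<phi> (x - X i *\<^sub>R b) - \<phi> x) / complex_of_real (X i)"
  have Q: "cmod (?Q i x) \<le> K * indicator (cbox (-e) e) x" for i x
  proof (cases "x \<in> cbox (-e) e")
    case True
    have "cmod (?Q i x) = cmod (\<phi> (x - X i *\<^sub>R b) - \<phi> x) / \<bar>X i\<bar>" by (simp add: norm_divide)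
    also have "\<dots> \<le> K" using incr(2)[of x "X i"] X(1) by (simp add: pos_divide_le_eq)
    finally show ?thesis using True by simp
  next
    case False
    then have "x \<notin> cball 0 (\<rho> + R)" using e by blast
    then have "norm x > \<rho> + R" by simp
    moreover have "norm (X i *\<^sub>R b) \<le> R" using R[of i] b by simp
    ultimately have "norm x > \<rho>" "norm (x - X i *\<^sub>R b) > \<rho>"
      using \<open>0 \<le> R\<close> norm_triangle_ineq2[of x "X i *\<^sub>R b"] by linarith+
    then have "\<phi> x = 0" "\<phi> (x - X i *\<^sub>R b) = 0" using \<rho> by force+
    then show ?thesis using False by simp
  qed
  have int: "integrable lborel (\<lambda>x. f x * \<phi> (x - y))" for y
    by (rule locally_integrable_mult_test(1)[OF f test_function_translate[OF \<phi>]])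
  have quot: "((LINT x|lborel. f x * \<phi> (x - (0 + X i) *\<^sub>R b)) - (LINT x|lborel. f x * \<phi> (x - 0 *\<^sub>R b))) /
      complex_of_real (X i) = (LINT x|lborel. f x * ?Q i x)" for i
    using int[of "X i *\<^sub>R b"] int[of 0]
    by (simp add: right_diff_distrib diff_divide_distrib)
  have "(\<lambda>i. LINT x|lborel. f x * ?Q i x) \<longlonglongrightarrow> (LINT x|lborel. f x * (- frechet_derivative \<phi> (at x) b))"
  proof (rule integral_dominated_convergence)
    have "integrable lborel (\<lambda>x. indicator (cbox (-e) e) x *\<^sub>R f x)"
      using f by (simp add: locally_integrable_def set_integrable_def)
    then show "integrable lborel (\<lambda>x. K * norm (indicator (cbox (-e) e) x *\<^sub>R f x))"
      by (intro integrable_mult_right integrable_norm)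
    show "AE x in lborel. norm (f x * ?Q i x) \<le> K * norm (indicator (cbox (-e) e) x *\<^sub>R f x)" for i
    proof (rule AE_I2)
      fix x
      have "cmod (f x) * cmod (?Q i x) \<le> cmod (f x) * (K * indicator (cbox (-e) e) x)"
        by (intro mult_left_mono Q) auto
      also have "\<dots> = K * norm (indicator (cbox (-e) e) x *\<^sub>R f x)" by simp
      finally show "norm (f x * ?Q i x) \<le> K * norm (indicator (cbox (-e) e) x *\<^sub>R f x)"
        by (simp only: norm_mult)
    qed
    have lim: "(\<lambda>i. ?Q i x) \<longlonglongrightarrow> - frechet_derivative \<phi> (at x) b" for x
    proof -
      have "((\<lambda>h. (\<phi> (x - h *\<^sub>R b) - \<phi> x) / complex_of_real h) \<longlongrightarrow> - frechet_derivative \<phi> (at x) b) (at 0)"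
        using incr(1)[of x 0] by (simp add: has_vector_derivative_quotient)
      then show ?thesis using X unfolding tendsto_at_iff_sequentially by (auto simp: o_def)
    qed
    show "AE x in lborel. (\<lambda>i. f x * ?Q i x) \<longlonglongrightarrow> f x * (- frechet_derivative \<phi> (at x) b)"
      by (rule AE_I2) (rule tendsto_mult[OF tendsto_const lim])
    have [measurable]: "(\<lambda>x. frechet_derivative \<phi> (at x) b) \<in> borel_measurable borel"
      by (intro borel_measurable_continuous_onI test_function_deriv_continuous \<phi> b)
    show "(\<lambda>x. f x * (- frechet_derivative \<phi> (at x) b)) \<in> borel_measurable lborel" by measurable
    show "(\<lambda>x. f x * ?Q i x) \<in> borel_measurable lborel" for i by measurable
  qed
  also have "(LINT x|lborel. f x * (- frechet_derivative \<phi> (at x) b)) = (LINT x|lborel. g x * \<phi> x)"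
    using fg \<phi> by (simp add: has_weak_deriv_def)
  finally show "((\<lambda>h. ((LINT x|lborel. f x * \<phi> (x - (0 + h) *\<^sub>R b)) -
      (LINT x|lborel. f x * \<phi> (x - 0 *\<^sub>R b))) / complex_of_real h) \<circ> X)
      \<longlonglongrightarrow> (LINT x|lborel. g x * \<phi> x)"
    unfolding o_def quot .
qed

lemma weak_deriv_test_translation_derivative:
  fixes f g \<phi> :: "'a::euclidean_space \<Rightarrow> complex"
  assumes "has_weak_deriv b f g" and \<phi>: "test_function \<phi>" and "b \<in> Basis"
  shows "((\<lambda>s. LINT x|lborel. f x * \<phi> (x - s *\<^sub>R b)) has_vector_derivative
          (LINT x|lborel. g x * \<phi> (x - s *\<^sub>R b))) (at s)"
  using weak_deriv_test_translation_derivative_0[OF assms(1) test_function_translate[OF \<phi>, of "s *\<^sub>R b"] assms(3)]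
  by (simp add: has_vector_derivative_quotient diff_diff_eq scaleR_add_left add.commute)

text \<open>For test functions this is the mean value inequality, with the derivative bounded by Cauchy-Schwarz; it
  passes to \<open>L\<^sup>2\<close> by density because both sides are continuous in \<open>h\<close> for fixed \<open>s\<close>.\<close>

lemma weak_deriv_translation_bound:
  fixes f g h :: "'a::euclidean_space \<Rightarrow> complex"
  assumes fg: "has_weak_deriv b f g" "f \<in> L2" "g \<in> L2" and h: "h \<in> L2" and b: "b \<in> Basis"
  shows "cmod ((LINT x|lborel. f x * h (x - s *\<^sub>R b)) - (LINT x|lborel. f x * h x))
    \<le> L2_norm g * L2_norm h * \<bar>s\<bar>"
proof -
  define A where "A h = (LINT x|lborel. f x * h (x - s *\<^sub>R b)) - (LINT x|lborel. f x * h x)" for h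
  have test: "cmod (A \<phi>) \<le> L2_norm g * L2_norm \<phi> * \<bar>s\<bar>" if \<phi>: "test_function \<phi>" "\<phi> \<in> L2" for \<phi>
  proof -
    have "norm ((LINT x|lborel. f x * \<phi> (x - s *\<^sub>R b)) - (LINT x|lborel. f x * \<phi> (x - 0 *\<^sub>R b)))
      \<le> L2_norm g * L2_norm \<phi> * \<bar>s - 0\<bar>"
    proof (rule vector_derivative_bound[OF weak_deriv_test_translation_derivative[OF fg(1) \<phi>(1) b]])
      show "cmod (LINT x|lborel. g x * \<phi> (x - r *\<^sub>R b)) \<le> L2_norm g * L2_norm \<phi>" for r
        using L2_bilinear_bound[OF fg(3) L2_translate(1)[OF \<phi>(2), of "r *\<^sub>R b"]]
        by (simp add: L2_translate(2)[OF \<phi>(2)])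
    qed
    then show ?thesis by (simp add: A_def)
  qed
  have A_bound: "cmod (A k) \<le> 2 * L2_norm f * L2_norm k" if "k \<in> L2" for k
    unfolding A_def
    using norm_triangle_ineq4[of "LINT x|lborel. f x * k (x - s *\<^sub>R b)" "LINT x|lborel. f x * k x"]
      L2_bilinear_bound[OF fg(2) L2_translate(1)[OF that, of "s *\<^sub>R b"]] L2_bilinear_bound[OF fg(2) that]
    by (simp add: L2_translate(2)[OF that])
  have A_diff: "A (\<lambda>x. k x - l x) = A k - A l" if "k \<in> L2" "l \<in> L2" for k l
    using L2_integrable_mult[OF fg(2) that(1)] L2_integrable_mult[OF fg(2) that(2)]
      L2_integrable_mult[OF fg(2) L2_translate(1)[OF that(1)]] L2_integrable_mult[OF fg(2) L2_translate(1)[OF that(2)]]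
    by (simp add: A_def right_diff_distrib)
  have "cmod (A h) \<le> 2 * L2_norm f * e + L2_norm g * (L2_norm h + e) * \<bar>s\<bar>" if "e > 0" for e
  proof -
    obtain \<phi> where \<phi>: "test_function \<phi>" "\<phi> \<in> L2" "L2_norm (\<lambda>x. h x - \<phi> x) < e"
      using test_function_dense[OF h \<open>e > 0\<close>] by blast
    have "L2_norm (\<lambda>x. \<phi> x - h x + h x) \<le> L2_norm (\<lambda>x. \<phi> x - h x) + L2_norm h"
      using h \<phi>(2) by (intro L2_norm_triangle L2_diff)
    then have n: "L2_norm \<phi> \<le> L2_norm h + e"
      using \<phi>(3) by (simp add: L2_norm_minus_commute[of \<phi> h])
    have "cmod (A h) \<le> cmod (A h - A \<phi>) + cmod (A \<phi>)"
      using norm_triangle_ineq[of "A h - A \<phi>" "A \<phi>"] by simp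
    also have "A h - A \<phi> = A (\<lambda>x. h x - \<phi> x)" using h \<phi> by (simp add: A_diff)
    also have "cmod (A (\<lambda>x. h x - \<phi> x)) \<le> 2 * L2_norm f * e"
      by (rule order_trans[OF A_bound[OF L2_diff[OF h \<phi>(2)]]]) (intro mult_left_mono, use \<phi> in auto)
    also have "cmod (A \<phi>) \<le> L2_norm g * (L2_norm h + e) * \<bar>s\<bar>"
      using test[OF \<phi>(1,2)] by (rule order_trans) (intro mult_right_mono mult_left_mono n, auto)
    finally show ?thesis by simp
  qed
  then have "eventually (\<lambda>e. cmod (A h) \<le> 2 * L2_norm f * e + L2_norm g * (L2_norm h + e) * \<bar>s\<bar>) (at_right 0)"
    by (auto simp: eventually_at_filter)
  moreover have "((\<lambda>e. 2 * L2_norm f * e + L2_norm g * (L2_norm h + e) * \<bar>s\<bar>) \<longlongrightarrow>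
      2 * L2_norm f * 0 + L2_norm g * (L2_norm h + 0) * \<bar>s\<bar>) (at_right 0)"
    by (intro tendsto_intros)
  ultimately have "cmod (A h) \<le> 2 * L2_norm f * 0 + L2_norm g * (L2_norm h + 0) * \<bar>s\<bar>"
    by (intro tendsto_lowerbound) auto
  then show ?thesis by (simp add: A_def)
qed

text \<open>The quotients, as functionals of \<open>h\<close>, are bounded by \<open>L2_norm g\<close> uniformly in \<open>s\<close>, and they converge on
  the dense set of test functions; hence they converge on \<open>L\<^sup>2\<close>.\<close>

lemma weak_deriv_translation_derivative:
  fixes f g h :: "'a::euclidean_space \<Rightarrow> complex"
  assumes fg: "has_weak_deriv b f g" "f \<in> L2" "g \<in> L2" and h: "h \<in> L2" and b: "b \<in> Basis"
  shows "((\<lambda>s. ((LINT x|lborel. f x * h (x - s *\<^sub>R b)) - (LINT x|lborel. f x * h x)) / complex_of_real s)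
     \<longlongrightarrow> (LINT x|lborel. g x * h x)) (at 0)"
proof -
  define Q where "Q h s = ((LINT x|lborel. f x * h (x - s *\<^sub>R b)) - (LINT x|lborel. f x * h x)) / complex_of_real s" for h s
  have Q_bound: "cmod (Q k s) \<le> L2_norm g * L2_norm k" if "k \<in> L2" for k s
  proof (cases "s = 0")
    case False
    then show ?thesis
      using weak_deriv_translation_bound[OF fg that b, of s]
      by (simp add: Q_def norm_divide pos_divide_le_eq)
  qed (simp add: Q_def)
  have Q_diff: "Q (\<lambda>x. k x - l x) s = Q k s - Q l s" if "k \<in> L2" "l \<in> L2" for k l s
    using L2_integrable_mult[OF fg(2) that(1)] L2_integrable_mult[OF fg(2) that(2)]
      L2_integrable_mult[OF fg(2) L2_translate(1)[OF that(1)]] L2_integrable_mult[OF fg(2) L2_translate(1)[OF that(2)]]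
    by (simp add: Q_def right_diff_distrib diff_divide_distrib)
  have "(Q h \<longlongrightarrow> (LINT x|lborel. g x * h x)) (at 0)"
  proof (rule tendstoI)
    fix e :: real assume "e > 0"
    define d where "d = e / (2 * (L2_norm g + 1))"
    have "d > 0" using \<open>e > 0\<close> by (simp add: d_def add_nonneg_pos)
    obtain \<phi> where \<phi>: "test_function \<phi>" "\<phi> \<in> L2" "L2_norm (\<lambda>x. h x - \<phi> x) < d / 2"
      using test_function_dense[OF h, of "d / 2"] \<open>d > 0\<close> by auto
    have hd: "(\<lambda>x. h x - \<phi> x) \<in> L2" using h \<phi>(2) by (rule L2_diff)
    have small: "L2_norm g * L2_norm (\<lambda>x. h x - \<phi> x) < e / 4"
    proof -
      have "L2_norm g * L2_norm (\<lambda>x. h x - \<phi> x) \<le> L2_norm g * (d / 2)"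
        using \<phi>(3) by (intro mult_left_mono) auto
      also have "\<dots> < (L2_norm g + 1) * (d / 2)" using \<open>d > 0\<close> by (intro mult_strict_right_mono) auto
      also have "\<dots> = e / 4"
      proof -
        have "L2_norm g + 1 \<noteq> 0" using L2_norm_nonneg[of g] by linarith
        then show ?thesis unfolding d_def by (simp add: divide_simps)
      qed
      finally show ?thesis .
    qed
    have "(Q \<phi> \<longlongrightarrow> (LINT x|lborel. g x * \<phi> x)) (at 0)"
      using weak_deriv_test_translation_derivative_0[OF fg(1) \<phi>(1) b]
      by (simp add: has_vector_derivative_quotient Q_def[abs_def])
    then have "eventually (\<lambda>s. dist (Q \<phi> s) (LINT x|lborel. g x * \<phi> x) < e / 4) (at 0)"
      using \<open>e > 0\<close> by (intro tendstoD) auto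
    then show "eventually (\<lambda>s. dist (Q h s) (LINT x|lborel. g x * h x) < e) (at 0)"
    proof eventually_elim
      case (elim s)
      have "Q h s - (LINT x|lborel. g x * h x) =
          Q (\<lambda>x. h x - \<phi> x) s + (Q \<phi> s - (LINT x|lborel. g x * \<phi> x)) - (LINT x|lborel. g x * (h x - \<phi> x))"
        using L2_integrable_mult[OF fg(3) h] L2_integrable_mult[OF fg(3) \<phi>(2)] h \<phi>(2)
        by (simp add: Q_diff right_diff_distrib)
      moreover have "cmod (y + z - w) \<le> cmod y + cmod z + cmod w" for y z w
        using norm_triangle_ineq4[of "y + z" w] norm_triangle_ineq[of y z] by linarith
      ultimately have "cmod (Q h s - (LINT x|lborel. g x * h x)) \<le>
          cmod (Q (\<lambda>x. h x - \<phi> x) s) + cmod (Q \<phi> s - (LINT x|lborel. g x * \<phi> x)) +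
          cmod (LINT x|lborel. g x * (h x - \<phi> x))"
        by (simp only:)
      also have "\<dots> < e / 4 + e / 4 + e / 4"
        using Q_bound[OF hd, of s] small elim L2_bilinear_bound[OF fg(3) hd] by (simp add: dist_norm)
      finally show ?case using \<open>e > 0\<close> by (simp add: dist_norm)
    qed
  qed
  then show ?thesis by (simp add: Q_def[abs_def])
qed

text \<open>Pairing the translate of \<open>h\<close> by \<open>s\<close> with \<open>f\<close> amounts to pairing the translate of \<open>f\<close> by \<open>- s\<close> with
  \<open>h\<close>. The two sides of the identity are therefore limits of the same difference quotient, once with the
  derivative on \<open>f\<close> and once, with the opposite sign, on \<open>h\<close>.\<close>

lemma weak_deriv_integration_by_parts:
  fixes f g h k :: "'a::euclidean_space \<Rightarrow> complex"
  assumes fg: "has_weak_deriv b f g" "f \<in> L2" "g \<in> L2"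
    and hk: "has_weak_deriv b h k" "h \<in> L2" "k \<in> L2" and b: "b \<in> Basis"
  shows "l2_inner g h = - l2_inner f k"
proof -
  note [measurable] = L2D(1)[OF fg(2)] L2D(1)[OF hk(2)]
  define Q where "Q s = ((LINT x|lborel. f x * cnj (h (x - s *\<^sub>R b))) - (LINT x|lborel. f x * cnj (h x))) / complex_of_real s" for s
  have 1: "(Q \<longlongrightarrow> l2_inner g h) (at 0)"
    using weak_deriv_translation_derivative[OF fg L2_cnj[OF hk(2)] b]
    by (simp add: Q_def[abs_def] l2_inner_def)
  define P where "P s = ((LINT x|lborel. h x * cnj (f (x - s *\<^sub>R b))) - (LINT x|lborel. h x * cnj (f x))) / complex_of_real s" for s
  have "(P \<longlongrightarrow> l2_inner k f) (at 0)"
    using weak_deriv_translation_derivative[OF hk L2_cnj[OF fg(2)] b]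
    by (simp add: P_def[abs_def] l2_inner_def)
  moreover have "filterlim uminus (at 0) (at (0::real))"
    by (simp add: filterlim_at eventually_at_filter tendsto_minus_cancel_left[symmetric] tendsto_ident_at)
  ultimately have "((\<lambda>s. P (- s)) \<longlongrightarrow> l2_inner k f) (at 0)"
    by (rule filterlim_compose)
  then have "((\<lambda>s. - cnj (P (- s))) \<longlongrightarrow> - cnj (l2_inner k f)) (at 0)"
    by (intro tendsto_intros)
  moreover have "- cnj (P (- s)) = Q s" for s
  proof -
    have "(LINT x|lborel. f x * cnj (h (x - s *\<^sub>R b))) = (LINT x|lborel. f (x + s *\<^sub>R b) * cnj (h x))"
      using integral_translate(1)[of "\<lambda>x. f x * cnj (h (x - s *\<^sub>R b))" "s *\<^sub>R b"] by simp
    also have "\<dots> = cnj (LINT x|lborel. h x * cnj (f (x - (- s) *\<^sub>R b)))"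
      unfolding Bochner_Integration.integral_cnj[symmetric] by (simp add: mult.commute)
    finally have a: "(LINT x|lborel. f x * cnj (h (x - s *\<^sub>R b))) = cnj (LINT x|lborel. h x * cnj (f (x - (- s) *\<^sub>R b)))" .
    have c: "(LINT x|lborel. f x * cnj (h x)) = cnj (LINT x|lborel. h x * cnj (f x))"
      unfolding Bochner_Integration.integral_cnj[symmetric] by (simp add: mult.commute)
    show ?thesis unfolding Q_def P_def a c by simp
  qed
  ultimately have "(Q \<longlongrightarrow> - cnj (l2_inner k f)) (at 0)" by simp
  from tendsto_unique[OF _ 1 this] show ?thesis by (simp add: l2_inner_cnj)
qed

section \<open>A differential inequality without global solutions\<close>

lemma nondecreasing_of_deriv_nonneg:
  fixes f :: "real \<Rightarrow> real"
  assumes "a \<le> b" "continuous_on {a..b} f"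
    and "\<And>t. a < t \<Longrightarrow> t < b \<Longrightarrow> \<exists>y. (f has_real_derivative y) (at t) \<and> 0 \<le> y"
  shows "f a \<le> f b"
  using assms
  by (cases "a = b") (auto intro!: DERIV_nonneg_imp_increasing_open[of a b f])

text \<open>The ordinary differential inequality behind the blow-up, with \<open>c = cos \<theta>\<close>, \<open>g = - \<gamma>\<close> and \<open>p = \<alpha> + 2\<close>.\<close>

lemma virial_blowup:
  fixes M E J K :: "real \<Rightarrow> real" and c g p \<xi> :: real
  assumes c: "c > 0" and g: "g > 0" and p: "p > 2" and xi: "c * p * \<xi> \<ge> g"
    and M_cont: "continuous_on {0..} M" and E_cont: "continuous_on {0..} E"
    and M_deriv: "\<And>t. t > 0 \<Longrightarrow> (M has_real_derivative 2 * (c * J t - g * M t)) (at t)"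
    and E_deriv: "\<And>t. t > 0 \<Longrightarrow> (E has_real_derivative (- c * K t + g * J t)) (at t)"
    and CS: "\<And>t. t > 0 \<Longrightarrow> (J t)\<^sup>2 \<le> K t * M t"
    and J_E: "\<And>t. t > 0 \<Longrightarrow> J t \<ge> - p * E t"
    and M_nonneg: "\<And>t. M t \<ge> 0"
    and init: "E 0 + \<xi> * M 0 < 0"
  shows False
proof -
  define \<eta> where "\<eta> t = - E t - \<xi> * M t" for t
  define \<eta>' where "\<eta>' t = c * K t - g * J t - \<xi> * (2 * (c * J t - g * M t))" for t
  have "\<xi> > 0"
  proof (rule ccontr)
    assume "\<not> \<xi> > 0"
    then have "c * p * \<xi> \<le> 0" using c p by (intro mult_nonneg_nonpos) auto
    with g xi show False by simp
  qed
  have \<eta>_deriv: "(\<eta> has_real_derivative \<eta>' t) (at t)" if "t > 0" for t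
    unfolding \<eta>_def \<eta>'_def
    by (rule derivative_eq_intros E_deriv M_deriv refl that | simp)+
  have \<eta>_cont: "continuous_on {0..} \<eta>"
    unfolding \<eta>_def by (intro continuous_intros E_cont M_cont)
  have key: "M t > 0 \<and> c * J t - g * M t \<ge> c * p * \<eta> t \<and>
      M t * \<eta>' t \<ge> p * \<eta> t * (c * J t - g * M t)" if "t > 0" "\<eta> t > 0" for t
  proof -
    have J: "J t \<ge> p * (\<eta> t + \<xi> * M t)"
      using J_E[OF \<open>t > 0\<close>] by (simp add: \<eta>_def algebra_simps)
    have "p * (\<eta> t + \<xi> * M t) > 0"
      using p that \<open>\<xi> > 0\<close> M_nonneg[of t] by (intro mult_pos_pos add_pos_nonneg mult_nonneg_nonneg) auto
    with J have "J t > 0" by simp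
    then have "0 < K t * M t" using CS[OF \<open>t > 0\<close>] by (smt (verit) zero_less_power)
    then have M: "M t > 0" using M_nonneg[of t] by (auto simp: zero_less_mult_iff)
    have "c * J t \<ge> c * (p * (\<eta> t + \<xi> * M t))" using J c by simp
    moreover have "(c * p * \<xi>) * M t \<ge> g * M t" using xi M by (intro mult_right_mono) auto
    ultimately have a: "c * J t - g * M t \<ge> c * p * \<eta> t" by (simp add: algebra_simps)
    have "p * (\<xi> * M t) \<ge> 2 * (\<xi> * M t)" using p M \<open>\<xi> > 0\<close> by (intro mult_right_mono) auto
    with J have b: "J t - 2 * \<xi> * M t \<ge> p * \<eta> t" by (simp add: algebra_simps)
    have "c * p * \<eta> t > 0" using c p that by simp
    with a have pos: "c * J t - g * M t \<ge> 0" by simp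
    have "M t * \<eta>' t = c * (K t * M t) - g * J t * M t - \<xi> * 2 * (c * J t - g * M t) * M t"
      by (simp add: \<eta>'_def algebra_simps)
    also have "\<dots> \<ge> c * (J t)\<^sup>2 - g * J t * M t - \<xi> * 2 * (c * J t - g * M t) * M t"
      using CS[OF \<open>t > 0\<close>] c by simp
    also (xtrans) have "c * (J t)\<^sup>2 - g * J t * M t - \<xi> * 2 * (c * J t - g * M t) * M t
        = (J t - 2 * \<xi> * M t) * (c * J t - g * M t)"
      by (simp add: power2_eq_square algebra_simps)
    also (xtrans) have "\<dots> \<ge> p * \<eta> t * (c * J t - g * M t)"
      using b pos by (rule mult_right_mono)
    finally show ?thesis using M a by simp
  qed
  have \<eta>'_nonneg: "\<eta>' t \<ge> 0" if "t > 0" "\<eta> t > 0" for t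
  proof -
    have "c * p * \<eta> t > 0" "p * \<eta> t > 0" using c p that by simp_all
    with key[OF that] have "c * J t - g * M t \<ge> 0" by simp
    with \<open>p * \<eta> t > 0\<close> have "p * \<eta> t * (c * J t - g * M t) \<ge> 0"
      by (intro mult_nonneg_nonneg[of "p * \<eta> t"]) auto
    with key[OF that] have "M t * \<eta>' t \<ge> 0" "M t > 0" by auto
    then show ?thesis by (simp add: zero_le_mult_iff)
  qed
  have "\<eta> 0 > 0" using init by (simp add: \<eta>_def)
  \<comment> \<open>At a first time \<open>s\<close> with \<open>\<eta> s \<le> 0\<close>, monotonicity on \<open>[0, s]\<close> would give \<open>\<eta> s \<ge> \<eta> 0 > 0\<close>.\<close>
  have \<eta>_pos: "\<eta> t > 0" if "t \<ge> 0" for t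
  proof (rule ccontr)
    assume "\<not> \<eta> t > 0"
    define S where "S = {0..t} \<inter> \<eta> -` {..0}"
    have "closed S" unfolding S_def
      by (intro continuous_closed_preimage continuous_on_subset[OF \<eta>_cont]) auto
    have "t \<in> S" using that \<open>\<not> \<eta> t > 0\<close> by (simp add: S_def)
    have bdd: "bdd_below S" unfolding S_def by (auto intro: bdd_below.I[of _ 0])
    define s where "s = Inf S"
    have "s \<in> S" unfolding s_def using \<open>t \<in> S\<close> bdd \<open>closed S\<close>
      by (intro closed_contains_Inf) auto
    then have s: "0 \<le> s" "\<eta> s \<le> 0" "s \<le> t" by (auto simp: S_def)
    have pos: "\<eta> r > 0" if "0 \<le> r" "r < s" for r
    proof (rule ccontr)
      assume "\<not> \<eta> r > 0"
      then have "r \<in> S" using that s by (simp add: S_def)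
      then have "s \<le> r" unfolding s_def using bdd by (rule cInf_lower)
      with that show False by simp
    qed
    have "\<eta> 0 \<le> \<eta> s"
    proof (rule nondecreasing_of_deriv_nonneg[of 0 s \<eta>])
      show "continuous_on {0..s} \<eta>" by (rule continuous_on_subset[OF \<eta>_cont]) auto
      fix r assume "0 < r" "r < s"
      then show "\<exists>y. (\<eta> has_real_derivative y) (at r) \<and> 0 \<le> y"
        using \<eta>_deriv[of r] \<eta>'_nonneg[of r] pos[of r] by auto
    qed (rule s)
    with s \<open>\<eta> 0 > 0\<close> show False by simp
  qed
  define q where "q = p / 2 - 1"
  have "q > 0" using p by (simp add: q_def)
  \<comment> \<open>Positivity of \<open>M\<close> comes from inequalities that hold at positive times, so the comparison of
    \<open>\<eta>\<close> with a power of \<open>M\<close> starts at time \<open>1\<close> instead of \<open>0\<close>.\<close>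
  have M_pos: "M t > 0" if "t \<ge> 1" for t using key \<eta>_pos that by simp
  have nz: "\<forall>r\<in>{1..t}. \<eta> r \<noteq> 0" "\<forall>r\<in>{1..t}. M r \<noteq> 0" for t
    using \<eta>_pos M_pos by (smt (verit) atLeastAtMost_iff)+
  define \<delta> where "\<delta> = exp (ln (\<eta> 1) - p / 2 * ln (M 1))"
  have "\<delta> > 0" by (simp add: \<delta>_def)
  have lower: "\<eta> t \<ge> \<delta> * M t powr (p / 2)" if "t \<ge> 1" for t
  proof -
    have "ln (\<eta> 1) - p / 2 * ln (M 1) \<le> ln (\<eta> t) - p / 2 * ln (M t)"
    proof (rule nondecreasing_of_deriv_nonneg[OF that, where f = "\<lambda>t. ln (\<eta> t) - p / 2 * ln (M t)"])
      show "continuous_on {1..t} (\<lambda>t. ln (\<eta> t) - p / 2 * ln (M t))"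
        by (intro continuous_intros continuous_on_subset[OF \<eta>_cont] continuous_on_subset[OF M_cont])
          (use nz in auto)
      fix r assume "1 < r" "r < t"
      then have r: "r > 0" "\<eta> r > 0" "M r > 0" using \<eta>_pos M_pos by simp_all
      let ?d = "\<eta>' r / \<eta> r - p / 2 * (2 * (c * J r - g * M r) / M r)"
      have "((\<lambda>t. ln (\<eta> t) - p / 2 * ln (M t)) has_real_derivative ?d) (at r)"
        by ((rule derivative_eq_intros \<eta>_deriv M_deriv refl r | simp)+, simp add: mult_ac)
      moreover have "?d = (M r * \<eta>' r - p * \<eta> r * (c * J r - g * M r)) / (\<eta> r * M r)"
        using r by (simp add: field_simps)
      moreover have "\<dots> \<ge> 0" using key[of r] r by (intro divide_nonneg_nonneg) auto
      ultimately show "\<exists>y. ((\<lambda>t. ln (\<eta> t) - p / 2 * ln (M t)) has_real_derivative y) (at r) \<and> 0 \<le> y"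
        by metis
    qed
    then have "\<delta> \<le> exp (ln (\<eta> t) - p / 2 * ln (M t))" by (simp add: \<delta>_def)
    also have "\<dots> = \<eta> t / M t powr (p / 2)"
      using \<eta>_pos[of t] M_pos[OF that] that by (simp add: exp_diff powr_def)
    finally show ?thesis using M_pos[OF that] by (simp add: pos_le_divide_eq)
  qed
  \<comment> \<open>\<open>M' \<ge> 2 c p \<delta> M\<^bsup>q+1\<^esup>\<close> says that \<open>M\<^bsup>-q\<^esup>\<close> decreases at least at the rate \<open>R\<close>, so it would become
    negative.\<close>
  define R where "R = 2 * q * c * p * \<delta>"
  have "R > 0" using \<open>q > 0\<close> c p \<open>\<delta> > 0\<close> by (simp add: R_def)
  have decay: "M t powr (- q) \<le> M 1 powr (- q) - R * (t - 1)" if "t \<ge> 1" for t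
  proof -
    have "- (M 1 powr (- q)) - R * 1 \<le> - (M t powr (- q)) - R * t"
    proof (rule nondecreasing_of_deriv_nonneg[OF that, where f = "\<lambda>t. - (M t powr (- q)) - R * t"])
      show "continuous_on {1..t} (\<lambda>t. - (M t powr (- q)) - R * t)"
        by (intro continuous_intros continuous_on_subset[OF M_cont])
          (use nz in auto)
      fix r assume "1 < r" "r < t"
      then have r: "r > 0" "\<eta> r > 0" "M r > 0" using \<eta>_pos M_pos by simp_all
      let ?d = "q * M r powr (- q - 1) * (2 * (c * J r - g * M r)) - R"
      have "((\<lambda>t. - (M t powr (- q)) - R * t) has_real_derivative ?d) (at r)"
        by (rule derivative_eq_intros M_deriv refl r | simp add: r)+
      moreover have "?d \<ge> 0"
      proof -
        have "c * J r - g * M r \<ge> c * p * (\<delta> * M r powr (p / 2))"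
        proof -
          have "c * p * \<eta> r \<ge> c * p * (\<delta> * M r powr (p / 2))"
            using lower[of r] \<open>1 < r\<close> c p by (intro mult_left_mono) auto
          with key[OF r(1,2)] show ?thesis by simp
        qed
        then have "q * M r powr (- q - 1) * (2 * (c * J r - g * M r)) \<ge>
            q * M r powr (- q - 1) * (2 * (c * p * (\<delta> * M r powr (p / 2))))"
          using \<open>q > 0\<close> by (intro mult_left_mono) auto
        also have "q * M r powr (- q - 1) * (2 * (c * p * (\<delta> * M r powr (p / 2)))) =
            R * (M r powr (- q - 1) * M r powr (p / 2))" by (simp add: R_def)
        also have "M r powr (- q - 1) * M r powr (p / 2) = 1"
          using r(3) by (simp add: q_def flip: powr_add)
        finally show ?thesis by simp
      qed
      ultimately show "\<exists>y. ((\<lambda>t. - (M t powr (- q)) - R * t) has_real_derivative y) (at r) \<and> 0 \<le> y"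
        by blast
    qed
    then show ?thesis by (simp add: algebra_simps)
  qed
  define t where "t = 1 + M 1 powr (- q) / R"
  have "t \<ge> 1" using \<open>R > 0\<close> by (simp add: t_def)
  from decay[OF this] have "M t powr (- q) \<le> 0" using \<open>R > 0\<close> by (simp add: t_def)
  with M_pos[OF \<open>t \<ge> 1\<close>] show False by simp
qed

section \<open>The potential, the Dirichlet integral and the energy\<close>

lemma L2_norm_le:
  assumes "\<And>x. cmod (f x) \<le> K * cmod (g x)" "f \<in> borel_measurable borel" "g \<in> L2" "0 \<le> K"
  shows "f \<in> L2" "L2_norm f \<le> K * L2_norm g"
proof -
  have sq: "(cmod (f x))\<^sup>2 \<le> K\<^sup>2 * (cmod (g x))\<^sup>2" for x
    using power_mono[OF assms(1), of x 2] by (simp add: power_mult_distrib)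
  have int: "integrable lborel (\<lambda>x. K\<^sup>2 * (cmod (g x))\<^sup>2)" using L2D(2)[OF assms(3)] by simp
  show "f \<in> L2" by (rule L2_bound[OF assms(2) int]) (simp add: sq)
  then have "(L2_norm f)\<^sup>2 \<le> (LINT x|lborel. K\<^sup>2 * (cmod (g x))\<^sup>2)"
    unfolding L2_norm_square by (intro integral_mono L2D(2) int sq)
  also have "\<dots> = (K * L2_norm g)\<^sup>2" by (simp add: L2_norm_square power_mult_distrib)
  finally show "L2_norm f \<le> K * L2_norm g"
    by (rule power2_le_imp_le) (use assms(4) in simp)
qed

lemma L2_norm_diff_abs:
  assumes "f \<in> L2" "g \<in> L2"
  shows "\<bar>L2_norm f - L2_norm g\<bar> \<le> L2_norm (\<lambda>x. f x - g x)"
  using L2_norm_triangle_diff[OF assms L2_zero] L2_norm_triangle_diff[OF assms(2,1) L2_zero]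
    L2_norm_minus_commute[of f g] by simp

lemma L2_norm_sum:
  "finite I \<Longrightarrow> (\<And>i. i \<in> I \<Longrightarrow> f i \<in> L2) \<Longrightarrow> L2_norm (\<lambda>x. \<Sum>i\<in>I. f i x) \<le> (\<Sum>i\<in>I. L2_norm (f i))"
proof (induction I rule: finite_induct)
  case empty
  then show ?case by (simp add: L2_norm_def)
next
  case (insert i I)
  have "L2_norm (\<lambda>x. f i x + (\<Sum>i\<in>I. f i x)) \<le> L2_norm (f i) + L2_norm (\<lambda>x. \<Sum>i\<in>I. f i x)"
    using insert by (intro L2_norm_triangle L2_sum) auto
  with insert show ?case by simp
qed

lemma C0_bounded:
  assumes "f \<in> C0"
  shows "bdd_above (range (\<lambda>x. cmod (f x)))"
proof -
  have cont: "continuous_on UNIV f" and lim: "(f \<longlongrightarrow> 0) at_infinity" using assms by (auto simp: C0_def)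
  obtain R where R: "\<And>x. R \<le> norm x \<Longrightarrow> cmod (f x) < 1"
    using tendstoD[OF lim, of 1] by (auto simp: eventually_at_infinity)
  have "compact (f ` cball 0 R)"
    using cont by (intro compact_continuous_image) (auto intro: continuous_on_subset)
  then obtain K where K: "\<And>x. x \<in> cball 0 R \<Longrightarrow> cmod (f x) \<le> K"
    using compact_imp_bounded bounded_iff by (metis imageI)
  have "cmod (f x) \<le> max 1 K" for x
    using R[of x] K[of x] by (cases "R \<le> norm x") auto
  then show ?thesis by (auto intro!: bdd_aboveI[of _ "max 1 K"])
qed

lemma C0_le_sup_norm: "f \<in> C0 \<Longrightarrow> cmod (f x) \<le> sup_norm f"
  unfolding sup_norm_def by (rule cSUP_upper) (auto intro: C0_bounded)

lemma C0_diff: "f \<in> C0 \<Longrightarrow> g \<in> C0 \<Longrightarrow> (\<lambda>x. f x - g x) \<in> C0"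
  by (auto simp: C0_def intro!: continuous_intros tendsto_eq_intros)

text \<open>Young's inequality for \<open>x\<close> and \<open>y\<^bsup>p-1\<^esup>\<close>, rearranged; it says that \<open>s\<^sup>p\<close> lies above its tangent at \<open>y\<close>.\<close>

lemma powr_tangent_below:
  fixes x y p :: real
  assumes "0 \<le> x" "0 \<le> y" "p > 1"
  shows "y powr p + p * y powr (p - 1) * (x - y) \<le> x powr p"
proof (cases "y = 0")
  case False
  then have "y > 0" using assms by simp
  define q where "q = p / (p - 1)"
  have q: "q > 1" "1 / p + 1 / q = 1" using assms by (auto simp: q_def field_simps)
  have "x * y powr (p - 1) \<le> x powr p / p + (y powr (p - 1)) powr q / q"
    using assms q by (intro Youngs_inequality) auto
  also have "(y powr (p - 1)) powr q = y powr p" using assms by (simp add: powr_powr q_def)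
  also have "y powr p / q = y powr p * (1 - 1 / p)" using q(2) by (metis add_diff_cancel_left' divide_inverse inverse_eq_divide)
  finally have "p * (x * y powr (p - 1)) \<le> p * (x powr p / p + y powr p * (1 - 1 / p))"
    using assms by (intro mult_left_mono) auto
  also have "\<dots> = x powr p + (p - 1) * y powr p" using assms by (simp add: field_simps)
  finally have "p * (x * y powr (p - 1)) \<le> x powr p + (p - 1) * y powr p" .
  moreover have "y powr (p - 1) * y = y powr p"
    using \<open>y > 0\<close> powr_add[of y "p - 1" 1] by simp
  ultimately show ?thesis by (simp add: algebra_simps)
qed (use assms in auto)

definition power_nonlinearity :: "real \<Rightarrow> ('a \<Rightarrow> complex) \<Rightarrow> 'a \<Rightarrow> complex" where
  "power_nonlinearity \<alpha> f x = complex_of_real (cmod (f x) powr \<alpha>) * f x"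

text \<open>If \<open>|b| \<le> |a|\<close>, write the difference as \<open>|a|\<^sup>\<alpha> (a - b) + (|a|\<^sup>\<alpha> - |b|\<^sup>\<alpha>) b\<close>. The second summand is not
  controlled by a Lipschitz bound for \<open>s\<^sup>\<alpha>\<close>, which fails at \<open>0\<close> when \<open>\<alpha> < 1\<close>; but the tangent of
  \<open>s\<^bsup>\<alpha>+1\<^esup>\<close> at \<open>|a|\<close> bounds it by \<open>\<alpha> |a|\<^sup>\<alpha> (|a| - |b|)\<close>.\<close>

lemma powr_times_lipschitz:
  fixes a b :: complex
  assumes "\<alpha> > 0" "cmod a \<le> K" "cmod b \<le> K"
  shows "cmod (of_real (cmod a powr \<alpha>) * a - of_real (cmod b powr \<alpha>) * b) \<le> (\<alpha> + 1) * K powr \<alpha> * cmod (a - b)"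
proof -
  have *: "cmod (of_real (cmod a powr \<alpha>) * a - of_real (cmod b powr \<alpha>) * b) \<le> (\<alpha> + 1) * K powr \<alpha> * cmod (a - b)"
    if "cmod b \<le> cmod a" "cmod a \<le> K" for a b :: complex
  proof -
    let ?A = "cmod a" and ?B = "cmod b"
    have mono: "?B powr \<alpha> \<le> ?A powr \<alpha>" using that assms by (intro powr_mono2) auto
    have A: "?A powr (\<alpha> + 1) = ?A powr \<alpha> * ?A" by (cases "?A = 0") (auto simp: powr_add)
    have B: "?B powr (\<alpha> + 1) = ?B powr \<alpha> * ?B" by (cases "?B = 0") (auto simp: powr_add)
    have "?A powr (\<alpha> + 1) + (\<alpha> + 1) * ?A powr \<alpha> * (?B - ?A) \<le> ?B powr (\<alpha> + 1)"
      using powr_tangent_below[of ?B ?A "\<alpha> + 1"] assms(1) by simp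
    then have "(?A powr \<alpha> - ?B powr \<alpha>) * ?B \<le> \<alpha> * ?A powr \<alpha> * (?A - ?B)"
      unfolding A B by (simp add: algebra_simps)
    also have "\<dots> \<le> \<alpha> * ?A powr \<alpha> * cmod (a - b)"
      using assms norm_triangle_ineq2[of a b] by (intro mult_left_mono) auto
    finally have 1: "(?A powr \<alpha> - ?B powr \<alpha>) * ?B \<le> \<alpha> * ?A powr \<alpha> * cmod (a - b)" .
    have "of_real (?A powr \<alpha>) * a - of_real (?B powr \<alpha>) * b =
        of_real (?A powr \<alpha>) * (a - b) + of_real (?A powr \<alpha> - ?B powr \<alpha>) * b"
      by (simp add: algebra_simps)
    then have "cmod (of_real (?A powr \<alpha>) * a - of_real (?B powr \<alpha>) * b) \<le>
        cmod (of_real (?A powr \<alpha>) * (a - b)) + cmod (of_real (?A powr \<alpha> - ?B powr \<alpha>) * b)"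
      by (simp only: norm_triangle_ineq)
    also have "\<dots> = ?A powr \<alpha> * cmod (a - b) + (?A powr \<alpha> - ?B powr \<alpha>) * ?B"
      unfolding norm_mult norm_of_real using mono by simp
    also have "\<dots> \<le> (\<alpha> + 1) * ?A powr \<alpha> * cmod (a - b)" using 1 by (simp add: algebra_simps)
    also have "\<dots> \<le> (\<alpha> + 1) * K powr \<alpha> * cmod (a - b)"
      using that assms by (intro mult_right_mono mult_left_mono powr_mono2) auto
    finally show ?thesis .
  qed
  show ?thesis
  proof (cases "cmod b \<le> cmod a")
    case True
    then show ?thesis using * assms by blast
  next
    case False
    then show ?thesis using *[of a b] assms by (simp add: norm_minus_commute)
  qed
qed

lemma power_nonlinearity_L2:
  fixes f :: "'a::euclidean_space \<Rightarrow> complex"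
  assumes "\<alpha> > 0" "f \<in> L2" "\<And>x. cmod (f x) \<le> K"
  shows "power_nonlinearity \<alpha> f \<in> L2" "L2_norm (power_nonlinearity \<alpha> f) \<le> K powr \<alpha> * L2_norm f"
proof -
  have [measurable]: "f \<in> borel_measurable borel" by (rule L2D(1)[OF assms(2)])
  have m: "power_nonlinearity \<alpha> f \<in> borel_measurable borel"
    unfolding power_nonlinearity_def[abs_def] by measurable
  have b: "cmod (power_nonlinearity \<alpha> f x) \<le> K powr \<alpha> * cmod (f x)" for x
  proof -
    have "cmod (f x) powr \<alpha> \<le> K powr \<alpha>" using assms(1,3) by (intro powr_mono2) simp_all
    then show ?thesis by (simp add: power_nonlinearity_def norm_mult mult_right_mono)
  qed
  show "power_nonlinearity \<alpha> f \<in> L2" "L2_norm (power_nonlinearity \<alpha> f) \<le> K powr \<alpha> * L2_norm f"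
    using L2_norm_le[where f = "power_nonlinearity \<alpha> f" and g = f and K = "K powr \<alpha>"] b m assms(2)
    by simp_all
qed

lemma power_nonlinearity_lipschitz:
  fixes f g :: "'a::euclidean_space \<Rightarrow> complex"
  assumes "\<alpha> > 0" "f \<in> L2" "g \<in> L2" "\<And>x. cmod (f x) \<le> K" "\<And>x. cmod (g x) \<le> K"
  shows "L2_norm (\<lambda>x. power_nonlinearity \<alpha> f x - power_nonlinearity \<alpha> g x)
    \<le> (\<alpha> + 1) * K powr \<alpha> * L2_norm (\<lambda>x. f x - g x)"
proof (rule L2_norm_le)
  show "cmod (power_nonlinearity \<alpha> f x - power_nonlinearity \<alpha> g x) \<le> (\<alpha> + 1) * K powr \<alpha> * cmod (f x - g x)" for x
    unfolding power_nonlinearity_def using assms by (intro powr_times_lipschitz) auto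
  show "(\<lambda>x. power_nonlinearity \<alpha> f x - power_nonlinearity \<alpha> g x) \<in> borel_measurable borel"
    using assms by (intro L2D(1) L2_diff power_nonlinearity_L2(1)[where K = K]) auto
qed (use assms in \<open>auto intro: L2_diff\<close>)

definition potential :: "real \<Rightarrow> ('a::euclidean_space \<Rightarrow> complex) \<Rightarrow> real" where
  "potential \<alpha> f = (LINT x|lborel. cmod (f x) powr (\<alpha> + 2))"

lemma cmod_powr_add_2: "cmod z powr (\<alpha> + 2) = cmod z powr \<alpha> * (cmod z)\<^sup>2"
  by (cases "z = 0") (auto simp: powr_add)

lemma potential_integrable:
  fixes f :: "'a::euclidean_space \<Rightarrow> complex"
  assumes "\<alpha> > 0" "f \<in> L2" "\<And>x. cmod (f x) \<le> K"
  shows "integrable lborel (\<lambda>x. cmod (f x) powr (\<alpha> + 2))"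
    and "l2_inner f (power_nonlinearity \<alpha> f) = of_real (potential \<alpha> f)"
proof -
  have e: "f x * cnj (power_nonlinearity \<alpha> f x) = of_real (cmod (f x) powr (\<alpha> + 2))" for x
    unfolding power_nonlinearity_def cmod_powr_add_2
    by (simp add: complex_norm_square[symmetric] mult.left_commute flip: of_real_power)
  have "integrable lborel (\<lambda>x. f x * cnj (power_nonlinearity \<alpha> f x))"
    using assms by (intro l2_inner_integrable power_nonlinearity_L2(1)[where K = K])
  then have "integrable lborel (\<lambda>x. complex_of_real (cmod (f x) powr (\<alpha> + 2)))" unfolding e .
  from integrable_Re[OF this] show "integrable lborel (\<lambda>x. cmod (f x) powr (\<alpha> + 2))" by simp
  show "l2_inner f (power_nonlinearity \<alpha> f) = of_real (potential \<alpha> f)"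
    unfolding l2_inner_def e potential_def by (rule integral_complex_of_real)
qed

text \<open>Convexity of \<open>|z|\<^bsup>\<alpha>+2\<^esup>\<close> on the plane: the tangent in the radial variable, together with
  \<open>Re (a * cnj b) \<le> |a| |b|\<close>.\<close>

lemma powr_norm_tangent_below:
  fixes a b :: complex
  assumes "\<alpha> > 0"
  shows "(\<alpha> + 2) * Re ((a - b) * cnj (of_real (cmod b powr \<alpha>) * b)) \<le> cmod a powr (\<alpha> + 2) - cmod b powr (\<alpha> + 2)"
proof -
  let ?A = "cmod a" and ?B = "cmod b"
  have B1: "?B powr (\<alpha> + 1) = ?B powr \<alpha> * ?B" by (cases "?B = 0") (auto simp: powr_add)
  have "Re (a * cnj b) \<le> ?A * ?B"
    using complex_Re_le_cmod[of "a * cnj b"] by (simp add: norm_mult)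
  moreover have "Re (b * cnj b) = ?B * ?B"
    by (simp add: complex_norm_square[symmetric] power2_eq_square flip: of_real_power)
  ultimately have "Re ((a - b) * cnj b) \<le> ?B * (?A - ?B)" by (simp add: algebra_simps)
  then have "(\<alpha> + 2) * (?B powr \<alpha> * Re ((a - b) * cnj b)) \<le> (\<alpha> + 2) * (?B powr \<alpha> * (?B * (?A - ?B)))"
    using assms by (intro mult_left_mono) auto
  also have "\<dots> = (\<alpha> + 2) * ?B powr (\<alpha> + 2 - 1) * (?A - ?B)"
    using B1 by (simp add: add.commute[of 2] algebra_simps)
  also have "\<dots> \<le> ?A powr (\<alpha> + 2) - ?B powr (\<alpha> + 2)"
    using powr_tangent_below[of ?A ?B "\<alpha> + 2"] assms by simp
  finally have "(\<alpha> + 2) * (?B powr \<alpha> * Re ((a - b) * cnj b)) \<le> ?A powr (\<alpha> + 2) - ?B powr (\<alpha> + 2)" .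
  moreover have "Re ((a - b) * cnj (of_real (?B powr \<alpha>) * b)) = ?B powr \<alpha> * Re ((a - b) * cnj b)"
    by (simp add: algebra_simps)
  ultimately show ?thesis by (simp only:)
qed

text \<open>Convexity avoids any second-order expansion of the potential: together with the upper bound by the tangent at
  \<open>f\<close> it traps the increment between two \<open>L\<^sup>2\<close> pairings with \<open>f - g\<close>.\<close>

lemma potential_tangent_below:
  fixes f g :: "'a::euclidean_space \<Rightarrow> complex"
  assumes "\<alpha> > 0" "f \<in> L2" "g \<in> L2" "\<And>x. cmod (f x) \<le> K" "\<And>x. cmod (g x) \<le> K"
  shows "(\<alpha> + 2) * Re (l2_inner (\<lambda>x. f x - g x) (power_nonlinearity \<alpha> g)) \<le> potential \<alpha> f - potential \<alpha> g"
proof -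
  have i: "integrable lborel (\<lambda>x. (f x - g x) * cnj (power_nonlinearity \<alpha> g x))"
    using assms by (intro l2_inner_integrable L2_diff power_nonlinearity_L2(1)[where K = K])
  have pf: "integrable lborel (\<lambda>x. cmod (f x) powr (\<alpha> + 2))" and pg: "integrable lborel (\<lambda>x. cmod (g x) powr (\<alpha> + 2))"
    using potential_integrable(1)[OF assms(1)] assms by blast+
  have "(\<alpha> + 2) * Re (l2_inner (\<lambda>x. f x - g x) (power_nonlinearity \<alpha> g)) =
      (LINT x|lborel. (\<alpha> + 2) * Re ((f x - g x) * cnj (power_nonlinearity \<alpha> g x)))"
    unfolding l2_inner_def using integral_Re[OF i] by simp
  also have "\<dots> \<le> (LINT x|lborel. cmod (f x) powr (\<alpha> + 2) - cmod (g x) powr (\<alpha> + 2))"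
    using pf pg integrable_Re[OF i] powr_norm_tangent_below[OF assms(1)]
    by (intro integral_mono) (auto simp: power_nonlinearity_def simp del: complex_cnj_mult)
  also have "\<dots> = potential \<alpha> f - potential \<alpha> g"
    unfolding potential_def using pf pg by (rule Bochner_Integration.integral_diff)
  finally show ?thesis .
qed

lemma potential_tangent_above:
  fixes f g :: "'a::euclidean_space \<Rightarrow> complex"
  assumes "\<alpha> > 0" "f \<in> L2" "g \<in> L2" "\<And>x. cmod (f x) \<le> K" "\<And>x. cmod (g x) \<le> K"
  shows "potential \<alpha> f - potential \<alpha> g \<le> (\<alpha> + 2) * Re (l2_inner (\<lambda>x. f x - g x) (power_nonlinearity \<alpha> f))"
proof -
  have "l2_inner (\<lambda>x. g x - f x) (power_nonlinearity \<alpha> f) = - l2_inner (\<lambda>x. f x - g x) (power_nonlinearity \<alpha> f)"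
    using l2_inner_cmult_left[of "-1" "\<lambda>x. f x - g x" "power_nonlinearity \<alpha> f"] by simp
  with potential_tangent_below[OF assms(1,3,2,5,4)] show ?thesis by simp
qed

definition dirichlet :: "('a::euclidean_space \<Rightarrow> complex) \<Rightarrow> real" where
  "dirichlet f = (\<Sum>b\<in>Basis. (L2_norm (weak_deriv b f))\<^sup>2)"

lemma energy_eq:
  assumes "f \<in> H1"
  shows "energy \<alpha> f = 1 / 2 * dirichlet f - 1 / (\<alpha> + 2) * potential \<alpha> f"
proof -
  have "(LINT x|lborel. (\<Sum>b\<in>Basis. (cmod (weak_deriv b f x))\<^sup>2)) = dirichlet f"
    unfolding dirichlet_def L2_norm_square
    by (rule Bochner_Integration.integral_sum) (use assms in \<open>auto intro: L2D weak_deriv_in_L2\<close>)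
  then show ?thesis by (simp add: energy_def potential_def)
qed

lemma H2_D: "f \<in> H2 \<Longrightarrow> f \<in> H1" "f \<in> H2 \<Longrightarrow> b \<in> Basis \<Longrightarrow> weak_deriv b f \<in> H1"
  by (auto simp: H2_def)

lemma laplacian_L2: "f \<in> H2 \<Longrightarrow> laplacian f \<in> L2"
  unfolding laplacian_def[abs_def] by (intro L2_sum weak_deriv_in_L2 H2_D) auto

lemma green_identity:
  assumes f: "f \<in> H1" and h: "h \<in> H2"
  shows "l2_inner f (laplacian h) = - (\<Sum>b\<in>Basis. l2_inner (weak_deriv b f) (weak_deriv b h))"
proof -
  have "l2_inner (weak_deriv b f) (weak_deriv b h) = - l2_inner f (weak_deriv b (weak_deriv b h))"
    if "b \<in> Basis" for b
  proof -
    have hb: "weak_deriv b h \<in> H1" using h that by (rule H2_D)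
    show ?thesis
      by (rule weak_deriv_integration_by_parts[OF weak_deriv_works[OF f that] H1_L2[OF f]
          weak_deriv_in_L2[OF f that] weak_deriv_works[OF hb that] H1_L2[OF hb]
          weak_deriv_in_L2[OF hb that] that])
  qed
  moreover have "l2_inner f (laplacian h) = (\<Sum>b\<in>Basis. l2_inner f (weak_deriv b (weak_deriv b h)))"
  proof -
    have "l2_inner (laplacian h) f = (\<Sum>b\<in>Basis. l2_inner (weak_deriv b (weak_deriv b h)) f)"
      unfolding laplacian_def[abs_def] using f h
      by (intro l2_inner_sum_left) (auto intro: weak_deriv_in_L2 H1_L2 H2_D(2))
    then have "cnj (l2_inner (laplacian h) f) = (\<Sum>b\<in>Basis. cnj (l2_inner (weak_deriv b (weak_deriv b h)) f))"
      by simp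
    then show ?thesis by (simp add: l2_inner_cnj)
  qed
  ultimately show ?thesis by (simp add: sum_negf)
qed

lemma green_identity_self: "f \<in> H2 \<Longrightarrow> l2_inner f (laplacian f) = - of_real (dirichlet f)"
  by (simp add: green_identity H2_D l2_inner_self dirichlet_def)

text \<open>Polarisation and Green's identity. The right-hand side contains \<open>f - g\<close> itself but none of its
  derivatives, so it can be divided by the time step when \<open>f\<close> and \<open>g\<close> lie on an \<open>L\<^sup>2\<close>-differentiable curve.\<close>

lemma dirichlet_diff:
  assumes f: "f \<in> H2" and g: "g \<in> H2"
  shows "dirichlet f - dirichlet g = - Re (l2_inner (\<lambda>x. f x - g x) (\<lambda>x. laplacian f x + laplacian g x))"
proof -
  note L2 = laplacian_L2[OF f] laplacian_L2[OF g] H1_L2[OF H2_D(1)[OF f]] H1_L2[OF H2_D(1)[OF g]]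
  have "l2_inner g (laplacian f) = cnj (l2_inner f (laplacian g))"
    using f g by (simp add: green_identity H2_D l2_inner_cnj)
  then have "Re (l2_inner g (laplacian f)) = Re (l2_inner f (laplacian g))" by simp
  then show ?thesis
    using L2 green_identity_self[OF f] green_identity_self[OF g]
    by (simp add: l2_inner_diff_left l2_inner_add_right L2_add)
qed

lemma has_weak_deriv_cong:
  assumes "has_weak_deriv b f g" "AE x in lborel. f x = f' x" "locally_integrable f'" "b \<in> Basis"
  shows "has_weak_deriv b f' g"
  unfolding has_weak_deriv_def
proof (intro conjI allI impI)
  fix \<phi> :: "'a \<Rightarrow> complex" assume \<phi>: "test_function \<phi>"
  have "(LINT x|lborel. f' x * frechet_derivative \<phi> (at x) b) = (LINT x|lborel. f x * frechet_derivative \<phi> (at x) b)"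
  proof (rule integral_cong_AE)
    show "AE x in lborel. f' x * frechet_derivative \<phi> (at x) b = f x * frechet_derivative \<phi> (at x) b"
      using assms(2) by eventually_elim simp
    show "(\<lambda>x. f' x * frechet_derivative \<phi> (at x) b) \<in> borel_measurable lborel"
      by (rule borel_measurable_integrable[OF locally_integrable_mult_test(2)[OF assms(3) \<phi> assms(4)]])
    have "locally_integrable f" using assms(1) by (simp add: has_weak_deriv_def)
    then show "(\<lambda>x. f x * frechet_derivative \<phi> (at x) b) \<in> borel_measurable lborel"
      by (rule borel_measurable_integrable[OF locally_integrable_mult_test(2)[OF _ \<phi> assms(4)]])
  qed
  then show "(LINT x|lborel. f' x * frechet_derivative \<phi> (at x) b) = - (LINT x|lborel. g x * \<phi> x)"
    using assms(1) \<phi> by (simp add: has_weak_deriv_def)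
qed (use assms in \<open>auto simp: has_weak_deriv_def\<close>)

text \<open>\<open>weak_deriv b (\<lambda>x. f x - g x)\<close> agrees with the difference of the weak derivatives almost everywhere only,
  so linearity of the second derivative needs that weak derivatives do not depend on the representative.\<close>

lemma second_weak_deriv_diff:
  assumes f: "f \<in> H2" and g: "g \<in> H2" and b: "b \<in> Basis"
  shows "L2_norm (weak_deriv b (weak_deriv b (\<lambda>x. f x - g x))) =
    L2_norm (\<lambda>x. weak_deriv b (weak_deriv b f) x - weak_deriv b (weak_deriv b g) x)"
proof -
  let ?h = "weak_deriv b (\<lambda>x. f x - g x)"
  let ?d = "\<lambda>x. weak_deriv b (weak_deriv b f) x - weak_deriv b (weak_deriv b g) x"
  have fg: "(\<lambda>x. f x - g x) \<in> H1" using f g by (intro H1_diff H2_D)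
  have h: "?h \<in> L2" using fg b by (rule weak_deriv_in_L2)
  have "has_weak_deriv b (\<lambda>x. weak_deriv b f x - weak_deriv b g x) ?d"
    using f g b by (intro has_weak_deriv_diff weak_deriv_works H2_D)
  moreover have "AE x in lborel. weak_deriv b f x - weak_deriv b g x = ?h x"
    using weak_deriv_diff[OF H2_D(1)[OF f] H2_D(1)[OF g] b] by eventually_elim simp
  ultimately have d: "has_weak_deriv b ?h ?d"
    using L2_locally_integrable[OF h] b by (rule has_weak_deriv_cong)
  have w: "has_weak_deriv b ?h (weak_deriv b ?h)"
    unfolding weak_deriv_def[of b ?h] by (rule someI[of "has_weak_deriv b ?h", OF d])
  have "AE x in lborel. weak_deriv b ?h x = ?d x" by (rule has_weak_deriv_unique[OF w d])
  then show ?thesis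
    by (rule L2_norm_cong_AE) (use w d in \<open>auto simp: has_weak_deriv_def locally_integrable_def\<close>)
qed

lemma H1_norm_ge:
  shows "L2_norm f \<le> H1_norm f"
    and "b \<in> Basis \<Longrightarrow> L2_norm (weak_deriv b f) \<le> H1_norm f"
proof -
  have "(L2_norm f)\<^sup>2 \<le> (H1_norm f)\<^sup>2" by (simp add: H1_norm_def sum_nonneg add_nonneg_nonneg)
  then show "L2_norm f \<le> H1_norm f"
    by (rule power2_le_imp_le) (simp add: H1_norm_def sum_nonneg add_nonneg_nonneg)
  assume b: "b \<in> Basis"
  have "(L2_norm (weak_deriv b f))\<^sup>2 \<le> (\<Sum>b\<in>Basis. (L2_norm (weak_deriv b f))\<^sup>2)"
    using b by (intro member_le_sum) auto
  then have "(L2_norm (weak_deriv b f))\<^sup>2 \<le> (H1_norm f)\<^sup>2"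
    by (simp add: H1_norm_def sum_nonneg add_nonneg_nonneg add_increasing)
  then show "L2_norm (weak_deriv b f) \<le> H1_norm f"
    by (rule power2_le_imp_le) (simp add: H1_norm_def sum_nonneg add_nonneg_nonneg)
qed

lemma H2_norm_ge:
  assumes b: "b \<in> Basis"
  shows "L2_norm (weak_deriv b (weak_deriv b f)) \<le> H2_norm f"
proof -
  define S where "S b = (\<Sum>c\<in>Basis. (L2_norm (weak_deriv c (weak_deriv b f)))\<^sup>2)" for b
  have S_nonneg: "0 \<le> S b" for b unfolding S_def by (intro sum_nonneg) auto
  have 1: "(L2_norm (weak_deriv b (weak_deriv b f)))\<^sup>2 \<le> S b"
    unfolding S_def using b by (intro member_le_sum) auto
  have 2: "S b \<le> sum S Basis"
    using b S_nonneg by (intro member_le_sum) auto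
  have 3: "H2_norm f = sqrt ((H1_norm f)\<^sup>2 + sum S Basis)"
    by (simp add: H2_norm_def S_def)
  have "0 \<le> sum S Basis" using S_nonneg by (intro sum_nonneg)
  then have "(H2_norm f)\<^sup>2 = (H1_norm f)\<^sup>2 + sum S Basis" "0 \<le> H2_norm f" unfolding 3 by auto
  moreover have "0 \<le> (H1_norm f)\<^sup>2" by simp
  ultimately have "(L2_norm (weak_deriv b (weak_deriv b f)))\<^sup>2 \<le> (H2_norm f)\<^sup>2"
    using 1 2 by linarith
  then show ?thesis by (rule power2_le_imp_le) fact
qed

lemma L2_norm_weak_deriv_diff:
  assumes "f \<in> H1" "g \<in> H1" "b \<in> Basis"
  shows "L2_norm (\<lambda>x. weak_deriv b f x - weak_deriv b g x) \<le> H1_norm (\<lambda>x. f x - g x)"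
proof -
  have "L2_norm (weak_deriv b (\<lambda>x. f x - g x)) = L2_norm (\<lambda>x. weak_deriv b f x - weak_deriv b g x)"
    using weak_deriv_diff[OF assms] by (rule L2_norm_cong_AE)
      (use assms in \<open>auto intro!: L2D(1) L2_diff weak_deriv_in_L2 H1_diff\<close>)
  then show ?thesis using H1_norm_ge(2)[OF assms(3), of "\<lambda>x. f x - g x"] by simp
qed

lemma L2_norm_laplacian_diff:
  fixes f g :: "'a::euclidean_space \<Rightarrow> complex"
  assumes "f \<in> H2" "g \<in> H2"
  shows "L2_norm (\<lambda>x. laplacian f x - laplacian g x) \<le> real DIM('a) * H2_norm (\<lambda>x. f x - g x)"
proof -
  have "L2_norm (\<lambda>x. laplacian f x - laplacian g x) =
      L2_norm (\<lambda>x. \<Sum>b\<in>Basis. weak_deriv b (weak_deriv b f) x - weak_deriv b (weak_deriv b g) x)"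
    by (simp add: laplacian_def sum_subtractf)
  also have "\<dots> \<le> (\<Sum>b\<in>Basis. L2_norm (\<lambda>x. weak_deriv b (weak_deriv b f) x - weak_deriv b (weak_deriv b g) x))"
    using assms by (intro L2_norm_sum L2_diff weak_deriv_in_L2 H2_D) auto
  also have "\<dots> \<le> (\<Sum>b\<in>(Basis::'a set). H2_norm (\<lambda>x. f x - g x))"
  proof (rule sum_mono)
    fix b :: 'a assume b: "b \<in> Basis"
    show "L2_norm (\<lambda>x. weak_deriv b (weak_deriv b f) x - weak_deriv b (weak_deriv b g) x)
        \<le> H2_norm (\<lambda>x. f x - g x)"
      using H2_norm_ge[OF b, of "\<lambda>x. f x - g x"] unfolding second_weak_deriv_diff[OF assms b] .
  qed
  finally show ?thesis by simp
qed

text \<open>The pairing converges because the difference quotient converges in norm and so does the other factor.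
  The factor \<open>w h\<close> may depend on the time step, as the increments of mass and energy require.\<close>

lemma L2_time_deriv_inner:
  assumes v: "has_L2_time_deriv u v t"
    and uL2: "\<forall>\<^sub>F h in at 0. u (t + h) \<in> L2" "u t \<in> L2"
    and wL2: "\<forall>\<^sub>F h in at 0. w h \<in> L2" "w0 \<in> L2"
    and w: "((\<lambda>h. L2_norm (\<lambda>x. w h x - w0 x)) \<longlongrightarrow> 0) (at 0)"
  shows "((\<lambda>h. Re (l2_inner (\<lambda>x. u (t + h) x - u t x) (w h)) / h) \<longlongrightarrow> Re (l2_inner v w0)) (at 0)"
proof -
  have vL2: "v \<in> L2" and lim: "((\<lambda>h. L2_norm (\<lambda>x. (u (t + h) x - u t x) / complex_of_real h - v x)) \<longlongrightarrow> 0) (at 0)"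
    using v by (auto simp: has_L2_time_deriv_def)
  let ?q = "\<lambda>h x. (u (t + h) x - u t x) / complex_of_real h"
  let ?e = "\<lambda>h. L2_norm (\<lambda>x. ?q h x - v x) * (L2_norm w0 + L2_norm (\<lambda>x. w h x - w0 x)) +
      L2_norm v * L2_norm (\<lambda>x. w h x - w0 x)"
  have "((\<lambda>h. Re (l2_inner (\<lambda>x. u (t + h) x - u t x) (w h)) / h - Re (l2_inner v w0)) \<longlongrightarrow> 0) (at 0)"
  proof (rule Lim_null_comparison)
    have "(?e \<longlongrightarrow> 0 * (L2_norm w0 + 0) + L2_norm v * 0) (at 0)"
      by (intro tendsto_intros lim w)
    then show "(?e \<longlongrightarrow> 0) (at 0)" by simp
    show "\<forall>\<^sub>F h in at 0. norm (Re (l2_inner (\<lambda>x. u (t + h) x - u t x) (w h)) / h - Re (l2_inner v w0)) \<le> ?e h"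
      using uL2(1) wL2(1)
    proof eventually_elim
      case (elim h)
      have q: "?q h \<in> L2"
        using L2_cmult[OF L2_diff[OF elim(1) uL2(2)], of "1 / complex_of_real h"] by simp
      have "l2_inner (?q h) (w h) = l2_inner (\<lambda>x. u (t + h) x - u t x) (w h) / complex_of_real h"
        using l2_inner_cmult_left[of "1 / complex_of_real h" "\<lambda>x. u (t + h) x - u t x" "w h"] by simp
      then have "Re (l2_inner (\<lambda>x. u (t + h) x - u t x) (w h)) / h - Re (l2_inner v w0) =
          Re (l2_inner (?q h) (w h) - l2_inner v w0)"
        by simp
      have tri: "norm (Re (y + z)) \<le> cmod y + cmod z" for y z
        using abs_Re_le_cmod[of "y + z"] norm_triangle_ineq[of y z] by simp
      note \<open>Re (l2_inner (\<lambda>x. u (t + h) x - u t x) (w h)) / h - Re (l2_inner v w0) =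
          Re (l2_inner (?q h) (w h) - l2_inner v w0)\<close>
      also have "l2_inner (?q h) (w h) - l2_inner v w0 =
          l2_inner (\<lambda>x. ?q h x - v x) (w h) + l2_inner v (\<lambda>x. w h x - w0 x)"
        using q vL2 elim wL2 by (simp add: l2_inner_diff_left l2_inner_diff_right)
      also have "norm (Re \<dots>) \<le> cmod (l2_inner (\<lambda>x. ?q h x - v x) (w h)) + cmod (l2_inner v (\<lambda>x. w h x - w0 x))"
        by (rule tri)
      also have "\<dots> \<le> L2_norm (\<lambda>x. ?q h x - v x) * L2_norm (w h) + L2_norm v * L2_norm (\<lambda>x. w h x - w0 x)"
        using q vL2 elim wL2 by (intro add_mono L2_Cauchy_Schwarz L2_diff)
      also have "L2_norm (w h) \<le> L2_norm w0 + L2_norm (\<lambda>x. w h x - w0 x)"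
        using L2_norm_diff_abs[OF elim(2) wL2(2)] by linarith
      finally show ?case by (simp add: mult_left_mono)
    qed
  qed
  then show ?thesis by (rule LIM_zero_cancel)
qed

section \<open>Time derivatives of mass and energy\<close>

lemma has_real_derivative_sandwich:
  fixes F A B :: "real \<Rightarrow> real"
  assumes A: "((\<lambda>h. A h / h) \<longlongrightarrow> D) (at 0)" and B: "((\<lambda>h. B h / h) \<longlongrightarrow> D) (at 0)"
    and F: "\<forall>\<^sub>F h in at 0. A h \<le> F (t + h) - F t \<and> F (t + h) - F t \<le> B h"
  shows "(F has_real_derivative D) (at t)"
proof -
  have "((\<lambda>h. (F (t + h) - F t) / h - D) \<longlongrightarrow> 0) (at 0)"
  proof (rule Lim_null_comparison)
    have "((\<lambda>h. \<bar>A h / h - D\<bar> + \<bar>B h / h - D\<bar>) \<longlongrightarrow> \<bar>D - D\<bar> + \<bar>D - D\<bar>) (at 0)"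
      by (intro tendsto_intros A B)
    then show "((\<lambda>h. \<bar>A h / h - D\<bar> + \<bar>B h / h - D\<bar>) \<longlongrightarrow> 0) (at 0)" by simp
    show "\<forall>\<^sub>F h in at 0. norm ((F (t + h) - F t) / h - D) \<le> \<bar>A h / h - D\<bar> + \<bar>B h / h - D\<bar>"
      using F
    proof eventually_elim
      case (elim h)
      show ?case
      proof (cases "h \<ge> 0")
        case True
        then have "A h / h \<le> (F (t + h) - F t) / h" "(F (t + h) - F t) / h \<le> B h / h"
          using elim by (auto intro!: divide_right_mono simp del: diff_divide_distrib)
        then show ?thesis unfolding real_norm_def by linarith
      next
        case False
        then have "(F (t + h) - F t) / h \<le> A h / h" "B h / h \<le> (F (t + h) - F t) / h"
          using elim by (auto intro!: divide_right_mono_neg)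
        then show ?thesis unfolding real_norm_def by linarith
      qed
    qed
  qed
  then show ?thesis unfolding DERIV_def by (rule LIM_zero_cancel)
qed

lemma eventually_pos_shift:
  fixes t :: real
  assumes "t > 0"
  shows "\<forall>\<^sub>F h in at 0. t + h > 0"
proof -
  have "((\<lambda>h. t + h) \<longlongrightarrow> t + 0) (at 0)" by (intro tendsto_intros)
  then show ?thesis using assms by (intro order_tendstoD(1)[where y = "t + 0"]) auto
qed

text \<open>\<open>\<parallel>f\<parallel>\<^sup>2 - \<parallel>g\<parallel>\<^sup>2 = Re \<langle>f - g, f + g\<rangle>\<close> turns the increment into a single pairing.\<close>

lemma mass_has_derivative:
  fixes u :: "real \<Rightarrow> 'a::euclidean_space \<Rightarrow> complex"
  assumes v: "has_L2_time_deriv u v t" and t: "t > 0" and u: "\<And>s. s > 0 \<Longrightarrow> u s \<in> L2"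
    and cont: "((\<lambda>s. L2_norm (\<lambda>x. u s x - u t x)) \<longlongrightarrow> 0) (at t)"
  shows "((\<lambda>s. (L2_norm (u s))\<^sup>2) has_real_derivative 2 * Re (l2_inner v (u t))) (at t)"
proof -
  have vL2: "v \<in> L2" using v by (simp add: has_L2_time_deriv_def)
  note pos = eventually_pos_shift[OF t]
  let ?R = "\<lambda>h. Re (l2_inner (\<lambda>x. u (t + h) x - u t x) (\<lambda>x. u (t + h) x + u t x))"
  have R: "((\<lambda>h. ?R h / h) \<longlongrightarrow> Re (l2_inner v (\<lambda>x. u t x + u t x))) (at 0)"
  proof (rule L2_time_deriv_inner[OF v])
    show "\<forall>\<^sub>F h in at 0. u (t + h) \<in> L2" using pos by eventually_elim (rule u)
    show "\<forall>\<^sub>F h in at 0. (\<lambda>x. u (t + h) x + u t x) \<in> L2"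
      using pos by eventually_elim (intro L2_add u t)
    show "((\<lambda>h. L2_norm (\<lambda>x. u (t + h) x + u t x - (u t x + u t x))) \<longlongrightarrow> 0) (at 0)"
      using LIM_offset_zero[OF cont] by simp
  qed (intro L2_add u t)+
  have eq: "(L2_norm f)\<^sup>2 - (L2_norm g)\<^sup>2 = Re (l2_inner (\<lambda>x. f x - g x) (\<lambda>x. f x + g x))"
    if "f \<in> L2" "g \<in> L2" for f g :: "'a \<Rightarrow> complex"
  proof -
    have "Re (l2_inner f g) = Re (l2_inner g f)" using l2_inner_cnj[of f g] by (metis cnj.sel(1))
    then show ?thesis
      using that by (simp add: l2_inner_diff_left l2_inner_add_right L2_add l2_inner_self)
  qed
  have "((\<lambda>s. (L2_norm (u s))\<^sup>2) has_real_derivative Re (l2_inner v (\<lambda>x. u t x + u t x))) (at t)"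
  proof (rule has_real_derivative_sandwich[OF R R])
    show "\<forall>\<^sub>F h in at 0. ?R h \<le> (L2_norm (u (t + h)))\<^sup>2 - (L2_norm (u t))\<^sup>2 \<and>
        (L2_norm (u (t + h)))\<^sup>2 - (L2_norm (u t))\<^sup>2 \<le> ?R h"
      using pos by eventually_elim (simp add: eq u t)
  qed
  moreover have "Re (l2_inner v (\<lambda>x. u t x + u t x)) = 2 * Re (l2_inner v (u t))"
    unfolding l2_inner_add_right[OF u[OF t] u[OF t] vL2] by simp
  ultimately show ?thesis by (simp only:)
qed

text \<open>The Dirichlet part is exact. For the potential part, the tangents at \<open>f\<close> and at \<open>g\<close> give the two bounds.\<close>

lemma energy_increment:
  fixes f g :: "'a::euclidean_space \<Rightarrow> complex"
  assumes \<alpha>: "\<alpha> > 0" and f: "f \<in> H2" and g: "g \<in> H2"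
    and K: "\<And>x. cmod (f x) \<le> K" "\<And>x. cmod (g x) \<le> K"
  shows "- Re (l2_inner (\<lambda>x. f x - g x) (\<lambda>x. (1/2) * (laplacian f x + laplacian g x) + power_nonlinearity \<alpha> f x))
      \<le> energy \<alpha> f - energy \<alpha> g" (is ?lower)
    and "energy \<alpha> f - energy \<alpha> g \<le>
      - Re (l2_inner (\<lambda>x. f x - g x) (\<lambda>x. (1/2) * (laplacian f x + laplacian g x) + power_nonlinearity \<alpha> g x))" (is ?upper)
proof -
  let ?d = "\<lambda>x. f x - g x" and ?L = "\<lambda>x. laplacian f x + laplacian g x"
  have fL2: "f \<in> L2" and gL2: "g \<in> L2" using f g by (auto intro: H1_L2 H2_D(1))
  have d: "?d \<in> L2" using fL2 gL2 by (rule L2_diff)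
  have L: "?L \<in> L2" using f g by (intro L2_add laplacian_L2)
  have half: "(\<lambda>x. (1/2) * ?L x) \<in> L2" using L by (rule L2_cmult)
  have nf: "power_nonlinearity \<alpha> f \<in> L2" by (rule power_nonlinearity_L2(1)[OF \<alpha> fL2 K(1)])
  have ng: "power_nonlinearity \<alpha> g \<in> L2" by (rule power_nonlinearity_L2(1)[OF \<alpha> gL2 K(2)])
  have E: "energy \<alpha> f - energy \<alpha> g =
      (dirichlet f - dirichlet g) / 2 - (potential \<alpha> f - potential \<alpha> g) / (\<alpha> + 2)"
    unfolding energy_eq[OF H2_D(1)[OF f]] energy_eq[OF H2_D(1)[OF g]] by (simp add: diff_divide_distrib)
  have w: "Re (l2_inner ?d (\<lambda>x. (1/2) * ?L x + k x)) = Re (l2_inner ?d ?L) / 2 + Re (l2_inner ?d k)"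
    if "k \<in> L2" for k
  proof -
    have "l2_inner ?d (\<lambda>x. (1/2) * ?L x) = cnj (l2_inner (\<lambda>x. (1/2) * ?L x) ?d)" by (simp only: l2_inner_cnj)
    also have "\<dots> = cnj ((1/2) * l2_inner ?L ?d)" by (simp only: l2_inner_cmult_left)
    also have "\<dots> = (1/2) * l2_inner ?d ?L" by (simp add: l2_inner_cnj)
    finally have h: "l2_inner ?d (\<lambda>x. (1/2) * ?L x) = (1/2) * l2_inner ?d ?L" .
    show ?thesis unfolding l2_inner_add_right[OF half that d] h by simp
  qed
  have div: "(potential \<alpha> f - potential \<alpha> g) / (\<alpha> + 2) \<le> Re (l2_inner ?d (power_nonlinearity \<alpha> f))"
    "Re (l2_inner ?d (power_nonlinearity \<alpha> g)) \<le> (potential \<alpha> f - potential \<alpha> g) / (\<alpha> + 2)"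
    using potential_tangent_above[OF \<alpha> fL2 gL2 K] potential_tangent_below[OF \<alpha> fL2 gL2 K] \<alpha>
    by (simp_all add: pos_divide_le_eq pos_le_divide_eq mult.commute)
  show ?lower unfolding E w[OF nf] dirichlet_diff[OF f g] using div(1) by simp
  show ?upper unfolding E w[OF ng] dirichlet_diff[OF f g] using div(2) by simp
qed

lemma sup_norm_locally_bounded:
  fixes u :: "'b \<Rightarrow> 'a::euclidean_space \<Rightarrow> complex"
  assumes u: "\<forall>\<^sub>F s in F. u s \<in> C0" "w \<in> C0"
    and cont: "((\<lambda>s. sup_norm (\<lambda>x. u s x - w x)) \<longlongrightarrow> 0) F"
  shows "\<forall>\<^sub>F s in F. \<forall>x. cmod (u s x) \<le> sup_norm w + 1"
  using u(1) order_tendstoD(2)[OF cont zero_less_one]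
proof eventually_elim
  case (elim s)
  have "cmod (u s x) \<le> sup_norm w + 1" for x
    using norm_triangle_ineq2[of "u s x" "w x"] C0_le_sup_norm[OF u(2), of x]
      C0_le_sup_norm[OF C0_diff[OF elim(1) u(2)], of x] elim(2) by linarith
  then show ?case by blast
qed

lemma power_nonlinearity_tendsto:
  fixes u :: "'b \<Rightarrow> 'a::euclidean_space \<Rightarrow> complex"
  assumes \<alpha>: "\<alpha> > 0" and K: "\<forall>\<^sub>F s in F. \<forall>x. cmod (u s x) \<le> K" "\<And>x. cmod (w x) \<le> K"
    and L2: "\<forall>\<^sub>F s in F. u s \<in> L2" "w \<in> L2"
    and cont: "((\<lambda>s. L2_norm (\<lambda>x. u s x - w x)) \<longlongrightarrow> 0) F"
  shows "((\<lambda>s. L2_norm (\<lambda>x. power_nonlinearity \<alpha> (u s) x - power_nonlinearity \<alpha> w x)) \<longlongrightarrow> 0) F"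
proof (rule Lim_null_comparison)
  show "((\<lambda>s. (\<alpha> + 1) * K powr \<alpha> * L2_norm (\<lambda>x. u s x - w x)) \<longlongrightarrow> 0) F"
    by (rule tendsto_mult_right_zero[OF cont])
  show "\<forall>\<^sub>F s in F. norm (L2_norm (\<lambda>x. power_nonlinearity \<alpha> (u s) x - power_nonlinearity \<alpha> w x))
      \<le> (\<alpha> + 1) * K powr \<alpha> * L2_norm (\<lambda>x. u s x - w x)"
    using K(1) L2(1)
  proof eventually_elim
    case (elim s)
    then show ?case using power_nonlinearity_lipschitz[OF \<alpha> elim(2) L2(2) _ K(2)] by simp
  qed
qed

text \<open>Both bounds of \<open>energy_increment\<close> pair \<open>u (t + h) - u t\<close> with a function that converges in \<open>L\<^sup>2\<close> to
  \<open>laplacian (u t) + power_nonlinearity \<alpha> (u t)\<close>.\<close>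

lemma energy_has_derivative:
  fixes u :: "real \<Rightarrow> 'a::euclidean_space \<Rightarrow> complex"
  assumes \<alpha>: "\<alpha> > 0" and v: "has_L2_time_deriv u v t" and t: "t > 0"
    and u: "\<And>s. s > 0 \<Longrightarrow> u s \<in> H2" "\<And>s. s > 0 \<Longrightarrow> u s \<in> C0"
    and cont_sup: "((\<lambda>s. sup_norm (\<lambda>x. u s x - u t x)) \<longlongrightarrow> 0) (at t)"
    and cont_L2: "((\<lambda>s. L2_norm (\<lambda>x. u s x - u t x)) \<longlongrightarrow> 0) (at t)"
    and cont_lap: "((\<lambda>s. L2_norm (\<lambda>x. laplacian (u s) x - laplacian (u t) x)) \<longlongrightarrow> 0) (at t)"
  shows "((\<lambda>s. energy \<alpha> (u s)) has_real_derivative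
    - Re (l2_inner v (\<lambda>x. laplacian (u t) x + power_nonlinearity \<alpha> (u t) x))) (at t)"
proof -
  define K where "K = sup_norm (u t) + 1"
  note pos = eventually_pos_shift[OF t]
  have uL2: "u s \<in> L2" if "s > 0" for s using u(1)[OF that] by (intro H1_L2 H2_D(1))
  have Kt: "cmod (u t x) \<le> K" for x using C0_le_sup_norm[OF u(2)[OF t], of x] by (simp add: K_def)
  have bounded: "\<forall>\<^sub>F h in at 0. \<forall>x. cmod (u (t + h) x) \<le> K"
    unfolding K_def
  proof (rule sup_norm_locally_bounded)
    show "\<forall>\<^sub>F h in at 0. u (t + h) \<in> C0" using pos by eventually_elim (rule u)
    show "((\<lambda>h. sup_norm (\<lambda>x. u (t + h) x - u t x)) \<longlongrightarrow> 0) (at 0)" by (rule LIM_offset_zero[OF cont_sup])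
  qed (rule u[OF t])
  have uL2_ev: "\<forall>\<^sub>F h in at 0. u (t + h) \<in> L2" using pos by eventually_elim (rule uL2)
  let ?N = "power_nonlinearity \<alpha>"
  have N_lim: "((\<lambda>h. L2_norm (\<lambda>x. ?N (u (t + h)) x - ?N (u t) x)) \<longlongrightarrow> 0) (at 0)"
    by (rule power_nonlinearity_tendsto[OF \<alpha> bounded Kt uL2_ev uL2[OF t] LIM_offset_zero[OF cont_L2]])
  have N_t: "?N (u t) \<in> L2" by (rule power_nonlinearity_L2(1)[OF \<alpha> uL2[OF t] Kt])
  have N_ev: "\<forall>\<^sub>F h in at 0. ?N (u (t + h)) \<in> L2"
    using uL2_ev bounded
  proof eventually_elim
    case (elim h)
    then show ?case using power_nonlinearity_L2(1)[OF \<alpha>, of "u (t + h)" K] by blast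
  qed
  have lap_t: "laplacian (u t) \<in> L2" by (rule laplacian_L2[OF u(1)[OF t]])
  have lap_ev: "\<forall>\<^sub>F h in at 0. laplacian (u (t + h)) \<in> L2"
    using pos by eventually_elim (rule laplacian_L2[OF u(1)])
  let ?lim = "\<lambda>x. laplacian (u t) x + ?N (u t) x"
  let ?w = "\<lambda>k h x. (1/2) * (laplacian (u (t + h)) x + laplacian (u t) x) + k h x"
  have lim: "((\<lambda>h. Re (l2_inner (\<lambda>x. u (t + h) x - u t x) (?w k h)) / h) \<longlongrightarrow> Re (l2_inner v ?lim)) (at 0)"
    if k: "\<forall>\<^sub>F h in at 0. k h \<in> L2" "((\<lambda>h. L2_norm (\<lambda>x. k h x - ?N (u t) x)) \<longlongrightarrow> 0) (at 0)" for k
  proof (rule L2_time_deriv_inner[OF v uL2_ev uL2[OF t]])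
    show "?lim \<in> L2" using lap_t N_t by (rule L2_add)
    show "\<forall>\<^sub>F h in at 0. ?w k h \<in> L2"
      using k(1) lap_ev by eventually_elim (intro L2_add L2_cmult lap_t)
    show "((\<lambda>h. L2_norm (\<lambda>x. ?w k h x - ?lim x)) \<longlongrightarrow> 0) (at 0)"
    proof (rule Lim_null_comparison)
      let ?e = "\<lambda>h. (1/2) * L2_norm (\<lambda>x. laplacian (u (t + h)) x - laplacian (u t) x) +
          L2_norm (\<lambda>x. k h x - ?N (u t) x)"
      have "(?e \<longlongrightarrow> (1/2) * 0 + 0) (at 0)"
        by (intro tendsto_intros k(2) LIM_offset_zero[OF cont_lap])
      then show "(?e \<longlongrightarrow> 0) (at 0)" by simp
      show "\<forall>\<^sub>F h in at 0. norm (L2_norm (\<lambda>x. ?w k h x - ?lim x)) \<le> ?e h"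
        using k(1) lap_ev
      proof eventually_elim
        case (elim h)
        have "(\<lambda>x. ?w k h x - ?lim x) =
          (\<lambda>x. (1/2) * (laplacian (u (t + h)) x - laplacian (u t) x) + (k h x - ?N (u t) x))"
          by (simp add: fun_eq_iff algebra_simps)
        then have "L2_norm (\<lambda>x. ?w k h x - ?lim x) \<le>
          L2_norm (\<lambda>x. (1/2) * (laplacian (u (t + h)) x - laplacian (u t) x)) + L2_norm (\<lambda>x. k h x - ?N (u t) x)"
          using elim lap_t N_t by (simp only:) (intro L2_norm_triangle L2_cmult L2_diff)
        then show ?case unfolding L2_norm_cmult by simp
      qed
    qed
  qed
  have "((\<lambda>h. - Re (l2_inner (\<lambda>x. u (t + h) x - u t x) (?w (\<lambda>h. ?N (u (t + h))) h)) / h) \<longlongrightarrow>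
      - Re (l2_inner v ?lim)) (at 0)"
    using tendsto_minus[OF lim[OF N_ev N_lim]] by simp
  moreover have "((\<lambda>h. - Re (l2_inner (\<lambda>x. u (t + h) x - u t x) (?w (\<lambda>h. ?N (u t)) h)) / h) \<longlongrightarrow>
      - Re (l2_inner v ?lim)) (at 0)"
    using tendsto_minus[OF lim[of "\<lambda>h. ?N (u t)"]] N_t by (simp add: L2_norm_def)
  ultimately show ?thesis
  proof (rule has_real_derivative_sandwich)
    show "\<forall>\<^sub>F h in at 0.
       - Re (l2_inner (\<lambda>x. u (t + h) x - u t x) (?w (\<lambda>h. ?N (u (t + h))) h)) \<le> energy \<alpha> (u (t + h)) - energy \<alpha> (u t) \<and>
       energy \<alpha> (u (t + h)) - energy \<alpha> (u t) \<le> - Re (l2_inner (\<lambda>x. u (t + h) x - u t x) (?w (\<lambda>h. ?N (u t)) h))"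
      using pos bounded
    proof eventually_elim
      case (elim h)
      then show ?case
        using energy_increment[OF \<alpha> u(1)[OF elim(1)] u(1)[OF t], of K] Kt by blast
    qed
  qed
qed

lemma L2_norm_tendsto:
  assumes "\<forall>\<^sub>F s in F. f s \<in> L2" "g \<in> L2" "((\<lambda>s. L2_norm (\<lambda>x. f s x - g x)) \<longlongrightarrow> 0) F"
  shows "((\<lambda>s. L2_norm (f s)) \<longlongrightarrow> L2_norm g) F"
proof -
  have "((\<lambda>s. L2_norm (f s) - L2_norm g) \<longlongrightarrow> 0) F"
    by (rule Lim_null_comparison[OF _ assms(3)])
      (use assms(1) in eventually_elim, simp add: L2_norm_diff_abs[OF _ assms(2)])
  then show ?thesis by (rule LIM_zero_cancel)
qed

text \<open>Needed at time \<open>0\<close>, where the curve is continuous in \<open>H\<^sup>1\<close> and \<open>C0\<close> but need not be in \<open>H\<^sup>2\<close>.\<close>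

lemma energy_tendsto:
  fixes u :: "'b \<Rightarrow> 'a::euclidean_space \<Rightarrow> complex"
  assumes \<alpha>: "\<alpha> > 0" and u: "\<forall>\<^sub>F s in F. u s \<in> H1" "\<forall>\<^sub>F s in F. u s \<in> C0" and w: "w \<in> H1" "w \<in> C0"
    and cont_sup: "((\<lambda>s. sup_norm (\<lambda>x. u s x - w x)) \<longlongrightarrow> 0) F"
    and cont_H1: "((\<lambda>s. H1_norm (\<lambda>x. u s x - w x)) \<longlongrightarrow> 0) F"
  shows "((\<lambda>s. energy \<alpha> (u s)) \<longlongrightarrow> energy \<alpha> w) F"
proof -
  define K where "K = sup_norm w + 1"
  have wL2: "w \<in> L2" using w(1) by (rule H1_L2)
  have uL2: "\<forall>\<^sub>F s in F. u s \<in> L2" using u(1) by eventually_elim (rule H1_L2)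
  have Kw: "cmod (w x) \<le> K" for x using C0_le_sup_norm[OF w(2), of x] by (simp add: K_def)
  have bounded: "\<forall>\<^sub>F s in F. \<forall>x. cmod (u s x) \<le> K"
    unfolding K_def by (rule sup_norm_locally_bounded[OF u(2) w(2) cont_sup])
  have cont_L2: "((\<lambda>s. L2_norm (\<lambda>x. u s x - w x)) \<longlongrightarrow> 0) F"
    by (rule Lim_null_comparison[OF _ cont_H1]) (simp add: H1_norm_ge always_eventually)
  have norm_lim: "((\<lambda>s. L2_norm (u s)) \<longlongrightarrow> L2_norm w) F"
    by (rule L2_norm_tendsto[OF uL2 wL2 cont_L2])
  have "((\<lambda>s. potential \<alpha> (u s) - potential \<alpha> w) \<longlongrightarrow> 0) F"
  proof (rule Lim_null_comparison)
    let ?e = "\<lambda>s. (\<alpha> + 2) * (L2_norm (\<lambda>x. u s x - w x) * (K powr \<alpha> * (L2_norm (u s) + L2_norm w)))"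
    have "(?e \<longlongrightarrow> (\<alpha> + 2) * (0 * (K powr \<alpha> * (L2_norm w + L2_norm w)))) F"
      by (intro tendsto_intros cont_L2 norm_lim)
    then show "(?e \<longlongrightarrow> 0) F" by simp
    show "\<forall>\<^sub>F s in F. norm (potential \<alpha> (u s) - potential \<alpha> w) \<le> ?e s"
      using uL2 bounded
    proof eventually_elim
      case (elim s)
      then have Ks: "cmod (u s x) \<le> K" for x by blast
      note nu = power_nonlinearity_L2[OF \<alpha> elim(1) Ks]
      note nw = power_nonlinearity_L2[OF \<alpha> wL2 Kw]
      have d: "(\<lambda>x. u s x - w x) \<in> L2" using elim(1) wL2 by (rule L2_diff)
      let ?D = "L2_norm (\<lambda>x. u s x - w x)"
      have b: "\<bar>Re (l2_inner (\<lambda>x. u s x - w x) n)\<bar> \<le> ?D * (K powr \<alpha> * (L2_norm (u s) + L2_norm w))"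
        if "n \<in> L2" "L2_norm n \<le> K powr \<alpha> * (L2_norm (u s) + L2_norm w)" for n
        using abs_Re_le_cmod[of "l2_inner (\<lambda>x. u s x - w x) n"] L2_Cauchy_Schwarz[OF d that(1)]
          mult_left_mono[OF that(2), of ?D] by simp
      have nonneg: "0 \<le> K powr \<alpha> * L2_norm w" "0 \<le> K powr \<alpha> * L2_norm (u s)" by simp_all
      have "L2_norm (power_nonlinearity \<alpha> (u s)) \<le> K powr \<alpha> * (L2_norm (u s) + L2_norm w)"
        "L2_norm (power_nonlinearity \<alpha> w) \<le> K powr \<alpha> * (L2_norm (u s) + L2_norm w)"
        using nu(2) nw(2) nonneg unfolding distrib_left by - linarith+
      note bounds = b[OF nu(1) this(1)] b[OF nw(1) this(2)]
      have scale: "(\<alpha> + 2) * r \<le> (\<alpha> + 2) * B" "- ((\<alpha> + 2) * B) \<le> (\<alpha> + 2) * r" if "\<bar>r\<bar> \<le> B" for r B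
        using mult_left_mono[of r B "\<alpha> + 2"] mult_left_mono[of "- B" r "\<alpha> + 2"] that \<alpha> by auto
      have "(\<alpha> + 2) * Re (l2_inner (\<lambda>x. u s x - w x) (power_nonlinearity \<alpha> (u s))) \<le> ?e s"
        "- ?e s \<le> (\<alpha> + 2) * Re (l2_inner (\<lambda>x. u s x - w x) (power_nonlinearity \<alpha> w))"
        by (rule scale(1)[OF bounds(1)], rule scale(2)[OF bounds(2)])
      with potential_tangent_below[OF \<alpha> elim(1) wL2 Ks Kw] potential_tangent_above[OF \<alpha> elim(1) wL2 Ks Kw]
      show ?case unfolding real_norm_def by linarith
    qed
  qed
  then have P: "((\<lambda>s. potential \<alpha> (u s)) \<longlongrightarrow> potential \<alpha> w) F" by (rule LIM_zero_cancel)
  have "((\<lambda>s. L2_norm (weak_deriv b (u s))) \<longlongrightarrow> L2_norm (weak_deriv b w)) F" if b: "b \<in> Basis" for b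
  proof (rule L2_norm_tendsto)
    show "\<forall>\<^sub>F s in F. weak_deriv b (u s) \<in> L2" using u(1) by eventually_elim (rule weak_deriv_in_L2[OF _ b])
    show "weak_deriv b w \<in> L2" using w(1) b by (rule weak_deriv_in_L2)
    show "((\<lambda>s. L2_norm (\<lambda>x. weak_deriv b (u s) x - weak_deriv b w x)) \<longlongrightarrow> 0) F"
      by (rule Lim_null_comparison[OF _ cont_H1])
        (use u(1) in eventually_elim, simp add: L2_norm_weak_deriv_diff[OF _ w(1) b])
  qed
  then have D: "((\<lambda>s. dirichlet (u s)) \<longlongrightarrow> dirichlet w) F"
    unfolding dirichlet_def by (intro tendsto_sum tendsto_power)
  have "((\<lambda>s. 1 / 2 * dirichlet (u s) - 1 / (\<alpha> + 2) * potential \<alpha> (u s)) \<longlongrightarrow>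
      1 / 2 * dirichlet w - 1 / (\<alpha> + 2) * potential \<alpha> w) F"
    by (intro tendsto_intros D P)
  then show ?thesis
    unfolding energy_eq[OF w(1)]
    by (rule Lim_transform_eventually) (use u(1) in eventually_elim, simp add: energy_eq)
qed

lemma no_global_solution:
  fixes \<theta> \<alpha> \<gamma> \<xi> :: real and u :: "real \<Rightarrow> 'a::euclidean_space \<Rightarrow> complex"
  assumes \<theta>: "cos \<theta> > 0" and \<alpha>: "\<alpha> > 0" and \<gamma>: "\<gamma> < 0"
    and sol: "is_solution \<theta> \<alpha> \<gamma> u0 \<infinity> u"
    and \<xi>: "cos \<theta> * (\<alpha> + 2) * \<xi> \<ge> - \<gamma>"
    and neg: "energy \<alpha> u0 + \<xi> * (L2_norm u0)\<^sup>2 < 0"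
  shows False
proof -
  have u0: "u 0 = u0" using sol by (simp add: is_solution_def)
  have cc: "continuous_curve {0..} C0 sup_norm u" "continuous_curve {0..} H1 H1_norm u"
    "continuous_curve {0<..} H2 H2_norm u"
    using sol by (simp_all add: is_solution_def atLeast_def greaterThan_def)
  obtain v where v: "\<And>t. t > 0 \<Longrightarrow> has_L2_time_deriv u (v t) t"
    and eqn: "\<And>t. t > 0 \<Longrightarrow> AE x in lborel. v t x =
        cis \<theta> * (laplacian (u t) x + complex_of_real (cmod (u t x) powr \<alpha>) * u t x) + complex_of_real \<gamma> * u t x"
    using sol by (auto simp: is_solution_def)
  have C0: "u t \<in> C0" and H1: "u t \<in> H1"
    and cont_sup: "((\<lambda>s. sup_norm (\<lambda>x. u s x - u t x)) \<longlongrightarrow> 0) (at t within {0..})"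
    and cont_H1: "((\<lambda>s. H1_norm (\<lambda>x. u s x - u t x)) \<longlongrightarrow> 0) (at t within {0..})" if "t \<ge> 0" for t
    using cc(1,2) that by (auto simp: continuous_curve_def)
  have H2: "u t \<in> H2" if "t > 0" for t
    using cc(3) that by (auto simp: continuous_curve_def)
  have cont_H2: "((\<lambda>s. H2_norm (\<lambda>x. u s x - u t x)) \<longlongrightarrow> 0) (at t)" if "t > 0" for t
  proof -
    have "((\<lambda>s. H2_norm (\<lambda>x. u s x - u t x)) \<longlongrightarrow> 0) (at t within {0<..})"
      using cc(3) that by (auto simp: continuous_curve_def)
    then show ?thesis using that by (simp add: at_within_open[OF _ open_greaterThan])
  qed
  have L2: "u t \<in> L2" if "t \<ge> 0" for t using H1[OF that] by (rule H1_L2)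
  have cont_L2: "((\<lambda>s. L2_norm (\<lambda>x. u s x - u t x)) \<longlongrightarrow> 0) (at t within {0..})" if "t \<ge> 0" for t
    by (rule Lim_null_comparison[OF _ cont_H1[OF that]]) (simp add: H1_norm_ge always_eventually)
  have at: "at t within {0..} = at t" if "t > 0" for t :: real
    using that by (intro at_within_interior) simp
  have cont_lap: "((\<lambda>s. L2_norm (\<lambda>x. laplacian (u s) x - laplacian (u t) x)) \<longlongrightarrow> 0) (at t)" if "t > 0" for t
  proof (rule Lim_null_comparison[OF _ tendsto_mult_right_zero[OF cont_H2[OF that]]])
    have "\<forall>\<^sub>F s in at t. s \<in> {0<..}" using that by (intro eventually_at_in_open') auto
    then show "\<forall>\<^sub>F s in at t. norm (L2_norm (\<lambda>x. laplacian (u s) x - laplacian (u t) x))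
        \<le> real DIM('a) * H2_norm (\<lambda>x. u s x - u t x)"
    proof eventually_elim
      case (elim s)
      then show ?case using L2_norm_laplacian_diff[OF H2 H2[OF that], of s] by simp
    qed
  qed
  define N where "N t = power_nonlinearity \<alpha> (u t)" for t
  define F where "F t x = laplacian (u t) x + N t x" for t x
  have N: "N t \<in> L2" if "t \<ge> 0" for t
    unfolding N_def by (rule power_nonlinearity_L2(1)[OF \<alpha> L2[OF that] C0_le_sup_norm[OF C0[OF that]]])
  have F: "F t \<in> L2" if "t > 0" for t
    unfolding F_def[abs_def] using that by (intro L2_add laplacian_L2 H2 N) auto
  define M where "M t = (L2_norm (u t))\<^sup>2" for t
  define J where "J t = potential \<alpha> (u t) - dirichlet (u t)" for t
  define K where "K t = (L2_norm (F t))\<^sup>2" for t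
  have uF: "l2_inner (u t) (F t) = of_real (J t)" if "t > 0" for t
  proof -
    have "l2_inner (u t) (F t) = l2_inner (u t) (laplacian (u t)) + l2_inner (u t) (N t)"
      unfolding F_def[abs_def] using that by (intro l2_inner_add_right laplacian_L2 H2 N L2) auto
    also have "\<dots> = of_real (J t)"
      unfolding J_def N_def
      using green_identity_self[OF H2[OF that]] that
        potential_integrable(2)[OF \<alpha> L2[of t] C0_le_sup_norm[OF C0[of t]]]
      by simp
    finally show ?thesis .
  qed
  have Fu: "l2_inner (F t) (u t) = of_real (J t)" if "t > 0" for t
    using uF[OF that] l2_inner_cnj[of "u t" "F t"] by simp
  have v_inner: "l2_inner (v t) w = cis \<theta> * l2_inner (F t) w + of_real \<gamma> * l2_inner (u t) w"
    if t: "t > 0" and w: "w \<in> L2" for t w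
  proof -
    have vL2: "v t \<in> L2" using v[OF t] by (simp add: has_L2_time_deriv_def)
    have 1: "(\<lambda>x. cis \<theta> * F t x) \<in> L2" "(\<lambda>x. complex_of_real \<gamma> * u t x) \<in> L2"
      using t by (auto intro!: L2_cmult F L2)
    have "l2_inner (v t) w = l2_inner (\<lambda>x. cis \<theta> * F t x + complex_of_real \<gamma> * u t x) w"
      by (rule l2_inner_cong_AE[OF _ vL2 L2_add[OF 1] w])
        (use eqn[OF t] in \<open>simp add: F_def N_def power_nonlinearity_def\<close>)
    also have "\<dots> = cis \<theta> * l2_inner (F t) w + of_real \<gamma> * l2_inner (u t) w"
      by (simp only: l2_inner_add_left[OF 1 w] l2_inner_cmult_left)
    finally show ?thesis .
  qed
  show False
  proof (rule virial_blowup[of "cos \<theta>" "- \<gamma>" "\<alpha> + 2" \<xi> M "\<lambda>t. energy \<alpha> (u t)" J K])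
    have ev: "\<forall>\<^sub>F s in at t within {0..}. s \<in> {0..}" for t :: real
      by (simp add: eventually_at_filter)
    show "continuous_on {0..} M"
      unfolding continuous_on_def M_def
      by (intro ballI tendsto_power L2_norm_tendsto cont_L2 L2)
        (auto intro: eventually_mono[OF ev] L2)
    show "continuous_on {0..} (\<lambda>t. energy \<alpha> (u t))"
      unfolding continuous_on_def
      by (intro ballI energy_tendsto \<alpha> cont_sup cont_H1 H1 C0)
        (auto intro: eventually_mono[OF ev] H1 C0)
    fix t :: real assume t: "t > 0"
    have "(M has_real_derivative 2 * Re (l2_inner (v t) (u t))) (at t)"
      unfolding M_def using mass_has_derivative[OF v[OF t] t] L2 cont_L2[of t] t by (simp add: at)
    also have "2 * Re (l2_inner (v t) (u t)) = 2 * (cos \<theta> * J t - (- \<gamma>) * M t)"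
      using v_inner[OF t L2, of t] t by (simp add: Fu l2_inner_self M_def)
    finally show "(M has_real_derivative 2 * (cos \<theta> * J t - - \<gamma> * M t)) (at t)" .
    have "((\<lambda>t. energy \<alpha> (u t)) has_real_derivative - Re (l2_inner (v t) (F t))) (at t)"
      unfolding F_def[abs_def] N_def
      using energy_has_derivative[OF \<alpha> v[OF t] t H2 C0 _ _ cont_lap[OF t]] cont_L2[of t] cont_sup[of t] t
      by (simp add: at)
    also have "- Re (l2_inner (v t) (F t)) = - cos \<theta> * K t + - \<gamma> * J t"
      using v_inner[OF t F[OF t]] t by (simp add: uF l2_inner_self K_def)
    finally show "((\<lambda>t. energy \<alpha> (u t)) has_real_derivative - cos \<theta> * K t + - \<gamma> * J t) (at t)" .
    have "\<bar>J t\<bar> \<le> L2_norm (F t) * L2_norm (u t)"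
      using L2_Cauchy_Schwarz[OF F L2, of t t] t by (simp add: Fu)
    then have "\<bar>J t\<bar>\<^sup>2 \<le> (L2_norm (F t) * L2_norm (u t))\<^sup>2" by (intro power_mono) auto
    then show "(J t)\<^sup>2 \<le> K t * M t" by (simp add: K_def M_def power_mult_distrib)
    have "dirichlet (u t) \<ge> 0" by (simp add: dirichlet_def sum_nonneg)
    then have "\<alpha> * dirichlet (u t) \<ge> 0" using \<alpha> by simp
    moreover have "(\<alpha> + 2) * energy \<alpha> (u t) = (\<alpha> + 2) / 2 * dirichlet (u t) - potential \<alpha> (u t)"
      using \<alpha> H1[of t] t by (simp add: energy_eq right_diff_distrib)
    ultimately show "J t \<ge> - (\<alpha> + 2) * energy \<alpha> (u t)"
      by (simp add: J_def field_simps)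
  qed (use \<theta> \<gamma> \<alpha> \<xi> neg in \<open>auto simp: M_def u0\<close>)
qed


theorem theorem1p2:
  fixes \<theta> \<alpha> \<gamma> \<xi> :: real
    and u0 :: "real ^ 'n \<Rightarrow> complex"
    and u :: "real \<Rightarrow> real ^ 'n \<Rightarrow> complex"
    and T_max :: ereal
  assumes "- pi / 4 < \<theta>" and "\<theta> < pi / 4" and "\<alpha> > 0" and "\<gamma> < 0"
    and "u0 \<in> H1 \<inter> C0"
    and "is_maximal_solution \<theta> \<alpha> \<gamma> u0 T_max u"
    and "(\<alpha> + 2) * cos (2 * \<theta>) + 2 * (1 - cos \<theta>) \<ge> 2 * cos \<theta>"
    and "\<xi> = - (\<gamma> / cos \<theta>) *
           max (1 / \<alpha>) (((\<alpha> + 2) * cos (2 * \<theta>) + 2 * (1 - cos \<theta>)) / 2)"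
    and "energy \<alpha> u0 + \<xi> * (LINT x|lborel. (cmod (u0 x))\<^sup>2) < 0"
  shows "T_max < \<infinity>"
proof (rule ccontr)
  assume "\<not> T_max < \<infinity>"
  then have "T_max = \<infinity>" by simp
  with assms(6) have sol: "is_solution \<theta> \<alpha> \<gamma> u0 \<infinity> u" by (simp add: is_maximal_solution_def)
  have c: "cos \<theta> > 0" using assms(1,2) by (intro cos_gt_zero_pi) auto
  have "cos \<theta> * \<xi> = - \<gamma> * max (1 / \<alpha>) (((\<alpha> + 2) * cos (2 * \<theta>) + 2 * (1 - cos \<theta>)) / 2)"
    using c by (simp add: assms(8))
  \<comment> \<open>By the first entry of the maximum, \<open>(\<alpha> + 2) \<xi> cos \<theta> \<ge> - \<gamma> (\<alpha> + 2) / \<alpha> \<ge> - \<gamma>\<close>.\<close>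
  also have "\<dots> \<ge> - \<gamma> * (1 / \<alpha>)" using assms(4) by (intro mult_left_mono) auto
  finally have "(\<alpha> + 2) * (cos \<theta> * \<xi>) \<ge> (\<alpha> + 2) * (- \<gamma> * (1 / \<alpha>))"
    using assms(3) by (intro mult_left_mono) auto
  moreover have "(\<alpha> + 2) * (- \<gamma> * (1 / \<alpha>)) \<ge> - \<gamma>"
    using assms(3,4) by (simp add: field_simps)
  ultimately have "cos \<theta> * (\<alpha> + 2) * \<xi> \<ge> - \<gamma>" by (simp add: mult_ac)
  from no_global_solution[OF c assms(3,4) sol this] assms(9) show False
    by (simp add: L2_norm_square)
qed

end
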